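(* Let $n\ge9$ and $N'=\{1,2,7,8,\dots,n\}$. For $i\in\{1,\dots,9\}$ let $F_i$ be the chain polynomial obtained by erasing the index $i$ from $\langle 123*456*789\rangle$ (e.g. $F_2=\langle 13*456*789\rangle$). Let $\Psi_{sp}:\mathbb{C}(\widehat{\mathrm{Gr}}_{4,N'})\to\mathbb{C}(\widehat{\mathrm{Gr}}_{4,n})$ be the unary spurion promotion, induced by $$z_2\mapsto\frac{(z_1\wedge z_2)*\big(z_3\wedge((z_4\wedge z_5\wedge z_6)*(z_7\wedge z_8\wedge z_9))\big)}{F_2},\quad z_7\mapsto\frac{(z_1\wedge z_2\wedge z_3)*(z_4\wedge z_5\wedge z_6)*(z_7\wedge z_8\wedge z_9)}{F_7},$$ $$z_8\mapsto\frac{\big(((z_1\wedge z_2\wedge z_3)*(z_4\wedge z_5\wedge z_6))\wedge z_7\big)*(z_8\wedge z_9)}{F_8},$$ and $z_j\mapsto z_j$ for the other $j\in N'$. Then $\Psi_{sp}$ is a quasi-cluster homomorphism from $\mathcal{A}(\Sigma)$ to $\mathcal{A}(\overline{\Sigma})$, where $\Sigma$ is the rectangles seed for $\mathrm{Gr}_{4,N'}$, and $\overline{\Sigma}$ is obtained from the rectangles seed for $\mathrm{Gr}_{4,n}$ by mutating successively at the vertices $(3,8),(3,7),(2,7),(2,6),(2,5),(3,6),(3,5),(3,8),(2,8),(1,8),(1,5)$ and then freezing all vertices $(r,c)$ with $1\le r\le3$, $5\le c\le8$ (whose cluster variables are then $\langle1236\rangle,\langle1237\rangle,\langle3789\ra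ngle,F_1,\dots,F_9$).
   Context: $\mathbb{C}(\widehat{\mathrm{Gr}}_{4,N})$: rational functions in Plücker coordinates $\langle i_1i_2i_3i_4\rangle=\det[z_{i_1}z_{i_2}z_{i_3}z_{i_4}]$ of a $4\times|N|$ matrix with columns $z_i$; substitutions of columns induce homomorphisms. Shuffle product on the exterior algebra of $\mathbb{C}^4$: for $A=a_1\wedge\cdots\wedge a_p$, $B=b_1\wedge\cdots\wedge b_q$, $s=p+q-4$, $A*B=0$ if $s<0$, else $A*B=\sum_w\operatorname{sign}(w)\det[a_{w(1)},\dots,a_{w(4-q)},b_1,\dots,b_q]\,a_{w(4-q+1)}\wedge\cdots\wedge a_{w(p)}$ over permutations $w$ of $[p]$ increasing on the first $4-q$ and the remaining positions; bilinear, associative. A chain polynomial $\langle A*B*C\rangle$ for index sets with pairwise size sums $\ge4$ and total size $8$ is the scalar $(z_{a_1}\wedge\cdots)*(z_{b_1}\wedge\cdots)*(z_{c_1}\wedge\cdots)$. Rectangles seed for $\mathrm{Gr}_{4,N}$, $N=\{a_1<\dots<a_M\}$: vertices $v_0$ (variable $\langle a_1a_2a_3a_4\rangle$) and $(r,c)$, $1\le r\le4$, $5\le c\le M$, with variable $\langle a_1,\dots,a_{4-r},a_{c-r+1},\dots,a_c\rangle$ for $r\le3$ and $\langle a_{c-3},\dots,a_c\rangle$ for $r=4$. Frozen: $v_0$, row $4$, column $M$; mutable: $(r,c)$, $r\le3$, $c\le M-1$. Arrows: $(r,c)\to(r,c+1)$, $(r,c)\to(r+1,c)$, $(r+1,c+1)\to(r,c)$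 for $r\le3$, $c\le M-1$, and $v_0\to(1,5)$. Cluster algebras: seeds (cluster + quiver with mutable and frozen vertices), mutation $x_k'x_k=\prod_{i\to k}x_i+\prod_{k\to i}x_i$ with quiver mutation; $\mathcal{A}(\Sigma)$ generated by cluster variables over Laurent polynomials in frozen variables; $\mathbb{M}$ = Laurent monomials in frozen variables; exchange ratio $\hat y_\Sigma(x_i)=\prod_{i\to j}x_j/\prod_{j\to i}x_j$. A quasi-cluster homomorphism of equal-rank cluster algebras is an algebra homomorphism $f$ with $f(\mathbb{M})\subseteq\overline{\mathbb{M}}$ such that for some seeds $\Sigma,\overline{\Sigma}$ and a bijection of mutable vertices $i\mapsto\bar i$, $f(x_i)\in\overline{\mathbb{M}}\,\bar x_{\bar i}$ and $f(\hat y_\Sigma(x_i))=\hat y_{\overline{\Sigma}}(\bar x_{\bar i})$. *)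

theory Defs
  imports
    "HOL-Library.Poly_Mapping"
    "HOL-Library.Nat_Bijection"
    "HOL-Computational_Algebra.Fraction_Field"
    "HOL-Combinatorics.Permutations"
    "Jordan_Normal_Form.Determinant"
begin

section \<open>Rational functions in the entries of a matrix with four rows\<close>

text \<open>
  The polynomial variable with number \<open>prod_encode (i, j)\<close> is the entry in row \<open>i\<close> (with
  \<open>i < 4\<close>) and column \<open>j\<close> of a generic matrix.  Columns carry arbitrary natural numbers as
  labels, so the function fields for all index sets \<open>N\<close> are subfields of one ambient field.
\<close>

type_synonym mpoly = "(nat \<Rightarrow>\<^sub>0 nat) \<Rightarrow>\<^sub>0 complex"
type_synonym ratfun = "mpoly fract"

definition const :: "complex \<Rightarrow> ratfun" where
  "const c = Fract (Poly_Mapping.single 0 c) 1"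

definition var :: "nat \<Rightarrow> nat \<Rightarrow> ratfun" where
  "var i j = Fract (Poly_Mapping.single (Poly_Mapping.single (prod_encode (i, j)) 1) 1) 1"

definition zcol :: "nat \<Rightarrow> ratfun vec" where
  "zcol j = vec 4 (\<lambda>i. var i j)"

definition plucker :: "nat list \<Rightarrow> ratfun" where
  "plucker js = det (mat_of_cols 4 (map zcol js))"

text \<open>Complex subalgebra, respectively subfield, generated by a set of rational functions.\<close>

inductive_set algebra_generated :: "ratfun set \<Rightarrow> ratfun set" for G where
  const: "const c \<in> algebra_generated G"
| gen: "x \<in> G \<Longrightarrow> x \<in> algebra_generated G"
| add: "x \<in> algebra_generated G \<Longrightarrow> y \<in> algebra_generated G \<Longrightarrow> x + y \<in> algebra_generated G"
| mult: "x \<in> algebra_generated G \<Longrightarrow> y \<in> algebra_generated G \<Longrightarrow> x * y \<in> algebra_generated G"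

inductive_set field_generated :: "ratfun set \<Rightarrow> ratfun set" for G where
  const: "const c \<in> field_generated G"
| gen: "x \<in> G \<Longrightarrow> x \<in> field_generated G"
| add: "x \<in> field_generated G \<Longrightarrow> y \<in> field_generated G \<Longrightarrow> x + y \<in> field_generated G"
| mult: "x \<in> field_generated G \<Longrightarrow> y \<in> field_generated G \<Longrightarrow> x * y \<in> field_generated G"
| inverse: "x \<in> field_generated G \<Longrightarrow> inverse x \<in> field_generated G"

definition gr_field :: "nat set \<Rightarrow> ratfun set" where
  "gr_field N = field_generated {plucker js | js. length js = 4 \<and> set js \<subseteq> N}"

definition algebra_hom :: "(ratfun \<Rightarrow> ratfun) \<Rightarrow> ratfun set \<Rightarrow> ratfun set \<Rightarrow> bool" where
  "algebra_hom f A B \<longleftrightarrow>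
     f ` A \<subseteq> B \<and> (\<forall>c. f (const c) = const c) \<and>
     (\<forall>x\<in>A. \<forall>y\<in>A. f (x + y) = f x + f y \<and> f (x * y) = f x * f y)"


section \<open>Substitution of columns\<close>

definition mpoly_eval :: "(nat \<Rightarrow> ratfun) \<Rightarrow> mpoly \<Rightarrow> ratfun" where
  "mpoly_eval s p =
     (\<Sum>m \<in> Poly_Mapping.keys p. const (Poly_Mapping.lookup p m) *
        (\<Prod>v \<in> Poly_Mapping.keys m. s v ^ Poly_Mapping.lookup m v))"

definition entries_subst :: "(nat \<Rightarrow> ratfun vec) \<Rightarrow> nat \<Rightarrow> ratfun" where
  "entries_subst t v = (case prod_decode v of (i, j) \<Rightarrow> t j $ i)"

text \<open>
  Substituting the vector \<open>t j\<close> for the column with label \<open>j\<close> is possible in a rational function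
  if one of its representations as a quotient keeps a nonzero denominator; the value
  does not depend on that representation.
\<close>

definition column_subst :: "(nat \<Rightarrow> ratfun vec) \<Rightarrow> ratfun \<Rightarrow> ratfun" where
  "column_subst t x =
     (THE y. \<exists>p q. x = Fract p q \<and> mpoly_eval (entries_subst t) q \<noteq> 0 \<and>
        y = mpoly_eval (entries_subst t) p / mpoly_eval (entries_subst t) q)"


section \<open>Exterior algebra of a four-dimensional space\<close>

text \<open>
  An element is given by its coordinates: the set \<open>S \<subseteq> {..<4}\<close> is sent to the coefficient of the
  basis element \<open>e_S\<close>, the wedge product of the unit vectors \<open>e_i\<close>, \<open>i \<in> S\<close>, in increasing order.
\<close>

type_synonym 'a ext = "nat set \<Rightarrow> 'a"

definition ext_one :: "'a::field ext" where
  "ext_one S = (if S = {} then 1 else 0)"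

definition ext_of_vec :: "'a::field vec \<Rightarrow> 'a ext" where
  "ext_of_vec v S = (\<Sum>i<4. if S = {i} then v $ i else 0)"

definition vec_of_ext :: "'a::field ext \<Rightarrow> 'a vec" where
  "vec_of_ext A = vec 4 (\<lambda>i. A {i})"

definition scalar_of_ext :: "'a::field ext \<Rightarrow> 'a" where
  "scalar_of_ext A = A {}"

definition ext_wedge :: "'a::field ext \<Rightarrow> 'a ext \<Rightarrow> 'a ext"  (infixr "\<curlywedge>" 75) where
  "(A \<curlywedge> B) U =
     (\<Sum>S \<in> Pow U. (-1) ^ card {(i, j). i \<in> S \<and> j \<in> U - S \<and> j < i} * A S * B (U - S))"

definition wedge_list :: "'a::field vec list \<Rightarrow> 'a ext" where
  "wedge_list vs = foldr (\<lambda>v A. ext_of_vec v \<curlywedge> A) vs ext_one"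

text \<open>
  The shuffle product of \<open>a_1 \<and> \<dots> \<and> a_p\<close> and \<open>b_1 \<and> \<dots> \<and> b_q\<close>, for lists of at most four vectors;
  positions are counted from 0.
\<close>

definition shuffle_decomposable :: "'a::field vec list \<Rightarrow> 'a vec list \<Rightarrow> 'a ext" where
  "shuffle_decomposable as bs U =
     (let p = length as; q = length bs in
      if p + q < 4 then 0
      else (\<Sum>w | w permutes {..<p} \<and> strict_mono_on {..<4 - q} w \<and> strict_mono_on {4 - q..<p} w.
              of_int (sign w) *
              det (mat_of_cols 4 (map (\<lambda>i. as ! w i) [0..<4 - q] @ bs)) *
              wedge_list (map (\<lambda>i. as ! w i) [4 - q..<p]) U))"

definition basis_vecs :: "nat set \<Rightarrow> 'a::field vec list" where
  "basis_vecs S = map (unit_vec 4) (sorted_list_of_set S)"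

text \<open>Bilinear extension from the basis elements \<open>e_S\<close>.\<close>

definition ext_shuffle :: "'a::field ext \<Rightarrow> 'a ext \<Rightarrow> 'a ext"  (infixl "\<star>" 70) where
  "(A \<star> B) U =
     (\<Sum>S \<in> Pow {..<4}. \<Sum>T \<in> Pow {..<4}.
        A S * B T * shuffle_decomposable (basis_vecs S) (basis_vecs T) U)"

definition zw :: "nat list \<Rightarrow> ratfun ext" where
  "zw js = wedge_list (map zcol js)"

definition chain :: "nat list \<Rightarrow> nat list \<Rightarrow> nat list \<Rightarrow> ratfun" where
  "chain as bs cs = scalar_of_ext (zw as \<star> zw bs \<star> zw cs)"


section \<open>Cluster algebras\<close>

text \<open>\<open>arrows \<Sigma> i j\<close> is the number of arrows from \<open>i\<close> to \<open>j\<close>.\<close>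

record 'v seed =
  vertices :: "'v set"
  frozen :: "'v set"
  cluster :: "'v \<Rightarrow> ratfun"
  arrows :: "'v \<Rightarrow> 'v \<Rightarrow> nat"

definition mutable :: "'v seed \<Rightarrow> 'v set" where
  "mutable \<Sigma> = vertices \<Sigma> - frozen \<Sigma>"

text \<open>
  Quiver mutation: add an arrow \<open>i \<rightarrow> j\<close> for every path \<open>i \<rightarrow> k \<rightarrow> j\<close> and reverse all arrows at \<open>k\<close>;
  then cancel 2-cycles (by truncated subtraction).
\<close>

definition quiver_mutation :: "'v \<Rightarrow> ('v \<Rightarrow> 'v \<Rightarrow> nat) \<Rightarrow> 'v \<Rightarrow> 'v \<Rightarrow> nat" where
  "quiver_mutation k q i j =
     (let q' = (\<lambda>i j. if i = k \<or> j = k then q j i else q i j + q i k * q k j)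
      in q' i j - q' j i)"

definition mutate :: "'v \<Rightarrow> 'v seed \<Rightarrow> 'v seed" where
  "mutate k \<Sigma> = \<Sigma>\<lparr>
     cluster := (cluster \<Sigma>)(k :=
       ((\<Prod>i\<in>vertices \<Sigma>. cluster \<Sigma> i ^ arrows \<Sigma> i k) +
        (\<Prod>i\<in>vertices \<Sigma>. cluster \<Sigma> i ^ arrows \<Sigma> k i)) / cluster \<Sigma> k),
     arrows := quiver_mutation k (arrows \<Sigma>)\<rparr>"

definition freeze :: "'v set \<Rightarrow> 'v seed \<Rightarrow> 'v seed" where
  "freeze F \<Sigma> = \<Sigma>\<lparr>frozen := frozen \<Sigma> \<union> F\<rparr>"

inductive_set mutation_class :: "'v seed \<Rightarrow> 'v seed set" for \<Sigma> where
  initial: "\<Sigma> \<in> mutation_class \<Sigma>"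
| step: "\<Sigma>' \<in> mutation_class \<Sigma> \<Longrightarrow> k \<in> mutable \<Sigma>' \<Longrightarrow> mutate k \<Sigma>' \<in> mutation_class \<Sigma>"

definition cluster_variables :: "'v seed \<Rightarrow> ratfun set" where
  "cluster_variables \<Sigma> = (\<Union>\<Sigma>'\<in>mutation_class \<Sigma>. cluster \<Sigma>' ` mutable \<Sigma>')"

definition cluster_algebra :: "'v seed \<Rightarrow> ratfun set" where
  "cluster_algebra \<Sigma> = algebra_generated
     (cluster_variables \<Sigma> \<union> cluster \<Sigma> ` frozen \<Sigma> \<union> (\<lambda>v. inverse (cluster \<Sigma> v)) ` frozen \<Sigma>)"

definition frozen_monomials :: "'v seed \<Rightarrow> ratfun set" where
  "frozen_monomials \<Sigma> = {\<Prod>v\<in>frozen \<Sigma>. cluster \<Sigma> v powi e v | e. True}"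

definition exchange_ratio :: "'v seed \<Rightarrow> 'v \<Rightarrow> ratfun" where
  "exchange_ratio \<Sigma> i =
     (\<Prod>j\<in>vertices \<Sigma>. cluster \<Sigma> j ^ arrows \<Sigma> i j) / (\<Prod>j\<in>vertices \<Sigma>. cluster \<Sigma> j ^ arrows \<Sigma> j i)"

text \<open>
  Exchange ratios are quotients of elements of the cluster algebra, so \<open>f\<close> is meant to be the
  restriction of a homomorphism that is also defined on these quotients.  Equality of the ranks
  is part of the bijection of mutable vertices.
\<close>

definition quasi_cluster_hom :: "(ratfun \<Rightarrow> ratfun) \<Rightarrow> 'v seed \<Rightarrow> 'w seed \<Rightarrow> bool" where
  "quasi_cluster_hom f \<Sigma>\<^sub>0 \<Sigma>\<^sub>1 \<longleftrightarrow>
     algebra_hom f (cluster_algebra \<Sigma>\<^sub>0) (cluster_algebra \<Sigma>\<^sub>1) \<and>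
     f ` frozen_monomials \<Sigma>\<^sub>0 \<subseteq> frozen_monomials \<Sigma>\<^sub>1 \<and>
     (\<exists>\<Sigma> \<in> mutation_class \<Sigma>\<^sub>0. \<exists>\<Sigma>' \<in> mutation_class \<Sigma>\<^sub>1. \<exists>\<beta>.
        bij_betw \<beta> (mutable \<Sigma>) (mutable \<Sigma>') \<and>
        (\<forall>i \<in> mutable \<Sigma>.
           (\<exists>m \<in> frozen_monomials \<Sigma>\<^sub>1. f (cluster \<Sigma> i) = m * cluster \<Sigma>' (\<beta> i)) \<and>
           f (exchange_ratio \<Sigma> i) = exchange_ratio \<Sigma>' (\<beta> i)))"


section \<open>Rectangles seeds\<close>

datatype vertex = V\<^sub>0 | V nat nat

definition rect_indices :: "nat \<Rightarrow> nat \<Rightarrow> nat list" where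
  "rect_indices r c = [1..<5 - r] @ [c + 1 - r..<c + 1]"

definition rect_arrow :: "nat \<Rightarrow> vertex \<Rightarrow> vertex \<Rightarrow> bool" where
  "rect_arrow M u v \<longleftrightarrow>
     (u = V\<^sub>0 \<and> v = V 1 5) \<or>
     (\<exists>r c. 1 \<le> r \<and> r \<le> 3 \<and> 5 \<le> c \<and> c < M \<and>
        (u = V r c \<and> v = V r (c + 1) \<or>
         u = V r c \<and> v = V (r + 1) c \<or>
         u = V (r + 1) (c + 1) \<and> v = V r c))"

text \<open>For a finite \<open>N\<close> with at least five elements; \<open>a i\<close> is its \<open>i\<close>-th element, counted from 1.\<close>

definition rectangles_seed :: "nat set \<Rightarrow> vertex seed" where
  "rectangles_seed N =
     (let M = card N; a = (\<lambda>i. sorted_list_of_set N ! (i - 1)) in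
      \<lparr>vertices = insert V\<^sub>0 {V r c | r c. 1 \<le> r \<and> r \<le> 4 \<and> 5 \<le> c \<and> c \<le> M},
       frozen = insert V\<^sub>0 {V r c | r c. 1 \<le> r \<and> r \<le> 4 \<and> 5 \<le> c \<and> c \<le> M \<and> (r = 4 \<or> c = M)},
       cluster = (\<lambda>v. case v of V\<^sub>0 \<Rightarrow> plucker (map a [1, 2, 3, 4])
                              | V r c \<Rightarrow> plucker (map a (rect_indices r c))),
       arrows = (\<lambda>u v. if rect_arrow M u v then 1 else 0)\<rparr>)"


section \<open>Unary spurion promotion\<close>

definition spurion_index_set :: "nat \<Rightarrow> nat set" where
  "spurion_index_set n = {1, 2} \<union> {7..n}"

definition spurion_F :: "nat \<Rightarrow> ratfun" where
  "spurion_F i = chain (remove1 i [1, 2, 3]) (remove1 i [4, 5, 6]) (remove1 i [7, 8, 9])"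

definition spurion_columns :: "nat \<Rightarrow> ratfun vec" where
  "spurion_columns j =
     (if j = 2 then inverse (spurion_F 2) \<cdot>\<^sub>v
        vec_of_ext (zw [1, 2] \<star> (zw [3] \<curlywedge> (zw [4, 5, 6] \<star> zw [7, 8, 9])))
      else if j = 7 then inverse (spurion_F 7) \<cdot>\<^sub>v
        vec_of_ext (zw [1, 2, 3] \<star> zw [4, 5, 6] \<star> zw [7, 8, 9])
      else if j = 8 then inverse (spurion_F 8) \<cdot>\<^sub>v
        vec_of_ext (((zw [1, 2, 3] \<star> zw [4, 5, 6]) \<curlywedge> zw [7]) \<star> zw [8, 9])
      else zcol j)"

definition spurion_promotion :: "ratfun \<Rightarrow> ratfun" where
  "spurion_promotion = column_subst spurion_columns"

definition spurion_frozen_vertices :: "vertex set" where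
  "spurion_frozen_vertices = {V r c | r c. 1 \<le> r \<and> r \<le> 3 \<and> 5 \<le> c \<and> c \<le> 8}"

definition spurion_seed :: "nat \<Rightarrow> vertex seed" where
  "spurion_seed n =
     freeze spurion_frozen_vertices
       (fold mutate
          [V 3 8, V 3 7, V 2 7, V 2 6, V 2 5, V 3 6, V 3 5, V 3 8, V 2 8, V 1 8, V 1 5]
          (rectangles_seed {1..n}))"

end

theory Submission
  imports Defs
begin

text \<open>
  Write \<open>\<psi> v = \<langle>v 4 5 6\<rangle>\<close> and \<open>\<phi> v = \<langle>v 7 8 9\<rangle>\<close>.  Every \<open>F\<^sub>i\<close> is a binomial in Pluecker coordinates, for
  instance \<open>F\<^sub>3 = \<psi> 1 \<phi> 2 - \<psi> 2 \<phi> 1\<close>, and each of the eleven exchange relations reduces to three-term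
  Pluecker relations and Cramer's rule; the only cluster variable on the way that is not named in
  the theorem is \<open>\<langle>12 * 567 * 789\<rangle>\<close>.  The substituted columns are
  \<open>z\<^sub>2 - (F\<^sub>1 / F\<^sub>2) z\<^sub>1\<close>, \<open>z\<^sub>7 - (F\<^sub>8 / F\<^sub>7) z\<^sub>8 + (F\<^sub>9 / F\<^sub>7) z\<^sub>9 = (F\<^sub>3 z\<^sub>3 - F\<^sub>2 z\<^sub>2 + F\<^sub>1 z\<^sub>1) / F\<^sub>7\<close> and
  \<open>z\<^sub>8 - (F\<^sub>9 / F\<^sub>8) z\<^sub>9\<close>, so the vertex \<open>(r, c)\<close> of the first seed corresponds to \<open>(r, c + 4)\<close>, with the
  factor \<open>F\<^sub>3 / F\<^sub>7\<close> in row 1 and the factor 1 in rows 2 and 3.  Exchange ratios mutate by a formula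
  in exchange ratios only, hence a match of one pair of seeds propagates to all seeds, and with it
  the inclusion of cluster algebras.  All cluster variables are positive at a Vandermonde matrix, in
  particular nonzero.
\<close>

section \<open>Evaluation of polynomials and substitution\<close>

text \<open>Two obstacles shape the proof. A substitution of columns has a value only where some
  denominator survives, so \<open>column_subst\<close> is a homomorphism on a local ring, whereas
  exchange ratios and inverses of frozen variables require a field. Hence everything is restricted
  to functions of the entries in the columns of \<open>N'\<close>, where no nonzero denominator is
  killed. Moreover \<open>n\<close> is arbitrary; but all mutations take place in columns 5 to 8, so
  the arrows meeting these columns form a fixed finite list that can be computed with, and the
  others are untouched. The factor in row 1 is harmless because an exchange ratio away from the
  first mutable column contains as many variables of row 1 in the numerator as in the denominator.
  The exchange ratios have to match exactly, not only up to frozen monomials: this is what gives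
  both terms of an exchange relation the same frozen factor.\<close>

lemma const_0 [simp]: "const 0 = 0"
  by (simp add: const_def Zero_fract_def)

lemma const_1 [simp]: "const 1 = 1"
  by (simp add: const_def One_fract_def)

lemma const_add: "const (a + b) = const a + const b"
  by (simp add: const_def single_add)

lemma const_mult: "const (a * b) = const a * const b"
  by (simp add: const_def mult_single)

lemma const_eq_iff [simp]: "const a = const b \<longleftrightarrow> a = b"
  by (simp add: const_def eq_fract inj_single[THEN inj_eq])

lemma const_uminus: "const (- a) = - const a"
  by (metis const_0 const_add eq_neg_iff_add_eq_0)

lemma const_diff: "const (a - b) = const a - const b"
  using const_add[of a "- b"] by (simp add: const_uminus)

lemma const_inverse: "const (inverse a) = inverse (const a)"
proof (cases "a = 0")
  case False
  then have "const (inverse a) * const a = 1"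
    by (simp flip: const_mult)
  then show ?thesis
    by (metis inverse_unique mult.commute)
qed simp

definition monom_eval :: "(nat \<Rightarrow> ratfun) \<Rightarrow> (nat \<Rightarrow>\<^sub>0 nat) \<Rightarrow> ratfun" where
  "monom_eval s m = (\<Prod>v\<in>Poly_Mapping.keys m. s v ^ Poly_Mapping.lookup m v)"

lemma monom_eval_superset:
  assumes "finite K" "Poly_Mapping.keys m \<subseteq> K"
  shows "monom_eval s m = (\<Prod>v\<in>K. s v ^ Poly_Mapping.lookup m v)"
  unfolding monom_eval_def
  by (rule prod.mono_neutral_left) (use assms in \<open>auto simp: in_keys_iff\<close>)

lemma monom_eval_0 [simp]: "monom_eval s 0 = 1"
  by (simp add: monom_eval_def)

lemma monom_eval_add: "monom_eval s (m + m') = monom_eval s m * monom_eval s m'"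
proof -
  let ?K = "Poly_Mapping.keys m \<union> Poly_Mapping.keys m'"
  have K: "finite ?K" "Poly_Mapping.keys (m + m') \<subseteq> ?K"
    using keys_add[of m m'] by auto
  have "monom_eval s (m + m') = (\<Prod>v\<in>?K. s v ^ Poly_Mapping.lookup (m + m') v)"
    by (rule monom_eval_superset[OF K])
  also have "\<dots> = (\<Prod>v\<in>?K. s v ^ Poly_Mapping.lookup m v) * (\<Prod>v\<in>?K. s v ^ Poly_Mapping.lookup m' v)"
    by (simp add: lookup_add power_add prod.distrib)
  finally show ?thesis
    using K by (simp add: monom_eval_superset[of ?K])
qed

lemma mpoly_eval_superset:
  assumes "finite K" "Poly_Mapping.keys p \<subseteq> K"
  shows "mpoly_eval s p = (\<Sum>m\<in>K. const (Poly_Mapping.lookup p m) * monom_eval s m)"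
  unfolding mpoly_eval_def monom_eval_def[symmetric]
  by (rule sum.mono_neutral_left) (use assms in \<open>auto simp: in_keys_iff\<close>)

lemma mpoly_eval_0 [simp]: "mpoly_eval s 0 = 0"
  by (simp add: mpoly_eval_def)

lemma mpoly_eval_single: "mpoly_eval s (Poly_Mapping.single m c) = const c * monom_eval s m"
  by (subst mpoly_eval_superset[of "{m}"]) auto

lemma mpoly_eval_add: "mpoly_eval s (p + q) = mpoly_eval s p + mpoly_eval s q"
proof -
  let ?K = "Poly_Mapping.keys p \<union> Poly_Mapping.keys q"
  have K: "finite ?K" "Poly_Mapping.keys (p + q) \<subseteq> ?K"
    using keys_add[of p q] by auto
  show ?thesis
    using K by (simp add: mpoly_eval_superset[of ?K] lookup_add const_add algebra_simps sum.distrib)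
qed

lemma mpoly_eval_sum: "mpoly_eval s (\<Sum>i\<in>I. p i) = (\<Sum>i\<in>I. mpoly_eval s (p i))"
  by (induction I rule: infinite_finite_induct) (auto simp: mpoly_eval_add)

lemma mpoly_sum_monomials:
  fixes p :: "'a \<Rightarrow>\<^sub>0 'b::comm_monoid_add"
  shows "p = (\<Sum>m\<in>Poly_Mapping.keys p. Poly_Mapping.single m (Poly_Mapping.lookup p m))"
  by (rule poly_mapping_eqI) (simp add: lookup_sum lookup_single when_def in_keys_iff)

lemma mpoly_eval_mult: "mpoly_eval s (p * q) = mpoly_eval s p * mpoly_eval s q"
proof -
  let ?p = "\<lambda>m. Poly_Mapping.single m (Poly_Mapping.lookup p m)"
  let ?q = "\<lambda>m. Poly_Mapping.single m (Poly_Mapping.lookup q m)"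
  have "p * q = (\<Sum>m\<in>Poly_Mapping.keys p. \<Sum>m'\<in>Poly_Mapping.keys q. ?p m * ?q m')"
    by (subst mpoly_sum_monomials[of p], subst mpoly_sum_monomials[of q]) (simp only: sum_product)
  also have "mpoly_eval s \<dots> =
      (\<Sum>m\<in>Poly_Mapping.keys p. \<Sum>m'\<in>Poly_Mapping.keys q. mpoly_eval s (?p m) * mpoly_eval s (?q m'))"
    by (simp add: mpoly_eval_sum mult_single mpoly_eval_single const_mult monom_eval_add algebra_simps)
  also have "\<dots> = mpoly_eval s (\<Sum>m\<in>Poly_Mapping.keys p. ?p m) * mpoly_eval s (\<Sum>m\<in>Poly_Mapping.keys q. ?q m)"
    by (simp only: mpoly_eval_sum sum_product)
  finally show ?thesis
    by (simp flip: mpoly_sum_monomials)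
qed

lemma mpoly_eval_const [simp]: "mpoly_eval s (Poly_Mapping.single 0 c) = const c"
  by (simp add: mpoly_eval_single)

lemma mpoly_eval_1 [simp]: "mpoly_eval s 1 = 1"
  by (metis const_1 mpoly_eval_const single_one)

lemma mpoly_eval_var [simp]:
  "mpoly_eval s (Poly_Mapping.single (Poly_Mapping.single v 1) 1) = s v"
  by (simp add: mpoly_eval_single monom_eval_def)

text \<open>Evaluation at the generic point. This recovers a polynomial once a second substitution
  has undone a first one.\<close>

lemma mpoly_eval_id: "mpoly_eval (\<lambda>v. Fract (Poly_Mapping.single (Poly_Mapping.single v 1) 1) 1) p = Fract p 1"
proof -
  let ?s = "\<lambda>v. Fract (Poly_Mapping.single (Poly_Mapping.single v 1) 1) (1 :: mpoly)"
  have fract_sum: "Fract (\<Sum>i\<in>I. f i) 1 = (\<Sum>i\<in>I. Fract (f i) 1)" for I and f :: "(nat \<Rightarrow>\<^sub>0 nat) \<Rightarrow> mpoly"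
  proof (induction I rule: infinite_finite_induct)
    case (insert i I)
    show ?case
      unfolding sum.insert[OF insert.hyps] insert.IH[symmetric] by simp
  qed (auto simp: Zero_fract_def)
  have pow: "?s v ^ k = Fract (Poly_Mapping.single (Poly_Mapping.single v k) 1) 1" for v k
    by (induction k) (auto simp: One_fract_def mult_single simp flip: single_add)
  have fract_prod: "(\<Prod>v\<in>V. Fract (Poly_Mapping.single (f v) 1) 1) =
      Fract (Poly_Mapping.single (\<Sum>v\<in>V. f v) 1) (1 :: mpoly)" for V and f :: "nat \<Rightarrow> nat \<Rightarrow>\<^sub>0 nat"
    by (induction V rule: infinite_finite_induct) (auto simp: mult_single One_fract_def)
  have "monom_eval ?s m = Fract (Poly_Mapping.single m 1) 1" for m
    unfolding monom_eval_def pow fract_prod by (simp flip: mpoly_sum_monomials)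
  then have "mpoly_eval ?s p =
      (\<Sum>m\<in>Poly_Mapping.keys p. Fract (Poly_Mapping.single m (Poly_Mapping.lookup p m)) 1)"
    unfolding mpoly_eval_def monom_eval_def[symmetric] by (simp add: const_def mult_single)
  also have "\<dots> = Fract p 1"
    by (simp flip: fract_sum mpoly_sum_monomials)
  finally show ?thesis .
qed

lemma mpoly_eval_entries_id: "mpoly_eval (\<lambda>v. case prod_decode v of (i, j) \<Rightarrow> var i j) p = Fract p 1"
proof -
  have "(\<lambda>v. case prod_decode v of (i, j) \<Rightarrow> var i j) =
      (\<lambda>v. Fract (Poly_Mapping.single (Poly_Mapping.single v 1) 1) (1 :: mpoly))"
    by (auto simp: fun_eq_iff var_def split: prod.split)
  then show ?thesis
    using mpoly_eval_id by simp
qed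

section \<open>The local ring on which a substitution is defined\<close>

definition subst_dom :: "(nat \<Rightarrow> ratfun vec) \<Rightarrow> ratfun set" where
  "subst_dom t = {Fract p q | p q. mpoly_eval (entries_subst t) q \<noteq> 0}"

text \<open>Equal fractions satisfy \<open>p * q' = p' * q\<close>, and evaluation preserves this
  identity; so all representations with a surviving denominator give the same quotient, and the
  definite description has a unique witness.\<close>

lemma column_subst_Fract:
  assumes "mpoly_eval (entries_subst t) q \<noteq> 0"
  shows "column_subst t (Fract p q) = mpoly_eval (entries_subst t) p / mpoly_eval (entries_subst t) q"
proof -
  let ?e = "mpoly_eval (entries_subst t)"
  have "?e p / ?e q = ?e p' / ?e q'" if "Fract p q = Fract p' q'" "?e q' \<noteq> 0" for p' q'
  proof -
    have "q \<noteq> 0" "q' \<noteq> 0"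
      using assms that by auto
    then have "p * q' = p' * q"
      using that by (simp add: eq_fract)
    then have "?e p * ?e q' = ?e p' * ?e q"
      by (metis mpoly_eval_mult)
    then show ?thesis
      using assms that by (simp add: frac_eq_eq)
  qed
  then show ?thesis
    unfolding column_subst_def using assms by (intro the_equality) metis+
qed

lemma subst_dom_cases:
  assumes "x \<in> subst_dom t"
  obtains p q where "x = Fract p q" "mpoly_eval (entries_subst t) q \<noteq> 0" "q \<noteq> 0"
    "column_subst t x = mpoly_eval (entries_subst t) p / mpoly_eval (entries_subst t) q"
  using assms column_subst_Fract unfolding subst_dom_def by fastforce

lemma subst_polynomial:
  "Fract p 1 \<in> subst_dom t" "column_subst t (Fract p 1) = mpoly_eval (entries_subst t) p"
proof -
  have "mpoly_eval (entries_subst t) 1 \<noteq> 0"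
    by simp
  then show "Fract p 1 \<in> subst_dom t"
    unfolding subst_dom_def by blast
  show "column_subst t (Fract p 1) = mpoly_eval (entries_subst t) p"
    using column_subst_Fract[of t 1 p] by simp
qed

lemma subst_const: "const c \<in> subst_dom t" "column_subst t (const c) = const c"
  unfolding const_def by (simp_all add: subst_polynomial) (simp add: const_def)

lemma subst_var: "var i j \<in> subst_dom t" "column_subst t (var i j) = t j $ i"
  unfolding var_def by (simp_all only: subst_polynomial mpoly_eval_var) (simp add: entries_subst_def)

lemma subst_add:
  assumes "x \<in> subst_dom t" "y \<in> subst_dom t"
  shows "x + y \<in> subst_dom t" "column_subst t (x + y) = column_subst t x + column_subst t y"
proof -
  obtain p q where x: "x = Fract p q" "mpoly_eval (entries_subst t) q \<noteq> 0" "q \<noteq> 0"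
    "column_subst t x = mpoly_eval (entries_subst t) p / mpoly_eval (entries_subst t) q"
    by (rule subst_dom_cases[OF assms(1)])
  obtain p' q' where y: "y = Fract p' q'" "mpoly_eval (entries_subst t) q' \<noteq> 0" "q' \<noteq> 0"
    "column_subst t y = mpoly_eval (entries_subst t) p' / mpoly_eval (entries_subst t) q'"
    by (rule subst_dom_cases[OF assms(2)])
  have s: "x + y = Fract (p * q' + p' * q) (q * q')"
    using x y by simp
  have nz: "mpoly_eval (entries_subst t) (q * q') \<noteq> 0"
    using x y by (simp add: mpoly_eval_mult)
  show "x + y \<in> subst_dom t"
    unfolding s subst_dom_def using nz by blast
  show "column_subst t (x + y) = column_subst t x + column_subst t y"
    unfolding s column_subst_Fract[OF nz]
    using x y by (simp add: mpoly_eval_mult mpoly_eval_add add_frac_eq)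
qed

lemma subst_mult:
  assumes "x \<in> subst_dom t" "y \<in> subst_dom t"
  shows "x * y \<in> subst_dom t" "column_subst t (x * y) = column_subst t x * column_subst t y"
proof -
  obtain p q where x: "x = Fract p q" "mpoly_eval (entries_subst t) q \<noteq> 0" "q \<noteq> 0"
    "column_subst t x = mpoly_eval (entries_subst t) p / mpoly_eval (entries_subst t) q"
    by (rule subst_dom_cases[OF assms(1)])
  obtain p' q' where y: "y = Fract p' q'" "mpoly_eval (entries_subst t) q' \<noteq> 0" "q' \<noteq> 0"
    "column_subst t y = mpoly_eval (entries_subst t) p' / mpoly_eval (entries_subst t) q'"
    by (rule subst_dom_cases[OF assms(2)])
  have s: "x * y = Fract (p * p') (q * q')"
    using x y by simp
  have nz: "mpoly_eval (entries_subst t) (q * q') \<noteq> 0"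
    using x y by (simp add: mpoly_eval_mult)
  show "x * y \<in> subst_dom t"
    unfolding s subst_dom_def using nz by blast
  show "column_subst t (x * y) = column_subst t x * column_subst t y"
    unfolding s column_subst_Fract[OF nz]
    using x y by (simp add: mpoly_eval_mult)
qed

text \<open>In a local ring an element is a unit only if its value is nonzero, hence the second
  assumption. On the function field of the columns that are substituted it is discharged later by
  injectivity.\<close>

lemma subst_inverse:
  assumes "x \<in> subst_dom t" "column_subst t x \<noteq> 0"
  shows "inverse x \<in> subst_dom t" "column_subst t (inverse x) = inverse (column_subst t x)"
proof -
  obtain p q where x: "x = Fract p q" "mpoly_eval (entries_subst t) q \<noteq> 0" "q \<noteq> 0"
    "column_subst t x = mpoly_eval (entries_subst t) p / mpoly_eval (entries_subst t) q"
    by (rule subst_dom_cases[OF assms(1)])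
  have nz: "mpoly_eval (entries_subst t) p \<noteq> 0"
    using assms(2) x by auto
  have s: "inverse x = Fract q p"
    using x by simp
  show "inverse x \<in> subst_dom t"
    unfolding s subst_dom_def using nz by blast
  show "column_subst t (inverse x) = inverse (column_subst t x)"
    unfolding s column_subst_Fract[OF nz] using x by simp
qed

lemma subst_uminus:
  assumes "x \<in> subst_dom t"
  shows "- x \<in> subst_dom t" "column_subst t (- x) = - column_subst t x"
  using subst_mult[OF subst_const(1)[where c = "-1"] assms]
  unfolding subst_const(2)[where c = "-1"] by (simp_all add: const_uminus)

lemma subst_diff:
  assumes "x \<in> subst_dom t" "y \<in> subst_dom t"
  shows "x - y \<in> subst_dom t" "column_subst t (x - y) = column_subst t x - column_subst t y"
  using subst_add[OF assms(1) subst_uminus(1)[OF assms(2)]] assms by (simp_all add: subst_uminus)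

lemma subst_divide:
  assumes "x \<in> subst_dom t" "y \<in> subst_dom t" "column_subst t y \<noteq> 0"
  shows "x / y \<in> subst_dom t" "column_subst t (x / y) = column_subst t x / column_subst t y"
  using subst_mult[OF assms(1) subst_inverse(1)[OF assms(2,3)]] assms
  by (simp_all add: subst_inverse divide_inverse)

lemma subst_0 [simp]: "0 \<in> subst_dom t" "column_subst t 0 = 0"
  using subst_const[where c = 0 and t = t] by simp_all

lemma subst_1 [simp]: "1 \<in> subst_dom t" "column_subst t 1 = 1"
  using subst_const[where c = 1 and t = t] by simp_all

lemma subst_power:
  assumes "x \<in> subst_dom t"
  shows "x ^ k \<in> subst_dom t" "column_subst t (x ^ k) = column_subst t x ^ k"
proof -
  have "x ^ k \<in> subst_dom t \<and> column_subst t (x ^ k) = column_subst t x ^ k"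
    using assms by (induction k) (auto simp: subst_mult)
  then show "x ^ k \<in> subst_dom t" "column_subst t (x ^ k) = column_subst t x ^ k"
    by auto
qed

lemma subst_sum:
  assumes "\<And>i. i \<in> I \<Longrightarrow> g i \<in> subst_dom t"
  shows "(\<Sum>i\<in>I. g i) \<in> subst_dom t" "column_subst t (\<Sum>i\<in>I. g i) = (\<Sum>i\<in>I. column_subst t (g i))"
proof -
  have "(\<Sum>i\<in>I. g i) \<in> subst_dom t \<and> column_subst t (\<Sum>i\<in>I. g i) = (\<Sum>i\<in>I. column_subst t (g i))"
    using assms by (induction I rule: infinite_finite_induct) (auto simp: subst_add)
  then show "(\<Sum>i\<in>I. g i) \<in> subst_dom t" "column_subst t (\<Sum>i\<in>I. g i) = (\<Sum>i\<in>I. column_subst t (g i))"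
    by auto
qed

lemma subst_prod:
  assumes "\<And>i. i \<in> I \<Longrightarrow> g i \<in> subst_dom t"
  shows "(\<Prod>i\<in>I. g i) \<in> subst_dom t" "column_subst t (\<Prod>i\<in>I. g i) = (\<Prod>i\<in>I. column_subst t (g i))"
proof -
  have "(\<Prod>i\<in>I. g i) \<in> subst_dom t \<and> column_subst t (\<Prod>i\<in>I. g i) = (\<Prod>i\<in>I. column_subst t (g i))"
    using assms by (induction I rule: infinite_finite_induct) (auto simp: subst_mult)
  then show "(\<Prod>i\<in>I. g i) \<in> subst_dom t" "column_subst t (\<Prod>i\<in>I. g i) = (\<Prod>i\<in>I. column_subst t (g i))"
    by auto
qed

text \<open>Composition of two substitutions. Only the variables that occur in \<open>p\<close> are
  constrained, because the specialisation used later is controlled on the columns in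
  \<open>N\<close> alone.\<close>

lemma subst_mpoly_eval:
  assumes "\<And>v. v \<in> (\<Union>m\<in>Poly_Mapping.keys p. Poly_Mapping.keys m) \<Longrightarrow> s v \<in> subst_dom t"
  shows "mpoly_eval s p \<in> subst_dom t"
    "column_subst t (mpoly_eval s p) = mpoly_eval (\<lambda>v. column_subst t (s v)) p"
proof -
  have m: "monom_eval s m \<in> subst_dom t \<and>
      column_subst t (monom_eval s m) = monom_eval (\<lambda>v. column_subst t (s v)) m"
    if "m \<in> Poly_Mapping.keys p" for m
  proof -
    have v: "s v \<in> subst_dom t" if "v \<in> Poly_Mapping.keys m" for v
      using assms that \<open>m \<in> Poly_Mapping.keys p\<close> by blast
    then have "s v ^ Poly_Mapping.lookup m v \<in> subst_dom t" if "v \<in> Poly_Mapping.keys m" for v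
      using that by (intro subst_power) auto
    from subst_prod[of "Poly_Mapping.keys m" "\<lambda>v. s v ^ Poly_Mapping.lookup m v", OF this] show ?thesis
      unfolding monom_eval_def
      using v by (auto intro!: prod.cong simp: subst_power)
  qed
  show "mpoly_eval s p \<in> subst_dom t"
    "column_subst t (mpoly_eval s p) = mpoly_eval (\<lambda>v. column_subst t (s v)) p"
    unfolding mpoly_eval_def monom_eval_def[symmetric] using m
    by (auto simp: subst_sum subst_mult subst_const intro!: sum.cong)
qed

lemma mpoly_eval_cong:
  assumes "\<And>v. v \<in> (\<Union>m\<in>Poly_Mapping.keys p. Poly_Mapping.keys m) \<Longrightarrow> s v = s' v"
  shows "mpoly_eval s p = mpoly_eval s' p"
  unfolding mpoly_eval_def using assms
  by (intro sum.cong refl arg_cong2[of _ _ _ _ "(*)"] prod.cong arg_cong2[of _ _ _ _ "(^)"]) auto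

lemma of_int_sign_cases: "of_int (sign w) = (1 :: 'a::ring_1) \<or> of_int (sign w) = (- 1 :: 'a)"
  by (auto simp: sign_def)

text \<open>By the Leibniz formula a determinant is a polynomial in its entries with coefficients 1
  and -1.\<close>

lemma subst_det:
  assumes "A \<in> carrier_mat n n" "\<And>i j. i < n \<Longrightarrow> j < n \<Longrightarrow> A $$ (i, j) \<in> subst_dom t"
  shows "det A \<in> subst_dom t" "column_subst t (det A) = det (map_mat (column_subst t) A)"
proof -
  let ?f = "\<lambda>w. of_int (sign w) * (\<Prod>i = 0..<n. A $$ (i, w i))"
  have f: "?f w \<in> subst_dom t \<and>
      column_subst t (?f w) = of_int (sign w) * (\<Prod>i = 0..<n. column_subst t (A $$ (i, w i)))"
    if w: "w permutes {0..<n}" for w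
  proof -
    have "i < n \<Longrightarrow> w i < n" for i
      using permutes_in_image[OF w, of i] by simp
    then have "A $$ (i, w i) \<in> subst_dom t" if "i \<in> {0..<n}" for i
      using assms(2) that by simp
    from subst_prod[of "{0..<n}" "\<lambda>i. A $$ (i, w i)", OF this] show ?thesis
      using of_int_sign_cases[of w, where 'a = ratfun] by (auto simp: subst_uminus)
  qed
  have det: "det A = (\<Sum>w | w permutes {0..<n}. ?f w)"
    using assms(1) by (simp add: det_def')
  have det': "det (map_mat (column_subst t) A) =
      (\<Sum>w | w permutes {0..<n}. of_int (sign w) * (\<Prod>i = 0..<n. column_subst t (A $$ (i, w i))))"
  proof -
    have "(\<Prod>i = 0..<n. map_mat (column_subst t) A $$ (i, w i)) =
        (\<Prod>i = 0..<n. column_subst t (A $$ (i, w i)))" if w: "w permutes {0..<n}" for w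
      using assms(1) permutes_in_image[OF w] by (intro prod.cong) auto
    then show ?thesis
      using assms(1) by (subst det_def'[of _ n]) auto
  qed
  show "det A \<in> subst_dom t"
    unfolding det by (rule subst_sum) (use f in auto)
  show "column_subst t (det A) = det (map_mat (column_subst t) A)"
    unfolding det det' by (subst subst_sum) (use f in \<open>auto intro!: sum.cong\<close>)
qed

section \<open>Brackets and shuffle products of decomposable elements\<close>

definition bracket :: "'a::field vec \<Rightarrow> 'a vec \<Rightarrow> 'a vec \<Rightarrow> 'a vec \<Rightarrow> 'a" where
  "bracket a b c d = det (mat_of_cols 4 [a, b, c, d])"

lemma det_2:
  assumes "A \<in> carrier_mat 2 2"
  shows "det A = A $$ (0, 0) * A $$ (1, 1) - A $$ (1, 0) * (A $$ (0, 1) :: 'a::comm_ring_1)"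
  using assms
  by (simp add: laplace_expansion_column[of A 2 0] cofactor_def mat_delete_def det_single
      numeral_2_eq_2 lessThan_Suc)

lemma det_3:
  assumes "A \<in> carrier_mat 3 3"
  shows "det A =
    A $$ (0, 0) * (A $$ (1, 1) * A $$ (2, 2) - A $$ (2, 1) * A $$ (1, 2)) -
    A $$ (1, 0) * (A $$ (0, 1) * A $$ (2, 2) - A $$ (2, 1) * A $$ (0, 2)) +
    A $$ (2, 0) * (A $$ (0, 1) * A $$ (1, 2) - A $$ (1, 1) * (A $$ (0, 2) :: 'a::comm_ring_1))"
proof -
  have "{..<3} = {0, 1, 2::nat}"
    by auto
  then have "det A = A $$ (0, 0) * cofactor A 0 0 + A $$ (1, 0) * cofactor A 1 0 + A $$ (2, 0) * cofactor A 2 0"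
    using laplace_expansion_column[OF assms, of 0] by simp
  moreover have "mat_delete A i 0 \<in> carrier_mat 2 2" for i
    using mat_delete_carrier[OF assms] by simp
  moreover have "dim_row A = 3" "dim_col A = 3"
    using assms by auto
  ultimately show ?thesis
    by (simp add: cofactor_def det_2 mat_delete_def numeral_2_eq_2 algebra_simps)
qed

text \<open>The 3 x 3 minor of the columns \<open>a\<close>, \<open>b\<close>, \<open>c\<close> in
  the rows \<open>i\<close>, \<open>j\<close>, \<open>k\<close>, expanded along \<open>a\<close>; it
  is also the coordinate of the wedge of the three vectors at \<open>{i, j, k}\<close>.\<close>

definition minor3 :: "'a::field vec \<Rightarrow> 'a vec \<Rightarrow> 'a vec \<Rightarrow> nat \<Rightarrow> nat \<Rightarrow> nat \<Rightarrow> 'a" where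
  "minor3 a b c i j k =
     a $ i * (b $ j * c $ k - b $ k * c $ j) -
     a $ j * (b $ i * c $ k - b $ k * c $ i) +
     a $ k * (b $ i * c $ j - b $ j * c $ i)"

text \<open>Laplace expansion along the first column. The minors stay folded, which keeps identities
  that are linear in the first column small.\<close>

lemma bracket_expand:
  "bracket a b c d = a $ 0 * minor3 b c d 1 2 3 - a $ 1 * minor3 b c d 0 2 3 +
     a $ 2 * minor3 b c d 0 1 3 - a $ 3 * minor3 b c d 0 1 2"
proof -
  define A where "A = mat_of_cols 4 [a, b, c, d]"
  have A: "A \<in> carrier_mat 4 4"
    by (simp add: A_def mat_of_cols_def numeral_eq_Suc)
  then have dim: "dim_row A = 4" "dim_col A = 4"
    by auto
  have entries: "i < 4 \<Longrightarrow> A $$ (i, 0) = a $ i" "i < 4 \<Longrightarrow> A $$ (i, 1) = b $ i"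
    "i < 4 \<Longrightarrow> A $$ (i, 2) = c $ i" "i < 4 \<Longrightarrow> A $$ (i, 3) = d $ i" for i
    by (simp_all add: A_def mat_of_cols_def)
  have "{..<4} = {0, 1, 2, 3::nat}"
    by auto
  then have "det A = A $$ (0, 0) * cofactor A 0 0 + A $$ (1, 0) * cofactor A 1 0 +
      A $$ (2, 0) * cofactor A 2 0 + A $$ (3, 0) * cofactor A 3 0"
    using laplace_expansion_column[OF A, of 0] by simp
  moreover have "mat_delete A i 0 \<in> carrier_mat 3 3" for i
    using mat_delete_carrier[OF A] by simp
  ultimately show ?thesis
    unfolding bracket_def A_def[symmetric] using entries(2-4)
    by (simp add: cofactor_def det_3 mat_delete_def dim entries(1) minor3_def algebra_simps
        numeral_2_eq_2[symmetric] numeral_3_eq_3[symmetric])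
qed

section \<open>The permutations that occur in the shuffle product\<close>

lemma permutations_2_1:
  "{w. w permutes {..<2::nat} \<and> strict_mono_on {..<1} w \<and> strict_mono_on {1..<2} w} = {id, transpose 0 1}"
  (is "?L = ?R")
proof
  show "?L \<subseteq> ?R"
  proof
    fix w assume "w \<in> ?L"
    then have w: "w permutes {..<2}"
      by auto
    then have *: "w 0 < 2" "w 1 < 2" "w 0 \<noteq> w 1" "\<And>i. i \<ge> 2 \<Longrightarrow> w i = i"
      using permutes_in_image[OF w] permutes_inj[OF w] permutes_not_in[OF w] by (auto simp: inj_eq)
    have "w i = id i" if "w 0 = 0" for i
      using that * by (cases "i = 0 \<or> i = 1") auto
    moreover have "w i = transpose 0 1 i" if "w 0 = 1" for i
      using that *
      by (cases "i = 0 \<or> i = 1") (auto simp: transpose_def)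
    ultimately have "w 0 = 0 \<Longrightarrow> w = id" "w 0 = 1 \<Longrightarrow> w = transpose 0 1"
      by (blast intro: ext)+
    then show "w \<in> ?R"
      using less_2_cases[OF *(1)] by auto
  qed
  show "?R \<subseteq> ?L"
    by (auto simp: permutes_id strict_mono_on_def intro!: permutes_swap_id)
qed

lemma permutations_3_cases:
  assumes w: "w permutes {..<3::nat}"
  shows "\<And>i. i \<ge> 3 \<Longrightarrow> w i = i" "w 0 < 3" "w 1 < 3" "w 2 < 3" "w 0 \<noteq> w 1" "w 0 \<noteq> w 2" "w 1 \<noteq> w 2"
  using permutes_in_image[OF w] permutes_inj[OF w] permutes_not_in[OF w] by (auto simp: inj_eq)

lemma less_3_cases: "(n::nat) < 3 \<Longrightarrow> n = 0 \<or> n = 1 \<or> n = 2"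
  by linarith

lemma eq_on_3:
  assumes "\<And>i. i \<ge> 3 \<Longrightarrow> w i = i" "\<And>i. i \<ge> 3 \<Longrightarrow> w' i = i" "w 0 = w' 0" "w 1 = w' 1" "w 2 = w' (2::nat)"
  shows "w = w'"
proof
  fix i :: nat
  consider "i = 0" | "i = 1" | "i = 2" | "i \<ge> 3"
    by linarith
  then show "w i = w' i"
    using assms by cases auto
qed

text \<open>Such a permutation is determined by \<open>w 0\<close>, since the two other values
  follow in increasing order. The third one is a 3-cycle and hence even.\<close>

lemma permutations_3_1:
  "{w. w permutes {..<3::nat} \<and> strict_mono_on {..<1} w \<and> strict_mono_on {1..<3} w} =
     {id, transpose 0 1, transpose 1 2 \<circ> transpose 0 1}"
  (is "?L = ?R")
proof
  show "?L \<subseteq> ?R"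
  proof
    fix w assume w: "w \<in> ?L"
    then have "w permutes {..<3}"
      by auto
    note * = permutations_3_cases[OF this]
    have "w 1 < w 2"
      using w by (auto simp: strict_mono_on_def)
    then have "w 0 = 0 \<and> w 1 = 1 \<and> w 2 = 2 \<or> w 0 = 1 \<and> w 1 = 0 \<and> w 2 = 2 \<or> w 0 = 2 \<and> w 1 = 0 \<and> w 2 = 1"
      using less_3_cases[OF *(2)] less_3_cases[OF *(3)] less_3_cases[OF *(4)] *(5-7) by auto
    then show "w \<in> ?R"
    proof (elim disjE conjE, goal_cases)
      case 1
      then have "w = id"
        by (intro eq_on_3) (use * in auto)
      then show ?thesis by simp
    next
      case 2
      then have "w = transpose 0 1"
        by (intro eq_on_3) (use * in \<open>auto simp: transpose_def\<close>)
      then show ?thesis by simp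
    next
      case 3
      then have "w = transpose 1 2 \<circ> transpose 0 1"
        by (intro eq_on_3) (use * in \<open>auto simp: transpose_def\<close>)
      then show ?thesis by simp
    qed
  qed
  have "transpose 0 1 permutes {..<3::nat}" "transpose 1 2 permutes {..<3::nat}"
    by (auto intro: permutes_swap_id)
  then have "w permutes {..<3}" if "w \<in> ?R" for w
    using that permutes_id permutes_compose by blast
  moreover have "strict_mono_on {..<1} w" "strict_mono_on {1..<3} w" if "w \<in> ?R" for w
    using that by (auto simp: strict_mono_on_def transpose_def)
  ultimately show "?R \<subseteq> ?L"
    by blast
qed

text \<open>Here the permutation is determined by the value \<open>w 2\<close> that is left
  over.\<close>

lemma permutations_3_2:
  "{w. w permutes {..<3::nat} \<and> strict_mono_on {..<2} w \<and> strict_mono_on {2..<3} w} =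
     {id, transpose 1 2, transpose 0 1 \<circ> transpose 1 2}"
  (is "?L = ?R")
proof
  show "?L \<subseteq> ?R"
  proof
    fix w assume w: "w \<in> ?L"
    then have "w permutes {..<3}"
      by auto
    note * = permutations_3_cases[OF this]
    have "w 0 < w 1"
      using w by (auto simp: strict_mono_on_def)
    then have "w 0 = 0 \<and> w 1 = 1 \<and> w 2 = 2 \<or> w 0 = 0 \<and> w 1 = 2 \<and> w 2 = 1 \<or> w 0 = 1 \<and> w 1 = 2 \<and> w 2 = 0"
      using less_3_cases[OF *(2)] less_3_cases[OF *(3)] less_3_cases[OF *(4)] *(5-7) by auto
    then show "w \<in> ?R"
    proof (elim disjE conjE, goal_cases)
      case 1
      then have "w = id"
        by (intro eq_on_3) (use * in auto)
      then show ?thesis by simp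
    next
      case 2
      then have "w = transpose 1 2"
        by (intro eq_on_3) (use * in \<open>auto simp: transpose_def\<close>)
      then show ?thesis by simp
    next
      case 3
      then have "w = transpose 0 1 \<circ> transpose 1 2"
        by (intro eq_on_3) (use * in \<open>auto simp: transpose_def\<close>)
      then show ?thesis by simp
    qed
  qed
  have "transpose 0 1 permutes {..<3::nat}" "transpose 1 2 permutes {..<3::nat}"
    by (auto intro: permutes_swap_id)
  then have "w permutes {..<3}" if "w \<in> ?R" for w
    using that permutes_id permutes_compose by blast
  moreover have "strict_mono_on {..<2} w" "strict_mono_on {2..<3} w" if "w \<in> ?R" for w
    using that by (auto simp: strict_mono_on_def transpose_def)
  ultimately show "?R \<subseteq> ?L"
    by blast
qed

text \<open>The case \<open>p + q = 4\<close>: all \<open>p\<close> vectors enter the determinant,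
  the second block of positions is empty, and monotonicity leaves only the identity.\<close>

lemma permutations_mono:
  "{w. w permutes {..<p::nat} \<and> strict_mono_on {..<p} w \<and> strict_mono_on {p..<p} w} = {id}"
proof -
  have "w = id" if w: "w permutes {..<p}" "strict_mono_on {..<p} w" for w
  proof -
    have "sorted_wrt (<) (map w [0..<p])"
      using w(2) by (auto simp: sorted_wrt_iff_nth_less strict_mono_on_def)
    moreover have "set (map w [0..<p]) = set [0..<p]"
      using permutes_image[OF w(1)] by (simp add: lessThan_atLeast0)
    ultimately have eq: "map w [0..<p] = [0..<p]"
      by (intro sorted_distinct_set_unique) (auto simp: strict_sorted_iff)
    have "w i = i" for i
    proof (cases "i < p")
      case True
      then have "map w [0..<p] ! i = w i"
        by simp
      then show ?thesis
        using True unfolding eq by simp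
    qed (use permutes_not_in[OF w(1)] in simp)
    then show ?thesis
      by (simp add: fun_eq_iff)
  qed
  then show ?thesis
    by (auto simp: permutes_id strict_mono_on_def)
qed

lemma sign_transpose: "a \<noteq> b \<Longrightarrow> sign (transpose a b) = - 1"
  by (simp add: sign_swap_id)

lemma sign_3_cycle:
  "sign (transpose 1 2 \<circ> transpose 0 (1::nat)) = 1" "sign (transpose 0 (1::nat) \<circ> transpose 1 2) = 1"
  by (simp_all add: sign_compose permutation_swap_id sign_swap_id)

section \<open>The shuffle formula on short lists of vectors\<close>

lemma shuffle_decomposable_1_3:
  "shuffle_decomposable [a] [b, c, d] U = bracket a b c d * ext_one U"
proof -
  let ?s = "\<lambda>w. of_int (sign w) * det (mat_of_cols 4 [[a] ! w 0, b, c, d]) * ext_one U"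
  have "shuffle_decomposable [a] [b, c, d] U =
      (\<Sum>w | w permutes {..<1} \<and> strict_mono_on {..<1} w \<and> strict_mono_on {1..<1} w. ?s w)"
    by (simp add: shuffle_decomposable_def wedge_list_def)
  also have "\<dots> = ?s id"
    unfolding permutations_mono by simp
  finally show ?thesis
    by (simp add: bracket_def)
qed

lemma shuffle_decomposable_2_2:
  "shuffle_decomposable [a, b] [c, d] U = bracket a b c d * ext_one U"
proof -
  let ?s = "\<lambda>w. of_int (sign w) * det (mat_of_cols 4 [[a, b] ! w 0, [a, b] ! w 1, c, d]) * ext_one U"
  have "shuffle_decomposable [a, b] [c, d] U =
      (\<Sum>w | w permutes {..<2} \<and> strict_mono_on {..<2} w \<and> strict_mono_on {2..<2} w. ?s w)"
    by (simp add: shuffle_decomposable_def wedge_list_def numeral_2_eq_2)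
  also have "\<dots> = ?s id"
    unfolding permutations_mono by simp
  finally show ?thesis
    by (simp add: bracket_def)
qed

lemma shuffle_decomposable_2_3:
  "shuffle_decomposable [a, b] [c, d, e] U =
     bracket a c d e * wedge_list [b] U - bracket b c d e * wedge_list [a] U"
proof -
  let ?s = "\<lambda>w. of_int (sign w) * det (mat_of_cols 4 [[a, b] ! w 0, c, d, e]) *
      wedge_list [[a, b] ! w 1] U"
  have "id \<noteq> transpose 0 (1::nat)"
    by (metis id_apply transpose_apply_first zero_neq_one)
  have "shuffle_decomposable [a, b] [c, d, e] U =
      (\<Sum>w | w permutes {..<2} \<and> strict_mono_on {..<1} w \<and> strict_mono_on {1..<2} w. ?s w)"
    by (simp add: shuffle_decomposable_def numeral_2_eq_2)
  also have "\<dots> = ?s id + ?s (transpose 0 1)"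
    unfolding permutations_2_1 using \<open>id \<noteq> transpose 0 (1::nat)\<close> by simp
  finally show ?thesis
    by (simp add: sign_transpose bracket_def)
qed

lemma three_permutations:
  "distinct [id, transpose 1 2, transpose 0 1 \<circ> transpose 1 (2::nat)]"
  "distinct [id, transpose 0 1, transpose 1 2 \<circ> transpose 0 (1::nat)]"
proof -
  \<comment> \<open>The values at 0 and 1 already tell these permutations apart.\<close>
  have "distinct ws" if "distinct (map (\<lambda>w. (w 0, w 1)) ws)" for ws :: "(nat \<Rightarrow> nat) list"
    using that by (simp add: distinct_map)
  note * = this
  show "distinct [id, transpose 1 2, transpose 0 1 \<circ> transpose 1 (2::nat)]"
    "distinct [id, transpose 0 1, transpose 1 2 \<circ> transpose 0 (1::nat)]"
    by (rule *; simp add: transpose_def)+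
qed

lemma shuffle_decomposable_3_2:
  "shuffle_decomposable [a, b, c] [d, e] U =
     bracket a b d e * wedge_list [c] U - bracket a c d e * wedge_list [b] U +
     bracket b c d e * wedge_list [a] U"
proof -
  let ?s = "\<lambda>w. of_int (sign w) * det (mat_of_cols 4 [[a, b, c] ! w 0, [a, b, c] ! w 1, d, e]) *
      wedge_list [[a, b, c] ! w 2] U"
  have "shuffle_decomposable [a, b, c] [d, e] U =
      (\<Sum>w | w permutes {..<3} \<and> strict_mono_on {..<2} w \<and> strict_mono_on {2..<3} w. ?s w)"
    by (simp add: shuffle_decomposable_def numeral_2_eq_2 numeral_3_eq_3)
  also have "\<dots> = ?s id + ?s (transpose 1 2) + ?s (transpose 0 1 \<circ> transpose 1 2)"
    unfolding permutations_3_2 using three_permutations(1) by (simp add: add.assoc)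
  finally show ?thesis
    by (simp add: sign_3_cycle[simplified] sign_transpose transpose_def bracket_def)
qed

lemma shuffle_decomposable_3_3:
  "shuffle_decomposable [a, b, c] [d, e, f] U =
     bracket a d e f * wedge_list [b, c] U - bracket b d e f * wedge_list [a, c] U +
     bracket c d e f * wedge_list [a, b] U"
proof -
  let ?s = "\<lambda>w. of_int (sign w) * det (mat_of_cols 4 [[a, b, c] ! w 0, d, e, f]) *
      wedge_list [[a, b, c] ! w 1, [a, b, c] ! w 2] U"
  have "shuffle_decomposable [a, b, c] [d, e, f] U =
      (\<Sum>w | w permutes {..<3} \<and> strict_mono_on {..<1} w \<and> strict_mono_on {1..<3} w. ?s w)"
    by (simp add: shuffle_decomposable_def numeral_2_eq_2 numeral_3_eq_3)
  also have "\<dots> = ?s id + ?s (transpose 0 1) + ?s (transpose 1 2 \<circ> transpose 0 1)"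
    unfolding permutations_3_1 using three_permutations(2) by (simp add: add.assoc)
  finally show ?thesis
    by (simp add: sign_3_cycle[simplified] sign_transpose transpose_def bracket_def)
qed

section \<open>Coordinates of wedge products\<close>

lemma prod_sign_card:
  assumes "finite U"
  shows "(\<Prod>j\<in>U. if P j then - 1 else 1) = (- 1 :: 'a::comm_ring_1) ^ card {j \<in> U. P j}"
  using assms by (simp add: prod.If_cases Int_def)

lemma ext_of_vec_singleton: "ext_of_vec v {i} = (if i < 4 then v $ i else 0)"
  by (simp add: ext_of_vec_def sum.delta)

lemma ext_of_vec_eq_0: "(\<And>i. S \<noteq> {i}) \<Longrightarrow> ext_of_vec v S = 0"
  by (simp add: ext_of_vec_def)

text \<open>Only singletons contribute to the sum. The exponent of the sign, a number of pairs,
  becomes the number of elements of \<open>U\<close> below \<open>i\<close>, and then a product over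
  \<open>U\<close>, which can be evaluated factor by factor on explicit sets.\<close>

lemma wedge_vec_left:
  assumes "U \<subseteq> {..<4}"
  shows "(ext_of_vec v \<curlywedge> B) U =
    (\<Sum>i\<in>U. (\<Prod>j\<in>U. if j < i then - 1 else 1) * v $ i * B (U - {i}))"
proof -
  have fin: "finite U"
    using assms finite_subset by blast
  have "(ext_of_vec v \<curlywedge> B) U = (\<Sum>S\<in>(\<lambda>i. {i}) ` U.
      (-1) ^ card {(i, j). i \<in> S \<and> j \<in> U - S \<and> j < i} * ext_of_vec v S * B (U - S))"
    unfolding ext_wedge_def
    by (rule sum.mono_neutral_right) (use fin in \<open>auto intro!: ext_of_vec_eq_0\<close>)
  also have "\<dots> = (\<Sum>i\<in>U. (\<Prod>j\<in>U. if j < i then - 1 else 1) * v $ i * B (U - {i}))"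
  proof (subst sum.reindex)
    have "{(i', j). i' \<in> {i} \<and> j \<in> U - {i} \<and> j < i'} = Pair i ` {j \<in> U. j < i}" for i
      by auto
    then have "card {(i', j). i' \<in> {i} \<and> j \<in> U - {i} \<and> j < i'} = card {j \<in> U. j < i}" for i
      by (simp add: card_image inj_on_def)
    then show "sum ((\<lambda>S. (-1) ^ card {(i, j). i \<in> S \<and> j \<in> U - S \<and> j < i} * ext_of_vec v S * B (U - S)) \<circ> (\<lambda>i. {i})) U =
        (\<Sum>i\<in>U. (\<Prod>j\<in>U. if j < i then - 1 else 1) * v $ i * B (U - {i}))"
      using assms by (intro sum.cong) (auto simp: prod_sign_card[OF fin] ext_of_vec_singleton)
  qed auto
  finally show ?thesis .
qed

text \<open>The mirror image, with complements of singletons. It is needed because the image of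
  \<open>z_8\<close> contains a wedge by \<open>z_7\<close> from the right.\<close>

lemma wedge_vec_right:
  assumes "U \<subseteq> {..<4}"
  shows "(B \<curlywedge> ext_of_vec v) U =
    (\<Sum>i\<in>U. (\<Prod>j\<in>U. if i < j then - 1 else 1) * B (U - {i}) * v $ i)"
proof -
  have fin: "finite U"
    using assms finite_subset by blast
  have "(B \<curlywedge> ext_of_vec v) U = (\<Sum>S\<in>(\<lambda>i. U - {i}) ` U.
      (-1) ^ card {(i, j). i \<in> S \<and> j \<in> U - S \<and> j < i} * B S * ext_of_vec v (U - S))"
    unfolding ext_wedge_def
  proof (rule sum.mono_neutral_right)
    show "\<forall>S\<in>Pow U - (\<lambda>i. U - {i}) ` U.
        (-1) ^ card {(i, j). i \<in> S \<and> j \<in> U - S \<and> j < i} * B S * ext_of_vec v (U - S) = 0"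
    proof
      fix S assume S: "S \<in> Pow U - (\<lambda>i. U - {i}) ` U"
      have "U - S \<noteq> {i}" for i
        using S by (auto simp: set_eq_iff image_iff)
      then show "(-1) ^ card {(i, j). i \<in> S \<and> j \<in> U - S \<and> j < i} * B S * ext_of_vec v (U - S) = 0"
        by (simp add: ext_of_vec_eq_0)
    qed
  qed (use fin in auto)
  also have "\<dots> = (\<Sum>i\<in>U. (\<Prod>j\<in>U. if i < j then - 1 else 1) * B (U - {i}) * v $ i)"
  proof (subst sum.reindex)
    show "inj_on (\<lambda>i. U - {i}) U"
      by (auto simp: inj_on_def)
    show "sum ((\<lambda>S. (-1) ^ card {(i, j). i \<in> S \<and> j \<in> U - S \<and> j < i} * B S * ext_of_vec v (U - S)) \<circ> (\<lambda>i. U - {i})) U =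
        (\<Sum>i\<in>U. (\<Prod>j\<in>U. if i < j then - 1 else 1) * B (U - {i}) * v $ i)"
    proof (rule sum.cong[OF refl])
      fix i assume i: "i \<in> U"
      then have eq: "U - (U - {i}) = {i}"
        by auto
      have "{(i', j). i' \<in> U - {i} \<and> j \<in> {i} \<and> j < i'} = (\<lambda>j. (j, i)) ` {j \<in> U. i < j}"
        by auto
      then have "card {(i', j). i' \<in> U - {i} \<and> j \<in> {i} \<and> j < i'} = card {j \<in> U. i < j}"
        by (simp only: card_image inj_on_def) (simp add: card_image inj_on_def)
      then show "((\<lambda>S. (-1) ^ card {(i, j). i \<in> S \<and> j \<in> U - S \<and> j < i} * B S * ext_of_vec v (U - S)) \<circ> (\<lambda>i. U - {i})) i =
          (\<Prod>j\<in>U. if i < j then - 1 else 1) * B (U - {i}) * v $ i"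
        unfolding o_apply eq prod_sign_card[OF fin] using i assms
        by (simp only: ext_of_vec_singleton) auto
    qed
  qed
  finally show ?thesis .
qed

lemma wedge_list_simps:
  "wedge_list [] = ext_one"
  "wedge_list (v # vs) = ext_of_vec v \<curlywedge> wedge_list vs"
  by (simp_all add: wedge_list_def)

text \<open>Homogeneity, which cuts the sums over all subsets down to subsets of one size.\<close>

lemma wedge_list_degree:
  "U \<subseteq> {..<4} \<Longrightarrow> card U \<noteq> length vs \<Longrightarrow> wedge_list vs U = 0"
proof (induction vs arbitrary: U)
  case Nil
  then show ?case
    using finite_subset[of U "{..<4}"] by (auto simp: wedge_list_simps ext_one_def)
next
  case (Cons v vs)
  then have fin: "finite U"
    using finite_subset by blast
  have "wedge_list vs (U - {i}) = 0" if "i \<in> U" for i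
    using Cons.prems card_Suc_Diff1[OF fin that] by (intro Cons.IH) auto
  then show ?case
    using Cons.prems by (auto simp: wedge_list_simps wedge_vec_left)
qed

lemma wedge_list_1: "i < 4 \<Longrightarrow> wedge_list [a] {i} = a $ i"
  by (simp add: wedge_list_simps wedge_vec_left ext_one_def)

lemma wedge_list_2:
  assumes "i < j" "j < 4"
  shows "wedge_list [a, b] {i, j} = a $ i * b $ j - a $ j * b $ i"
proof -
  have "{i, j} - {i} = {j}" "{i, j} - {j} = {i}"
    using assms by auto
  then show ?thesis
    using assms unfolding wedge_list_simps(2)[of a]
    by (simp add: wedge_vec_left wedge_list_1)
qed

lemma wedge_list_3:
  assumes "i < j" "j < k" "k < 4"
  shows "wedge_list [a, b, c] {i, j, k} = minor3 a b c i j k"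
proof -
  have "{i, j, k} - {i} = {j, k}" "{i, j, k} - {j} = {i, k}" "{i, j, k} - {k} = {i, j}"
    using assms by auto
  then show ?thesis
    using assms unfolding wedge_list_simps(2)[of a]
    by (simp add: wedge_vec_left wedge_list_2 minor3_def)
qed

lemma subsets_4:
  "{S \<in> Pow {..<4::nat}. card S = 1} = {{0}, {1}, {2}, {3}}"
  "{S \<in> Pow {..<4::nat}. card S = 2} = {{0, 1}, {0, 2}, {0, 3}, {1, 2}, {1, 3}, {2, 3}}"
  "{S \<in> Pow {..<4::nat}. card S = 3} = {{0, 1, 2}, {0, 1, 3}, {0, 2, 3}, {1, 2, 3}}"
proof -
  let ?L = "[{}, {0}, {1}, {2}, {3}, {0, 1}, {0, 2}, {0, 3}, {1, 2}, {1, 3}, {2, 3},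
    {0, 1, 2}, {0, 1, 3}, {0, 2, 3}, {1, 2, 3}, {0, 1, 2, 3::nat}]"
  have "{..<4::nat} = {0, 1, 2, 3}"
    by auto
  then have "Pow {..<4} = set ?L"
    by (simp only: Pow_insert) (simp add: insert_commute)
  then have *: "{S \<in> Pow {..<4}. P S} = set (filter P ?L)" for P
    by (simp only: set_filter)
  show "{S \<in> Pow {..<4::nat}. card S = 1} = {{0}, {1}, {2}, {3}}"
    "{S \<in> Pow {..<4::nat}. card S = 2} = {{0, 1}, {0, 2}, {0, 3}, {1, 2}, {1, 3}, {2, 3}}"
    "{S \<in> Pow {..<4::nat}. card S = 3} = {{0, 1, 2}, {0, 1, 3}, {0, 2, 3}, {1, 2, 3}}"
    unfolding * by simp_all
qed

lemma sum_subsets_4: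
  "(\<Sum>S | S \<in> Pow {..<4::nat} \<and> card S = 1. g S) = g {0} + g {1} + g {2} + g {3}"
  "(\<Sum>S | S \<in> Pow {..<4::nat} \<and> card S = 2. g S) = g {0, 1} + g {0, 2} + g {0, 3} + g {1, 2} + g {1, 3} + g {2, 3}"
  "(\<Sum>S | S \<in> Pow {..<4::nat} \<and> card S = 3. g S) = g {0, 1, 2} + g {0, 1, 3} + g {0, 2, 3} + g {1, 2, 3}"
  for g :: "nat set \<Rightarrow> 'a::comm_monoid_add"
proof -
  \<comment> \<open>The binary code of a set turns pairwise distinctness into a comparison of
    numbers.\<close>
  have *: "sum g (set Ss) = sum_list (map g Ss)" if "distinct (map (\<lambda>S. \<Sum>i\<in>S. (2::nat) ^ i) Ss)" for Ss
    using that by (simp add: sum.distinct_set_conv_list distinct_map)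
  show "(\<Sum>S | S \<in> Pow {..<4::nat} \<and> card S = 1. g S) = g {0} + g {1} + g {2} + g {3}"
    using *[of "[{0}, {1}, {2}, {3}]"] unfolding subsets_4 by (simp add: add.assoc)
  show "(\<Sum>S | S \<in> Pow {..<4::nat} \<and> card S = 2. g S) =
      g {0, 1} + g {0, 2} + g {0, 3} + g {1, 2} + g {1, 3} + g {2, 3}"
    using *[of "[{0, 1}, {0, 2}, {0, 3}, {1, 2}, {1, 3}, {2, 3}]"] unfolding subsets_4 by (simp add: add.assoc)
  show "(\<Sum>S | S \<in> Pow {..<4::nat} \<and> card S = 3. g S) =
      g {0, 1, 2} + g {0, 1, 3} + g {0, 2, 3} + g {1, 2, 3}"
    using *[of "[{0, 1, 2}, {0, 1, 3}, {0, 2, 3}, {1, 2, 3}]"] unfolding subsets_4 by (simp add: add.assoc)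
qed

section \<open>Shuffle products in coordinates\<close>

lemma ext_shuffle_homogeneous:
  assumes "\<And>S. S \<subseteq> {..<4} \<Longrightarrow> card S \<noteq> p \<Longrightarrow> A S = 0"
    and "\<And>S. S \<subseteq> {..<4} \<Longrightarrow> card S \<noteq> q \<Longrightarrow> B S = 0"
  shows "(A \<star> B) U = (\<Sum>S | S \<in> Pow {..<4} \<and> card S = p. \<Sum>T | T \<in> Pow {..<4} \<and> card T = q.
    A S * B T * shuffle_decomposable (basis_vecs S) (basis_vecs T) U)"
proof -
  have "(A \<star> B) U = (\<Sum>S\<in>Pow {..<4}. \<Sum>T | T \<in> Pow {..<4} \<and> card T = q.
      A S * B T * shuffle_decomposable (basis_vecs S) (basis_vecs T) U)"
    unfolding ext_shuffle_def by (intro sum.cong sum.mono_neutral_right) (auto simp: assms)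
  also have "\<dots> = (\<Sum>S | S \<in> Pow {..<4} \<and> card S = p. \<Sum>T | T \<in> Pow {..<4} \<and> card T = q.
      A S * B T * shuffle_decomposable (basis_vecs S) (basis_vecs T) U)"
    by (intro sum.mono_neutral_right) (auto simp: assms)
  finally show ?thesis .
qed

lemma basis_vecs_simps:
  "basis_vecs {i} = [unit_vec 4 i]"
  "i < j \<Longrightarrow> basis_vecs {i, j} = [unit_vec 4 i, unit_vec 4 j]"
  "i < j \<Longrightarrow> j < k \<Longrightarrow> basis_vecs {i, j, k} = [unit_vec 4 i, unit_vec 4 j, unit_vec 4 k]"
proof -
  have *: "sorted_list_of_set (set xs) = xs" if "sorted_wrt (<) xs" for xs :: "nat list"
    using that by (simp add: sorted_list_of_set.idem_if_sorted_distinct strict_sorted_iff)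
  show "basis_vecs {i} = [unit_vec 4 i]"
    by (simp add: basis_vecs_def)
  show "basis_vecs {i, j} = [unit_vec 4 i, unit_vec 4 j]" if "i < j"
    using *[of "[i, j]"] that by (simp add: basis_vecs_def)
  show "basis_vecs {i, j, k} = [unit_vec 4 i, unit_vec 4 j, unit_vec 4 k]" if "i < j" "j < k"
    using *[of "[i, j, k]"] that by (simp add: basis_vecs_def)
qed

lemma unit_vec_4:
  "unit_vec 4 i $ 0 = (if i = 0 then 1 else 0)" "unit_vec 4 i $ Suc 0 = (if i = 1 then 1 else 0)"
  "unit_vec 4 i $ 2 = (if i = 2 then 1 else 0)" "unit_vec 4 i $ 3 = (if i = 3 then 1 else 0)"
  by (simp_all add: unit_vec_def)

lemma subsets_4_cases:
  assumes "U \<subseteq> {..<4::nat}"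
  shows "card U = 1 \<Longrightarrow> U \<in> {{0}, {1}, {2}, {3}}"
    "card U = 2 \<Longrightarrow> U \<in> {{0, 1}, {0, 2}, {0, 3}, {1, 2}, {1, 3}, {2, 3}}"
    "card U = 3 \<Longrightarrow> U \<in> {{0, 1, 2}, {0, 1, 3}, {0, 2, 3}, {1, 2, 3}}"
  unfolding subsets_4[symmetric] using assms by auto

context
  fixes A B :: "'a::field ext" and p q :: nat
  assumes deg: "\<And>S. S \<subseteq> {..<4} \<Longrightarrow> card S \<noteq> p \<Longrightarrow> A S = 0"
    "\<And>S. S \<subseteq> {..<4} \<Longrightarrow> card S \<noteq> q \<Longrightarrow> B S = 0"
begin

lemma shuffle_sum:
  "(A \<star> B) U = (\<Sum>S | S \<in> Pow {..<4} \<and> card S = p. \<Sum>T | T \<in> Pow {..<4} \<and> card T = q.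
    A S * B T * shuffle_decomposable (basis_vecs S) (basis_vecs T) U)"
  by (rule ext_shuffle_homogeneous) (use deg in auto)

text \<open>Brackets of unit vectors are 0, 1 or -1, so the bilinear extension becomes a signed
  pairing of complementary coordinates.\<close>

lemma shuffle_coords_1_3:
  assumes "p = 1" "q = 3"
  shows "(A \<star> B) U = (A {0} * B {1, 2, 3} - A {1} * B {0, 2, 3} + A {2} * B {0, 1, 3} -
    A {3} * B {0, 1, 2}) * ext_one U"
  unfolding shuffle_sum assms sum_subsets_4
  by (simp add: basis_vecs_simps shuffle_decomposable_1_3 bracket_expand minor3_def unit_vec_4 ring_distribs)

lemma shuffle_coords_2_2:
  assumes "p = 2" "q = 2"
  shows "(A \<star> B) U = (A {0, 1} * B {2, 3} - A {0, 2} * B {1, 3} + A {0, 3} * B {1, 2} +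
    A {1, 2} * B {0, 3} - A {1, 3} * B {0, 2} + A {2, 3} * B {0, 1}) * ext_one U"
  unfolding shuffle_sum assms sum_subsets_4
  by (simp add: basis_vecs_simps shuffle_decomposable_2_2 bracket_expand minor3_def unit_vec_4 ring_distribs)

lemma shuffle_coords_2_3:
  assumes "p = 2" "q = 3"
  shows "(A \<star> B) U =
    (A {0, 1} * B {0, 2, 3} - A {0, 2} * B {0, 1, 3} + A {0, 3} * B {0, 1, 2}) * wedge_list [unit_vec 4 0] U +
    (A {0, 1} * B {1, 2, 3} - A {1, 2} * B {0, 1, 3} + A {1, 3} * B {0, 1, 2}) * wedge_list [unit_vec 4 1] U +
    (A {0, 2} * B {1, 2, 3} - A {1, 2} * B {0, 2, 3} + A {2, 3} * B {0, 1, 2}) * wedge_list [unit_vec 4 2] U +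
    (A {0, 3} * B {1, 2, 3} - A {1, 3} * B {0, 2, 3} + A {2, 3} * B {0, 1, 3}) * wedge_list [unit_vec 4 3] U"
  unfolding shuffle_sum assms sum_subsets_4
  by (simp add: basis_vecs_simps shuffle_decomposable_2_3 bracket_expand minor3_def unit_vec_4 ring_distribs)

lemma shuffle_coords_3_3:
  assumes "p = 3" "q = 3"
  shows "(A \<star> B) U =
    (A {0, 1, 2} * B {0, 1, 3} - A {0, 1, 3} * B {0, 1, 2}) * wedge_list [unit_vec 4 0, unit_vec 4 1] U +
    (A {0, 1, 2} * B {0, 2, 3} - A {0, 2, 3} * B {0, 1, 2}) * wedge_list [unit_vec 4 0, unit_vec 4 2] U +
    (A {0, 1, 2} * B {1, 2, 3} - A {1, 2, 3} * B {0, 1, 2}) * wedge_list [unit_vec 4 1, unit_vec 4 2] U +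
    (A {0, 1, 3} * B {0, 2, 3} - A {0, 2, 3} * B {0, 1, 3}) * wedge_list [unit_vec 4 0, unit_vec 4 3] U +
    (A {0, 1, 3} * B {1, 2, 3} - A {1, 2, 3} * B {0, 1, 3}) * wedge_list [unit_vec 4 1, unit_vec 4 3] U +
    (A {0, 2, 3} * B {1, 2, 3} - A {1, 2, 3} * B {0, 2, 3}) * wedge_list [unit_vec 4 2, unit_vec 4 3] U"
  unfolding shuffle_sum assms sum_subsets_4
  by (simp add: basis_vecs_simps shuffle_decomposable_3_3 bracket_expand minor3_def unit_vec_4 ring_distribs)

lemma shuffle_coords_3_2:
  assumes "p = 3" "q = 2"
  shows "(A \<star> B) U =
    (A {0, 1, 2} * B {0, 3} - A {0, 1, 3} * B {0, 2} + A {0, 2, 3} * B {0, 1}) * wedge_list [unit_vec 4 0] U +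
    (A {0, 1, 2} * B {1, 3} - A {0, 1, 3} * B {1, 2} + A {1, 2, 3} * B {0, 1}) * wedge_list [unit_vec 4 1] U +
    (A {0, 1, 2} * B {2, 3} - A {0, 2, 3} * B {1, 2} + A {1, 2, 3} * B {0, 2}) * wedge_list [unit_vec 4 2] U +
    (A {0, 1, 3} * B {2, 3} - A {0, 2, 3} * B {1, 3} + A {1, 2, 3} * B {0, 3}) * wedge_list [unit_vec 4 3] U"
  unfolding shuffle_sum assms sum_subsets_4
  by (simp add: basis_vecs_simps shuffle_decomposable_3_2 bracket_expand minor3_def unit_vec_4 ring_distribs)

end

text \<open>The shuffle product is defined by bilinear extension from basis elements. This lemma and
  the next four confirm that it is given by the determinant formula on arbitrary decomposable
  elements, by comparing coordinates.\<close>

lemma shuffle_1_3: "(wedge_list [a] \<star> wedge_list [b, c, d]) U = bracket a b c d * ext_one U"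
  by (subst shuffle_coords_1_3[where p = 1 and q = 3])
    (simp_all add: wedge_list_degree wedge_list_1 wedge_list_3 bracket_expand)

lemma shuffle_2_2: "(wedge_list [a, b] \<star> wedge_list [c, d]) U = bracket a b c d * ext_one U"
  by (subst shuffle_coords_2_2[where p = 2 and q = 2])
    (simp_all add: wedge_list_degree wedge_list_2 bracket_expand minor3_def algebra_simps)

lemma shuffle_2_3:
  assumes U: "U \<subseteq> {..<4}"
  shows "(wedge_list [a, b] \<star> wedge_list [c, d, e]) U =
    bracket a c d e * wedge_list [b] U - bracket b c d e * wedge_list [a] U"
proof (cases "card U = 1")
  case True
  then have "U \<in> {{0}, {1}, {2}, {3}}"
    using subsets_4_cases(1)[OF U] by blast
  then show ?thesis
    by (subst shuffle_coords_2_3[where p = 2 and q = 3])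
     (auto simp: wedge_list_degree wedge_list_1 wedge_list_2 wedge_list_3 unit_vec_4 bracket_expand algebra_simps)
next
  case False
  with U show ?thesis
    by (subst shuffle_coords_2_3[where p = 2 and q = 3]) (simp_all add: wedge_list_degree)
qed

lemma shuffle_3_2:
  assumes U: "U \<subseteq> {..<4}"
  shows "(wedge_list [a, b, c] \<star> wedge_list [d, e]) U =
    bracket a b d e * wedge_list [c] U - bracket a c d e * wedge_list [b] U + bracket b c d e * wedge_list [a] U"
proof (cases "card U = 1")
  case True
  \<comment> \<open>The 2 x 2 minors of \<open>d\<close> and \<open>e\<close> are treated as
    independent symbols, which lowers the degree of the four coordinate identities.\<close>
  define m where "m i j = d $ i * e $ j - d $ j * e $ i" for i j
  have m: "minor3 v d e i j k = v $ i * m j k - v $ j * m i k + v $ k * m i j"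
    "i < j \<Longrightarrow> j < 4 \<Longrightarrow> wedge_list [d, e] {i, j} = m i j" for v i j k
    by (simp_all add: minor3_def m_def wedge_list_2)
  have U4: "U \<in> {{0}, {1}, {2}, {3}}"
    using subsets_4_cases(1)[OF U] True by blast
  have degree: "\<And>S. S \<subseteq> {..<4} \<Longrightarrow> card S \<noteq> 3 \<Longrightarrow> wedge_list [a, b, c] S = 0"
    "\<And>S. S \<subseteq> {..<4} \<Longrightarrow> card S \<noteq> 2 \<Longrightarrow> wedge_list [d, e] S = 0"
    by (simp_all add: wedge_list_degree)
  have coords:
    "(wedge_list [a, b, c] \<star> wedge_list [d, e]) {0} = minor3 a b c 0 1 2 * m 0 3 - minor3 a b c 0 1 3 * m 0 2 + minor3 a b c 0 2 3 * m 0 1"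
    "(wedge_list [a, b, c] \<star> wedge_list [d, e]) {1} = minor3 a b c 0 1 2 * m 1 3 - minor3 a b c 0 1 3 * m 1 2 + minor3 a b c 1 2 3 * m 0 1"
    "(wedge_list [a, b, c] \<star> wedge_list [d, e]) {2} = minor3 a b c 0 1 2 * m 2 3 - minor3 a b c 0 2 3 * m 1 2 + minor3 a b c 1 2 3 * m 0 2"
    "(wedge_list [a, b, c] \<star> wedge_list [d, e]) {3} = minor3 a b c 0 1 3 * m 2 3 - minor3 a b c 0 2 3 * m 1 3 + minor3 a b c 1 2 3 * m 0 3"
    using shuffle_coords_3_2[of 3 "wedge_list [a, b, c]" 2 "wedge_list [d, e]", OF degree refl refl]
    by (simp_all add: wedge_list_1 m(2) wedge_list_3 unit_vec_4)
  have
    "(wedge_list [a, b, c] \<star> wedge_list [d, e]) {0} = bracket a b d e * wedge_list [c] {0} -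
      bracket a c d e * wedge_list [b] {0} + bracket b c d e * wedge_list [a] {0}"
    "(wedge_list [a, b, c] \<star> wedge_list [d, e]) {1} = bracket a b d e * wedge_list [c] {1} -
      bracket a c d e * wedge_list [b] {1} + bracket b c d e * wedge_list [a] {1}"
    "(wedge_list [a, b, c] \<star> wedge_list [d, e]) {2} = bracket a b d e * wedge_list [c] {2} -
      bracket a c d e * wedge_list [b] {2} + bracket b c d e * wedge_list [a] {2}"
    "(wedge_list [a, b, c] \<star> wedge_list [d, e]) {3} = bracket a b d e * wedge_list [c] {3} -
      bracket a c d e * wedge_list [b] {3} + bracket b c d e * wedge_list [a] {3}"
    unfolding coords bracket_expand m(1) by (simp_all add: wedge_list_1 minor3_def algebra_simps)
  with U4 show ?thesis
    by auto
next
  case False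
  with U show ?thesis
    by (subst shuffle_coords_3_2[where p = 3 and q = 2]) (simp_all add: wedge_list_degree)
qed

lemma shuffle_3_3:
  assumes U: "U \<subseteq> {..<4}"
  shows "(wedge_list [a, b, c] \<star> wedge_list [d, e, f]) U =
    bracket a d e f * wedge_list [b, c] U - bracket b d e f * wedge_list [a, c] U +
    bracket c d e f * wedge_list [a, b] U"
proof (cases "card U = 2")
  case True
  \<comment> \<open>The minors of \<open>d\<close>, \<open>e\<close>, \<open>f\<close> enter
    linearly on both sides, so they can be treated as independent symbols.\<close>
  define m where "m i j k = minor3 d e f i j k" for i j k
  have m: "minor3 d e f i j k = m i j k" for i j k
    by (simp add: m_def)
  have U4: "U \<in> {{0, 1}, {0, 2}, {0, 3}, {1, 2}, {1, 3}, {2, 3}}"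
    using subsets_4_cases(2)[OF U] True by blast
  have degree: "\<And>S. S \<subseteq> {..<4} \<Longrightarrow> card S \<noteq> 3 \<Longrightarrow> wedge_list [a, b, c] S = 0"
    "\<And>S. S \<subseteq> {..<4} \<Longrightarrow> card S \<noteq> 3 \<Longrightarrow> wedge_list [d, e, f] S = 0"
    by (simp_all add: wedge_list_degree)
  have coords:
    "(wedge_list [a, b, c] \<star> wedge_list [d, e, f]) {0, 1} = minor3 a b c 0 1 2 * m 0 1 3 - minor3 a b c 0 1 3 * m 0 1 2"
    "(wedge_list [a, b, c] \<star> wedge_list [d, e, f]) {0, 2} = minor3 a b c 0 1 2 * m 0 2 3 - minor3 a b c 0 2 3 * m 0 1 2"
    "(wedge_list [a, b, c] \<star> wedge_list [d, e, f]) {0, 3} = minor3 a b c 0 1 3 * m 0 2 3 - minor3 a b c 0 2 3 * m 0 1 3"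
    "(wedge_list [a, b, c] \<star> wedge_list [d, e, f]) {1, 2} = minor3 a b c 0 1 2 * m 1 2 3 - minor3 a b c 1 2 3 * m 0 1 2"
    "(wedge_list [a, b, c] \<star> wedge_list [d, e, f]) {1, 3} = minor3 a b c 0 1 3 * m 1 2 3 - minor3 a b c 1 2 3 * m 0 1 3"
    "(wedge_list [a, b, c] \<star> wedge_list [d, e, f]) {2, 3} = minor3 a b c 0 2 3 * m 1 2 3 - minor3 a b c 1 2 3 * m 0 2 3"
    using shuffle_coords_3_3[of 3 "wedge_list [a, b, c]" 3 "wedge_list [d, e, f]", OF degree refl refl]
    by (simp_all add: wedge_list_2 wedge_list_3 unit_vec_4 m)
  have
    "(wedge_list [a, b, c] \<star> wedge_list [d, e, f]) {0, 1} = bracket a d e f * wedge_list [b, c] {0, 1} -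
      bracket b d e f * wedge_list [a, c] {0, 1} + bracket c d e f * wedge_list [a, b] {0, 1}"
    "(wedge_list [a, b, c] \<star> wedge_list [d, e, f]) {0, 2} = bracket a d e f * wedge_list [b, c] {0, 2} -
      bracket b d e f * wedge_list [a, c] {0, 2} + bracket c d e f * wedge_list [a, b] {0, 2}"
    "(wedge_list [a, b, c] \<star> wedge_list [d, e, f]) {0, 3} = bracket a d e f * wedge_list [b, c] {0, 3} -
      bracket b d e f * wedge_list [a, c] {0, 3} + bracket c d e f * wedge_list [a, b] {0, 3}"
    "(wedge_list [a, b, c] \<star> wedge_list [d, e, f]) {1, 2} = bracket a d e f * wedge_list [b, c] {1, 2} -
      bracket b d e f * wedge_list [a, c] {1, 2} + bracket c d e f * wedge_list [a, b] {1, 2}"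
    "(wedge_list [a, b, c] \<star> wedge_list [d, e, f]) {1, 3} = bracket a d e f * wedge_list [b, c] {1, 3} -
      bracket b d e f * wedge_list [a, c] {1, 3} + bracket c d e f * wedge_list [a, b] {1, 3}"
    "(wedge_list [a, b, c] \<star> wedge_list [d, e, f]) {2, 3} = bracket a d e f * wedge_list [b, c] {2, 3} -
      bracket b d e f * wedge_list [a, c] {2, 3} + bracket c d e f * wedge_list [a, b] {2, 3}"
    unfolding coords bracket_expand m by (simp_all add: wedge_list_2 minor3_def algebra_simps)
  with U4 show ?thesis
    by auto
next
  case False
  with U show ?thesis
    by (subst shuffle_coords_3_3[where p = 3 and q = 3]) (simp_all add: wedge_list_degree)
qed

lemma wedge_list_singleton:
  assumes "S \<subseteq> {..<4}"
  shows "wedge_list [c] S = ext_of_vec c S"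
proof (cases "card S = 1")
  case True
  then have "S \<in> {{0}, {1}, {2}, {3}}"
    using subsets_4_cases(1)[OF assms] by blast
  then show ?thesis
    by (auto simp: wedge_list_1 ext_of_vec_singleton)
next
  case False
  with assms show ?thesis
    by (subst ext_of_vec_eq_0) (auto simp: wedge_list_degree)
qed

lemma wedge_2_1:
  assumes U: "U \<subseteq> {..<4}"
  shows "(wedge_list [a, b] \<curlywedge> wedge_list [c]) U = wedge_list [a, b, c] U"
proof -
  have "(wedge_list [a, b] \<curlywedge> wedge_list [c]) U = (wedge_list [a, b] \<curlywedge> ext_of_vec c) U"
    using U unfolding ext_wedge_def
    by (intro sum.cong refl arg_cong2[of _ _ _ _ "(*)"] wedge_list_singleton) auto
  moreover have "(wedge_list [a, b] \<curlywedge> ext_of_vec c) U = wedge_list [a, b, c] U"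
  proof (cases "card U = 3")
    case True
    then have "U \<in> {{0, 1, 2}, {0, 1, 3}, {0, 2, 3}, {1, 2, 3}}"
      using subsets_4_cases(3)[OF U] by blast
    then show ?thesis
      by (auto simp: wedge_vec_right wedge_list_2 wedge_list_3 minor3_def insert_Diff_if algebra_simps)
  next
    case False
    have "finite U"
      using U finite_subset by blast
    have "wedge_list [a, b] (U - {i}) = 0" if "i \<in> U" for i
      using U False card_Suc_Diff1[OF \<open>finite U\<close> that] by (intro wedge_list_degree) auto
    then show ?thesis
      using U False by (simp add: wedge_vec_right wedge_list_degree)
  qed
  ultimately show ?thesis
    by simp
qed

text \<open>Cramer's rule: five vectors in a four-dimensional space satisfy a linear relation whose
  coefficients are their brackets. It is the expansion of a 5 x 5 determinant in which row
  \<open>i\<close> is repeated.\<close>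

lemma cramer_coord:
  assumes "i < 4"
  shows "bracket a b c d * e $ i - bracket a b c e * d $ i + bracket a b d e * c $ i -
    bracket a c d e * b $ i + bracket b c d e * a $ i = 0"
proof -
  have "i \<in> {0, 1, 2, 3}"
    using assms by auto
  then show ?thesis
    by (elim insertE; simp add: bracket_expand minor3_def algebra_simps)
qed

text \<open>The linear functional given by the bracket with \<open>f\<close>, \<open>g\<close>,
  \<open>h\<close>, applied to the relation of Cramer's rule.\<close>

lemma cramer:
  "bracket a b c d * bracket e f g h - bracket a b c e * bracket d f g h + bracket a b d e * bracket c f g h -
    bracket a c d e * bracket b f g h + bracket b c d e * bracket a f g h = 0"
proof -
  define p1 p2 p3 p4 p5 where p: "p1 = bracket a b c d" "p2 = bracket a b c e" "p3 = bracket a b d e"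
    "p4 = bracket a c d e" "p5 = bracket b c d e"
  \<comment> \<open>The vanishing vector of Cramer's rule; its coefficients stay folded, so that
    only the bracket with \<open>f\<close>, \<open>g\<close>, \<open>h\<close> has to be
    expanded.\<close>
  define C where "C i = p1 * e $ i - p2 * d $ i + p3 * c $ i - p4 * b $ i + p5 * a $ i" for i
  have "C i = 0" if "i < 4" for i
    using cramer_coord[OF that] by (simp add: C_def p)
  then have "C 0 * minor3 f g h 1 2 3 - C 1 * minor3 f g h 0 2 3 + C 2 * minor3 f g h 0 1 3 -
      C 3 * minor3 f g h 0 1 2 = 0"
    by simp
  then show ?thesis
    unfolding p[symmetric] bracket_expand[of _ f g h] by (simp add: C_def algebra_simps)
qed

lemma bracket_swap:
  "bracket b a c d = - bracket a b c d"
  "bracket a c b d = - bracket a b c d"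
  "bracket a b d c = - bracket a b c d"
  by (simp_all add: bracket_expand minor3_def algebra_simps)

lemma bracket_repeat [simp]:
  "bracket a a c d = 0" "bracket a b b d = 0" "bracket a b c c = 0"
  "bracket a b a d = 0" "bracket a b c a = 0" "bracket a b c b = 0"
  by (simp_all add: bracket_expand minor3_def algebra_simps)

text \<open>The shuffle product reads its arguments on subsets of \<open>{..<4}\<close> only, which
  is where the formulas above hold; they can therefore be inserted into longer products.\<close>

lemma ext_shuffle_cong:
  assumes "\<And>S. S \<subseteq> {..<4} \<Longrightarrow> A S = A' S" "\<And>S. S \<subseteq> {..<4} \<Longrightarrow> B S = B' S"
  shows "A \<star> B = A' \<star> B'"
  unfolding ext_shuffle_def fun_eq_iff by (intro allI sum.cong) (auto simp: assms)

lemma ext_wedge_cong: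
  assumes "\<And>S. S \<subseteq> U \<Longrightarrow> A S = A' S" "\<And>S. S \<subseteq> U \<Longrightarrow> B S = B' S"
  shows "(A \<curlywedge> B) U = (A' \<curlywedge> B') U"
  unfolding ext_wedge_def by (intro sum.cong) (auto simp: assms)

lemma ext_shuffle_left_linear:
  "((\<lambda>S. x * A S - y * B S) \<star> D) U = x * (A \<star> D) U - y * (B \<star> D) U"
  "((\<lambda>S. x * A S - y * B S + z * C S) \<star> D) U = x * (A \<star> D) U - y * (B \<star> D) U + z * (C \<star> D) U"
  unfolding ext_shuffle_def
  by (simp_all add: sum_distrib_left algebra_simps sum.distrib sum_subtractf)

lemma ext_shuffle_right_linear:
  "(D \<star> (\<lambda>S. x * A S - y * B S + z * C S)) U = x * (D \<star> A) U - y * (D \<star> B) U + z * (D \<star> C) U"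
  unfolding ext_shuffle_def
  by (simp add: sum_distrib_left algebra_simps sum.distrib sum_subtractf)

lemma ext_wedge_linear:
  "((\<lambda>S. x * A S - y * B S + z * C S) \<curlywedge> D) U = x * (A \<curlywedge> D) U - y * (B \<curlywedge> D) U + z * (C \<curlywedge> D) U"
  "(D \<curlywedge> (\<lambda>S. x * A S - y * B S + z * C S)) U = x * (D \<curlywedge> A) U - y * (D \<curlywedge> B) U + z * (D \<curlywedge> C) U"
  unfolding ext_wedge_def
  by (simp_all add: sum_distrib_left algebra_simps sum.distrib sum_subtractf)

section \<open>Chain polynomials and intersections of lines and planes\<close>

lemma chain_2_3_3:
  "(wedge_list [a, b] \<star> wedge_list [c, d, e] \<star> wedge_list [f, g, h]) {} =
    bracket a c d e * bracket b f g h - bracket b c d e * bracket a f g h"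
proof -
  have "wedge_list [a, b] \<star> wedge_list [c, d, e] \<star> wedge_list [f, g, h] =
      (\<lambda>U. bracket a c d e * wedge_list [b] U - bracket b c d e * wedge_list [a] U) \<star> wedge_list [f, g, h]"
    by (rule ext_shuffle_cong) (auto simp: shuffle_2_3)
  then show ?thesis
    by (simp add: ext_shuffle_left_linear shuffle_1_3 ext_one_def)
qed

text \<open>Expanding the left product yields three terms; Cramer's rule for \<open>a\<close>,
  \<open>b\<close>, \<open>c\<close>, \<open>d\<close>, \<open>e\<close> trades them for
  two.\<close>

lemma chain_3_2_3:
  "(wedge_list [a, b, c] \<star> wedge_list [d, e] \<star> wedge_list [f, g, h]) {} =
    bracket a b c e * bracket d f g h - bracket a b c d * bracket e f g h"
proof -
  have "wedge_list [a, b, c] \<star> wedge_list [d, e] \<star> wedge_list [f, g, h] =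
      (\<lambda>U. bracket a b d e * wedge_list [c] U - bracket a c d e * wedge_list [b] U +
        bracket b c d e * wedge_list [a] U) \<star> wedge_list [f, g, h]"
    by (rule ext_shuffle_cong) (auto simp: shuffle_3_2)
  then show ?thesis
    using cramer[of a b c d e f g h]
    by (simp add: ext_shuffle_left_linear shuffle_1_3 ext_one_def) (simp add: algebra_simps)
qed

lemma shuffle_3_3_fun:
  "wedge_list [a, b, c] \<star> wedge_list [d, e, f] \<star> X =
    (\<lambda>U. bracket a d e f * wedge_list [b, c] U - bracket b d e f * wedge_list [a, c] U +
      bracket c d e f * wedge_list [a, b] U) \<star> X"
  by (rule ext_shuffle_cong) (auto simp: shuffle_3_3)

lemma chain_3_3_2:
  "(wedge_list [a, b, c] \<star> wedge_list [d, e, f] \<star> wedge_list [g, h]) {} =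
    bracket a d e f * bracket b c g h - bracket b d e f * bracket a c g h + bracket c d e f * bracket a b g h"
  unfolding shuffle_3_3_fun by (simp add: ext_shuffle_left_linear shuffle_2_2 ext_one_def)

text \<open>The common point of three planes, written in the vectors that span the first one. The
  coefficients are 2 x 2 determinants in the values of the two functionals that define the other
  planes.\<close>

lemma intersection_3_3_3:
  assumes "i < 4"
  shows "(wedge_list [a, b, c] \<star> wedge_list [d, e, f] \<star> wedge_list [g, h, k]) {i} =
    (bracket a d e f * bracket b g h k - bracket b d e f * bracket a g h k) * c $ i -
    (bracket a d e f * bracket c g h k - bracket c d e f * bracket a g h k) * b $ i +
    (bracket b d e f * bracket c g h k - bracket c d e f * bracket b g h k) * a $ i"
  unfolding shuffle_3_3_fun
  using assms by (simp add: ext_shuffle_left_linear shuffle_2_3 wedge_list_1) (simp add: algebra_simps)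

text \<open>The point where the line \<open>ab\<close> meets the plane spanned by \<open>c\<close>
  and the line common to the planes \<open>def\<close> and \<open>ghk\<close>.\<close>

lemma projection_2_3:
  assumes "i < 4"
  shows "(wedge_list [a, b] \<star> (wedge_list [c] \<curlywedge> (wedge_list [d, e, f] \<star> wedge_list [g, h, k]))) {i} =
    (bracket a d e f * bracket c g h k - bracket c d e f * bracket a g h k) * b $ i -
    (bracket b d e f * bracket c g h k - bracket c d e f * bracket b g h k) * a $ i"
proof -
  let ?x = "bracket d g h k" and ?y = "bracket e g h k" and ?z = "bracket f g h k"
  have "(wedge_list [c] \<curlywedge> (wedge_list [d, e, f] \<star> wedge_list [g, h, k])) U =
      ?x * wedge_list [c, e, f] U - ?y * wedge_list [c, d, f] U + ?z * wedge_list [c, d, e] U"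
    if U: "U \<subseteq> {..<4}" for U
  proof -
    have "(wedge_list [c] \<curlywedge> (wedge_list [d, e, f] \<star> wedge_list [g, h, k])) U =
        (ext_of_vec c \<curlywedge> (\<lambda>U. ?x * wedge_list [e, f] U - ?y * wedge_list [d, f] U + ?z * wedge_list [d, e] U)) U"
      using U by (intro ext_wedge_cong wedge_list_singleton shuffle_3_3) auto
    then show ?thesis
      by (simp add: ext_wedge_linear wedge_list_simps)
  qed
  then have "(wedge_list [a, b] \<star> (wedge_list [c] \<curlywedge> (wedge_list [d, e, f] \<star> wedge_list [g, h, k]))) =
      (wedge_list [a, b] \<star> (\<lambda>U. ?x * wedge_list [c, e, f] U - ?y * wedge_list [c, d, f] U + ?z * wedge_list [c, d, e] U))"
    by (intro ext_shuffle_cong) auto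
  then have "(wedge_list [a, b] \<star> (wedge_list [c] \<curlywedge> (wedge_list [d, e, f] \<star> wedge_list [g, h, k]))) {i} =
      (?x * bracket a c e f - ?y * bracket a c d f + ?z * bracket a c d e) * b $ i -
      (?x * bracket b c e f - ?y * bracket b c d f + ?z * bracket b c d e) * a $ i"
    using assms by (simp add: ext_shuffle_right_linear shuffle_2_3 wedge_list_1) (simp add: algebra_simps)
  \<comment> \<open>That plane belongs to the pencil of the planes \<open>def\<close> and
    \<open>ghk\<close>: its functional is the combination of the two given functionals that vanishes
    at \<open>c\<close>.\<close>
  moreover have "?x * bracket v c e f - ?y * bracket v c d f + ?z * bracket v c d e =
      bracket v d e f * bracket c g h k - bracket c d e f * bracket v g h k" for v
    using cramer[of v c d e f g h k] by (simp add: algebra_simps)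
  ultimately show ?thesis
    by simp
qed

text \<open>The point where the line \<open>hk\<close> meets the plane spanned by \<open>g\<close>
  and the line common to the planes \<open>abc\<close> and \<open>def\<close>.\<close>

lemma projection_3_2:
  assumes "i < 4"
  shows "(((wedge_list [a, b, c] \<star> wedge_list [d, e, f]) \<curlywedge> wedge_list [g]) \<star> wedge_list [h, k]) {i} =
    (bracket a d e f * bracket b c g k - bracket b d e f * bracket a c g k + bracket c d e f * bracket a b g k) * h $ i -
    (bracket a d e f * bracket b c g h - bracket b d e f * bracket a c g h + bracket c d e f * bracket a b g h) * k $ i"
proof -
  let ?x = "bracket a d e f" and ?y = "bracket b d e f" and ?z = "bracket c d e f"
  let ?M = "\<lambda>U. ?x * wedge_list [b, c, g] U - ?y * wedge_list [a, c, g] U + ?z * wedge_list [a, b, g] U"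
  let ?L = "\<lambda>U. ?x * wedge_list [b, c] U - ?y * wedge_list [a, c] U + ?z * wedge_list [a, b] U"
  have "((wedge_list [a, b, c] \<star> wedge_list [d, e, f]) \<curlywedge> wedge_list [g]) U = ?M U" if U: "U \<subseteq> {..<4}" for U
  proof -
    have "((wedge_list [a, b, c] \<star> wedge_list [d, e, f]) \<curlywedge> wedge_list [g]) U = (?L \<curlywedge> wedge_list [g]) U"
      using U by (intro ext_wedge_cong shuffle_3_3) auto
    then show ?thesis
      by (simp add: ext_wedge_linear wedge_2_1 U)
  qed
  then have "((wedge_list [a, b, c] \<star> wedge_list [d, e, f]) \<curlywedge> wedge_list [g]) \<star> wedge_list [h, k] =
      ?M \<star> wedge_list [h, k]"
    by (intro ext_shuffle_cong) auto
  \<comment> \<open>The shuffle formula gives the point in terms of \<open>u\<close>,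
    \<open>v\<close>, \<open>g\<close>; Cramer's rule rewrites it on the line
    \<open>hk\<close>.\<close>
  moreover have "(wedge_list [u, v, g] \<star> wedge_list [h, k]) {i} = bracket u v g k * h $ i - bracket u v g h * k $ i" for u v
    using cramer_coord[OF assms, of u v g h k] assms
    by (simp add: shuffle_3_2 wedge_list_1) (simp add: algebra_simps)
  ultimately show ?thesis
    by (simp add: ext_shuffle_left_linear) (simp add: algebra_simps)
qed

section \<open>Pluecker relations and the exchange relations of the eleven mutations\<close>

lemma plucker_bracket: "plucker [i, j, k, l] = bracket (zcol i) (zcol j) (zcol k) (zcol l)"
  by (simp add: plucker_def bracket_def)

text \<open>The conditions on the indices make these terminating rewrite rules towards increasing
  indices, after which identities between brackets are compared as polynomials in sorted
  ones.\<close>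

lemma plucker_sort:
  "j < i \<Longrightarrow> plucker [i, j, k, l] = - plucker [j, i, k, l]"
  "k < j \<Longrightarrow> plucker [i, j, k, l] = - plucker [i, k, j, l]"
  "l < k \<Longrightarrow> plucker [i, j, k, l] = - plucker [i, j, l, k]"
  unfolding plucker_bracket by (rule bracket_swap)+

lemma plucker_repeat [simp]:
  "plucker [i, i, k, l] = 0" "plucker [i, j, j, l] = 0" "plucker [i, j, k, k] = 0"
  "plucker [i, j, i, l] = 0" "plucker [i, j, k, i] = 0" "plucker [i, j, k, j] = 0"
  by (simp_all add: plucker_bracket)

lemma cramer_plucker:
  "plucker [a, b, c, d] * plucker [e, f, g, h] - plucker [a, b, c, e] * plucker [d, f, g, h] +
   plucker [a, b, d, e] * plucker [c, f, g, h] - plucker [a, c, d, e] * plucker [b, f, g, h] +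
   plucker [b, c, d, e] * plucker [a, f, g, h] = 0"
  unfolding plucker_bracket by (rule cramer)

text \<open>Cramer's rule for \<open>a\<close>, \<open>b\<close>, \<open>d\<close>,
  \<open>e\<close>, \<open>f\<close> against \<open>a\<close>, \<open>b\<close>, \<open>c\<close>:
  the two terms in which \<open>a\<close> or \<open>b\<close> meets itself vanish.\<close>

lemma three_term:
  "plucker [a, b, c, d] * plucker [a, b, e, f] - plucker [a, b, c, e] * plucker [a, b, d, f] +
   plucker [a, b, c, f] * plucker [a, b, d, e] = 0"
proof -
  have "plucker [f, a, b, c] = - plucker [a, b, c, f]" "plucker [d, a, b, c] = - plucker [a, b, c, d]"
    "plucker [e, a, b, c] = - plucker [a, b, c, e]"
    unfolding plucker_bracket by (simp_all add: bracket_expand minor3_def algebra_simps)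
  then show ?thesis
    using cramer_plucker[of a b d e f a b c] by (simp add: algebra_simps)
qed

lemma chain_brackets:
  "chain [a, b] [c, d, e] [f, g, h] =
    plucker [a, c, d, e] * plucker [b, f, g, h] - plucker [b, c, d, e] * plucker [a, f, g, h]"
  "chain [a, b, c] [d, e] [f, g, h] =
    plucker [a, b, c, e] * plucker [d, f, g, h] - plucker [a, b, c, d] * plucker [e, f, g, h]"
  "chain [a, b, c] [d, e, f] [g, h] =
    plucker [a, d, e, f] * plucker [b, c, g, h] - plucker [b, d, e, f] * plucker [a, c, g, h] +
    plucker [c, d, e, f] * plucker [a, b, g, h]"
  by (simp_all add: chain_def scalar_of_ext_def zw_def plucker_bracket chain_2_3_3 chain_3_2_3 chain_3_3_2)

text \<open>The chain formulas give binomials for the first six; for the last three they give three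
  terms, which Cramer's rule for 1, 2, 3 and the two remaining indices of the last block contracts
  to two.\<close>

lemma spurion_F_brackets:
  "spurion_F 1 = plucker [2, 4, 5, 6] * plucker [3, 7, 8, 9] - plucker [3, 4, 5, 6] * plucker [2, 7, 8, 9]"
  "spurion_F 2 = plucker [1, 4, 5, 6] * plucker [3, 7, 8, 9] - plucker [3, 4, 5, 6] * plucker [1, 7, 8, 9]"
  "spurion_F 3 = plucker [1, 4, 5, 6] * plucker [2, 7, 8, 9] - plucker [2, 4, 5, 6] * plucker [1, 7, 8, 9]"
  "spurion_F 4 = plucker [1, 2, 3, 6] * plucker [5, 7, 8, 9] - plucker [1, 2, 3, 5] * plucker [6, 7, 8, 9]"
  "spurion_F 5 = plucker [1, 2, 3, 6] * plucker [4, 7, 8, 9] - plucker [1, 2, 3, 4] * plucker [6, 7, 8, 9]"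
  "spurion_F 6 = plucker [1, 2, 3, 5] * plucker [4, 7, 8, 9] - plucker [1, 2, 3, 4] * plucker [5, 7, 8, 9]"
  "spurion_F 7 = plucker [1, 2, 3, 8] * plucker [4, 5, 6, 9] - plucker [1, 2, 3, 9] * plucker [4, 5, 6, 8]"
  "spurion_F 8 = plucker [1, 2, 3, 7] * plucker [4, 5, 6, 9] - plucker [1, 2, 3, 9] * plucker [4, 5, 6, 7]"
  "spurion_F 9 = plucker [1, 2, 3, 7] * plucker [4, 5, 6, 8] - plucker [1, 2, 3, 8] * plucker [4, 5, 6, 7]"
  using cramer_plucker[of 1 2 3 8 9 4 5 6] cramer_plucker[of 1 2 3 7 9 4 5 6] cramer_plucker[of 1 2 3 7 8 4 5 6]
  by (simp_all add: spurion_F_def chain_brackets plucker_sort) (simp_all add: algebra_simps)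

text \<open>The first mutation at \<open>(3, 8)\<close>. Here and below, the listed relations
  generate an ideal in the sorted brackets that contains the difference of the two sides.\<close>

lemma exchange_X:
  "(plucker [1, 5, 6, 7] * plucker [2, 7, 8, 9] - plucker [2, 5, 6, 7] * plucker [1, 7, 8, 9]) * plucker [1, 6, 7, 8] =
    plucker [1, 2, 7, 8] * plucker [1, 5, 6, 7] * plucker [6, 7, 8, 9] + plucker [1, 2, 6, 7] * plucker [1, 7, 8, 9] * plucker [5, 6, 7, 8]"
  using three_term[of 7 8 1 2 6 9] three_term[of 6 7 1 2 5 8]
  by (simp add: plucker_sort spurion_F_brackets del: One_nat_def) Groebner_Basis.algebra

lemma exchange_F3:
  "spurion_F 3 * plucker [1, 5, 6, 7] =
    plucker [1, 4, 5, 6] * (plucker [1, 5, 6, 7] * plucker [2, 7, 8, 9] - plucker [2, 5, 6, 7] * plucker [1, 7, 8, 9]) + plucker [1, 2, 5, 6] * plucker [1, 7, 8, 9] * plucker [4, 5, 6, 7]"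
  using three_term[of 5 6 1 2 4 7]
  by (simp add: plucker_sort spurion_F_brackets del: One_nat_def) Groebner_Basis.algebra

lemma exchange_F4:
  "spurion_F 4 * plucker [1, 2, 6, 7] =
    plucker [1, 2, 3, 7] * plucker [1, 2, 5, 6] * plucker [6, 7, 8, 9] + plucker [1, 2, 3, 6] * (plucker [1, 5, 6, 7] * plucker [2, 7, 8, 9] - plucker [2, 5, 6, 7] * plucker [1, 7, 8, 9])"
  using cramer_plucker[of 1 2 5 6 7 7 8 9] three_term[of 1 2 3 5 6 7]
  by (simp add: plucker_sort spurion_F_brackets del: One_nat_def) Groebner_Basis.algebra

lemma exchange_F6:
  "spurion_F 6 * plucker [1, 2, 5, 6] =
    plucker [1, 2, 4, 5] * spurion_F 4 + plucker [1, 2, 3, 5] * spurion_F 3"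
  using cramer_plucker[of 1 2 4 5 6 7 8 9] three_term[of 1 2 3 4 5 6]
  by (simp add: plucker_sort spurion_F_brackets del: One_nat_def) Groebner_Basis.algebra

lemma exchange_F2:
  "spurion_F 2 * plucker [1, 2, 4, 5] =
    spurion_F 6 * plucker [1, 4, 5, 6] + plucker [1, 3, 4, 5] * spurion_F 3"
  using cramer_plucker[of 1 3 4 5 6 7 8 9] cramer_plucker[of 1 2 4 5 6 7 8 9]
    three_term[of 1 4 2 3 5 6] three_term[of 1 5 2 3 4 6]
  by (simp add: plucker_sort spurion_F_brackets del: One_nat_def) Groebner_Basis.algebra

lemma exchange_P3789:
  "plucker [3, 7, 8, 9] * plucker [1, 4, 5, 6] =
    spurion_F 2 + plucker [1, 7, 8, 9] * plucker [3, 4, 5, 6]"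
  unfolding spurion_F_brackets by (simp add: algebra_simps)

lemma exchange_F1:
  "spurion_F 1 * plucker [1, 3, 4, 5] =
    spurion_F 6 * plucker [3, 4, 5, 6] + spurion_F 2 * plucker [2, 3, 4, 5]"
  using cramer_plucker[of 2 3 4 5 6 7 8 9] cramer_plucker[of 1 3 4 5 6 7 8 9] three_term[of 3 4 1 2 5 6]
    three_term[of 3 5 1 2 4 6]
  by (simp add: plucker_sort spurion_F_brackets del: One_nat_def) Groebner_Basis.algebra

text \<open>The second mutation at \<open>(3, 8)\<close>, which removes the auxiliary variable
  again.\<close>

lemma exchange_F9:
  "spurion_F 9 * (plucker [1, 5, 6, 7] * plucker [2, 7, 8, 9] - plucker [2, 5, 6, 7] * plucker [1, 7, 8, 9]) =
    plucker [1, 2, 3, 7] * spurion_F 3 * plucker [5, 6, 7, 8] + spurion_F 4 * plucker [1, 2, 7, 8] * plucker [4, 5, 6, 7]"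
  using cramer_plucker[of 1 2 5 6 7 7 8 9] cramer_plucker[of 1 2 4 5 6 7 8 9] cramer_plucker[of 4 5 6 7 8 7 8 9]
    three_term[of 1 2 3 5 7 8] cramer_plucker[of 4 5 6 7 8 1 2 5] three_term[of 1 2 3 6 7 8]
    cramer_plucker[of 4 5 6 7 8 1 2 6]
  by (simp add: plucker_sort spurion_F_brackets del: One_nat_def) Groebner_Basis.algebra

lemma exchange_F7:
  "spurion_F 7 * plucker [1, 2, 7, 8] =
    plucker [1, 2, 3, 8] * spurion_F 3 + plucker [1, 2, 8, 9] * spurion_F 9"
  using cramer_plucker[of 1 2 3 8 9 4 5 6] cramer_plucker[of 1 2 3 7 8 4 5 6]
    three_term[of 2 8 1 3 7 9] three_term[of 1 8 2 3 7 9]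
  by (simp add: plucker_sort spurion_F_brackets del: One_nat_def) Groebner_Basis.algebra

text \<open>The last three \<open>F_i\<close> are the 2 x 2 minors of the matrix with columns
  \<open>(<123j>, <456j>)\<close> for \<open>j\<close> = 7, 8, 9, and the relation expands a 3 x 3
  determinant with a repeated row.\<close>

lemma exchange_F8:
  "spurion_F 8 * plucker [1, 2, 3, 8] =
    plucker [1, 2, 3, 7] * spurion_F 7 + plucker [1, 2, 3, 9] * spurion_F 9"
  unfolding spurion_F_brackets by (simp add: algebra_simps)

lemma exchange_F5:
  "spurion_F 5 * plucker [1, 2, 3, 5] =
    plucker [1, 2, 3, 4] * spurion_F 4 + plucker [1, 2, 3, 6] * spurion_F 6"
  unfolding spurion_F_brackets by (simp add: algebra_simps)

text \<open>The same kind of relation for the first three \<open>F_i\<close>. It is not one of the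
  eleven exchange relations but evaluates the image of \<open><2789>\<close>.\<close>

lemma exchange_spurion:
  "spurion_F 2 * plucker [2, 7, 8, 9] =
    spurion_F 1 * plucker [1, 7, 8, 9] + spurion_F 3 * plucker [3, 7, 8, 9]"
  unfolding spurion_F_brackets by (simp add: algebra_simps)

section \<open>Quasi-cluster homomorphisms from one pair of seeds\<close>

definition seed_ok :: "'v seed \<Rightarrow> bool" where
  "seed_ok \<Sigma> \<longleftrightarrow> finite (vertices \<Sigma>) \<and> frozen \<Sigma> \<subseteq> vertices \<Sigma> \<and> (\<forall>v. arrows \<Sigma> v v = 0)"

definition in_product :: "'v seed \<Rightarrow> 'v \<Rightarrow> ratfun" where
  "in_product \<Sigma> k = (\<Prod>i\<in>vertices \<Sigma>. cluster \<Sigma> i ^ arrows \<Sigma> i k)"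

definition out_product :: "'v seed \<Rightarrow> 'v \<Rightarrow> ratfun" where
  "out_product \<Sigma> k = (\<Prod>i\<in>vertices \<Sigma>. cluster \<Sigma> i ^ arrows \<Sigma> k i)"

lemma exchange_ratio_alt: "exchange_ratio \<Sigma> k = out_product \<Sigma> k / in_product \<Sigma> k"
  by (simp add: exchange_ratio_def out_product_def in_product_def)

lemma mutate_simps [simp]:
  "vertices (mutate k \<Sigma>) = vertices \<Sigma>"
  "frozen (mutate k \<Sigma>) = frozen \<Sigma>"
  "mutable (mutate k \<Sigma>) = mutable \<Sigma>"
  "arrows (mutate k \<Sigma>) = quiver_mutation k (arrows \<Sigma>)"
  by (simp_all add: mutate_def mutable_def)

lemma cluster_mutate:
  "cluster (mutate k \<Sigma>) =
    (cluster \<Sigma>)(k := (in_product \<Sigma> k + out_product \<Sigma> k) / cluster \<Sigma> k)"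
  by (simp add: mutate_def in_product_def out_product_def)

lemma seed_ok_mutate: "seed_ok \<Sigma> \<Longrightarrow> seed_ok (mutate k \<Sigma>)"
  by (simp add: seed_ok_def quiver_mutation_def)

text \<open>A semifield without zero. Mutation is free of subtractions, so a seed with variables in
  \<open>S\<close> has only nonzero variables in its whole mutation class.\<close>

definition positive_cone :: "ratfun set \<Rightarrow> bool" where
  "positive_cone S \<longleftrightarrow> 0 \<notin> S \<and> 1 \<in> S \<and> (\<forall>x\<in>S. \<forall>y\<in>S. x + y \<in> S \<and> x * y \<in> S) \<and> (\<forall>x\<in>S. inverse x \<in> S)"

lemma positive_cone_prod:
  assumes "positive_cone S" "\<And>i. i \<in> I \<Longrightarrow> g i \<in> S"
  shows "(\<Prod>i\<in>I. g i ^ e i) \<in> S"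
proof -
  have pow: "x ^ k \<in> S" if "x \<in> S" for x k
    using assms(1) that by (induction k) (auto simp: positive_cone_def)
  show ?thesis
    using assms by (induction I rule: infinite_finite_induct) (auto simp: positive_cone_def pow)
qed

definition seed_positive :: "ratfun set \<Rightarrow> 'v seed \<Rightarrow> bool" where
  "seed_positive S \<Sigma> \<longleftrightarrow> (\<forall>v\<in>vertices \<Sigma>. cluster \<Sigma> v \<in> S)"

lemma product_positive:
  assumes "positive_cone S" "seed_positive S \<Sigma>"
  shows "in_product \<Sigma> k \<in> S" "out_product \<Sigma> k \<in> S"
  unfolding in_product_def out_product_def using assms
  by (auto simp: seed_positive_def intro: positive_cone_prod)

lemma seed_positive_mutate:
  assumes "positive_cone S" "seed_positive S \<Sigma>"
  shows "seed_positive S (mutate k \<Sigma>)"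
  using product_positive[OF assms, of k] assms
  by (auto simp: seed_positive_def cluster_mutate positive_cone_def divide_inverse)

lemma seed_positive_nonzero:
  "positive_cone S \<Longrightarrow> seed_positive S \<Sigma> \<Longrightarrow> v \<in> vertices \<Sigma> \<Longrightarrow> cluster \<Sigma> v \<noteq> 0"
  by (auto simp: seed_positive_def positive_cone_def)

section \<open>The exchange matrix and the mutation of exchange ratios\<close>

definition net_arrows :: "'v seed \<Rightarrow> 'v \<Rightarrow> 'v \<Rightarrow> int" where
  "net_arrows \<Sigma> i j = int (arrows \<Sigma> i j) - int (arrows \<Sigma> j i)"

lemma net_arrows_mutate:
  assumes "i \<noteq> k" "j \<noteq> k"
  shows "net_arrows (mutate k \<Sigma>) i j = net_arrows \<Sigma> i j +
    int (arrows \<Sigma> i k * arrows \<Sigma> k j) - int (arrows \<Sigma> j k * arrows \<Sigma> k i)"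
proof -
  have "int (x - y) - int (y - x) = int x - int y" for x y :: nat
    by linarith
  then show ?thesis
    using assms by (simp add: net_arrows_def quiver_mutation_def Let_def)
qed

lemma net_arrows_mutate_self:
  "i = k \<or> j = k \<Longrightarrow> net_arrows (mutate k \<Sigma>) i j = - net_arrows \<Sigma> i j"
  by (auto simp: net_arrows_def quiver_mutation_def Let_def)

lemma exchange_ratio_net_arrows:
  assumes "\<And>v. v \<in> vertices \<Sigma> \<Longrightarrow> cluster \<Sigma> v \<noteq> 0"
  shows "exchange_ratio \<Sigma> i = (\<Prod>j\<in>vertices \<Sigma>. cluster \<Sigma> j powi net_arrows \<Sigma> i j)"
  unfolding exchange_ratio_def prod_dividef[symmetric]
  by (intro prod.cong) (auto simp: net_arrows_def power_int_diff assms)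

text \<open>All arrows at \<open>k\<close> are reversed, and without loops the changed variable does
  not enter its own ratio.\<close>

lemma exchange_ratio_mutate_self:
  assumes "positive_cone S" "seed_positive S \<Sigma>" "seed_ok \<Sigma>"
  shows "exchange_ratio (mutate k \<Sigma>) k = inverse (exchange_ratio \<Sigma> k)"
proof -
  note nz = seed_positive_nonzero[OF assms(1,2)]
  note nz' = seed_positive_nonzero[OF assms(1) seed_positive_mutate[OF assms(1,2)]]
  have "exchange_ratio (mutate k \<Sigma>) k =
      (\<Prod>j\<in>vertices \<Sigma>. cluster (mutate k \<Sigma>) j powi - net_arrows \<Sigma> k j)"
    using nz' by (subst exchange_ratio_net_arrows) (auto simp: net_arrows_mutate_self)
  also have "\<dots> = (\<Prod>j\<in>vertices \<Sigma>. inverse (cluster \<Sigma> j powi net_arrows \<Sigma> k j))"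
    by (intro prod.cong) (auto simp: cluster_mutate net_arrows_def simp flip: power_int_minus)
  finally show ?thesis
    using nz by (simp add: exchange_ratio_net_arrows prod_inversef[unfolded o_def])
qed

text \<open>With \<open>P\<close> and \<open>Q\<close> the out- and in-products at \<open>k\<close>,
  the new variable is \<open>(P + Q) / x_k\<close>, and the paths through \<open>k\<close>
  contribute powers of \<open>P\<close> and \<open>Q\<close>. Apart from the old ratio at
  \<open>i\<close>, everything depends only on \<open>P / Q\<close>, the ratio at
  \<open>k\<close>.\<close>

lemma exchange_ratio_mutate:
  assumes S: "positive_cone S" "seed_positive S \<Sigma>" "seed_ok \<Sigma>" and k: "k \<in> vertices \<Sigma>" "i \<noteq> k"
  shows "exchange_ratio (mutate k \<Sigma>) i = exchange_ratio \<Sigma> i * exchange_ratio \<Sigma> k ^ arrows \<Sigma> i k *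
    (1 + exchange_ratio \<Sigma> k) powi (int (arrows \<Sigma> k i) - int (arrows \<Sigma> i k))"
proof -
  note nz = seed_positive_nonzero[OF S(1,2)]
  note nz' = seed_positive_nonzero[OF S(1) seed_positive_mutate[OF S(1,2)]]
  let ?V = "vertices \<Sigma>" and ?x = "cluster \<Sigma>" and ?a = "arrows \<Sigma>" and ?b = "net_arrows \<Sigma>"
  define P Q where "P = out_product \<Sigma> k" and "Q = in_product \<Sigma> k"
  have fin: "finite ?V"
    using S(3) by (simp add: seed_ok_def)
  have "P \<in> S" "Q \<in> S"
    using product_positive[OF S(1,2), of k] by (simp_all add: P_def Q_def)
  then have pos: "P \<noteq> 0" "Q \<noteq> 0" "P + Q \<noteq> 0"
    using S(1) unfolding positive_cone_def by metis+
  have akk: "?a k k = 0"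
    using S(3) by (simp add: seed_ok_def)
  have P: "P = (\<Prod>j\<in>?V - {k}. ?x j ^ ?a k j)" and Q: "Q = (\<Prod>j\<in>?V - {k}. ?x j ^ ?a j k)"
    unfolding P_def Q_def out_product_def in_product_def
    by (simp_all add: prod.remove[OF fin k(1)] akk)
  have "exchange_ratio (mutate k \<Sigma>) i =
      (\<Prod>j\<in>?V. cluster (mutate k \<Sigma>) j powi net_arrows (mutate k \<Sigma>) i j)"
    using nz' by (subst exchange_ratio_net_arrows) auto
  also have "\<dots> = cluster (mutate k \<Sigma>) k powi net_arrows (mutate k \<Sigma>) i k *
      (\<Prod>j\<in>?V - {k}. cluster (mutate k \<Sigma>) j powi net_arrows (mutate k \<Sigma>) i j)"
    by (rule prod.remove[OF fin k(1)])
  also have "cluster (mutate k \<Sigma>) k powi net_arrows (mutate k \<Sigma>) i k =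
      (P + Q) powi - ?b i k * ?x k powi ?b i k"
    using nz[OF k(1)]
    by (simp add: cluster_mutate P_def Q_def net_arrows_mutate_self power_int_divide_distrib
        power_int_minus add.commute) (simp add: divide_inverse mult.commute)
  also have "(\<Prod>j\<in>?V - {k}. cluster (mutate k \<Sigma>) j powi net_arrows (mutate k \<Sigma>) i j) =
      (\<Prod>j\<in>?V - {k}. ?x j powi ?b i j * (?x j ^ ?a k j) ^ ?a i k / (?x j ^ ?a j k) ^ ?a k i)"
  proof (intro prod.cong refl)
    fix j assume j: "j \<in> ?V - {k}"
    then have "?x j \<noteq> 0"
      using nz by auto
    then have "?x j powi (?b i j + int (?a i k * ?a k j) - int (?a j k * ?a k i)) =
        ?x j powi ?b i j * ?x j ^ (?a i k * ?a k j) / ?x j ^ (?a j k * ?a k i)"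
      by (simp only: power_int_add power_int_diff power_int_of_nat simp_thms)
    with j k show "cluster (mutate k \<Sigma>) j powi net_arrows (mutate k \<Sigma>) i j =
        ?x j powi ?b i j * (?x j ^ ?a k j) ^ ?a i k / (?x j ^ ?a j k) ^ ?a k i"
      by (simp add: net_arrows_mutate cluster_mutate mult.commute flip: power_mult)
  qed
  also have "\<dots> = (\<Prod>j\<in>?V - {k}. ?x j powi ?b i j) * P ^ ?a i k / Q ^ ?a k i"
    unfolding P Q prod_dividef prod.distrib prod_power_distrib ..
  also have "(P + Q) powi - ?b i k * ?x k powi ?b i k * ((\<Prod>j\<in>?V - {k}. ?x j powi ?b i j) * P ^ ?a i k / Q ^ ?a k i) =
      (?x k powi ?b i k * (\<Prod>j\<in>?V - {k}. ?x j powi ?b i j)) * ((P + Q) powi - ?b i k * P ^ ?a i k / Q ^ ?a k i)"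
    by simp
  also have "?x k powi ?b i k * (\<Prod>j\<in>?V - {k}. ?x j powi ?b i j) = exchange_ratio \<Sigma> i"
    using nz by (simp add: exchange_ratio_net_arrows prod.remove[OF fin k(1)])
  also have "(P + Q) powi - ?b i k * P ^ ?a i k / Q ^ ?a k i =
      (P / Q) ^ ?a i k * (1 + P / Q) powi (int (?a k i) - int (?a i k))"
  proof -
    have "1 + P / Q = (P + Q) / Q"
      using pos by (simp add: field_simps)
    then have "(1 + P / Q) powi (int (?a k i) - int (?a i k)) =
        (P + Q) powi - ?b i k * (Q ^ ?a i k / Q ^ ?a k i)"
      using pos by (simp add: power_int_divide_distrib net_arrows_def power_int_diff)
    then show ?thesis
      using pos by (simp add: power_divide)
  qed
  finally show ?thesis
    by (simp add: exchange_ratio_alt P_def Q_def mult.assoc)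
qed

lemma frozen_monomials_props:
  assumes "finite (frozen \<Sigma>)" "\<And>v. v \<in> frozen \<Sigma> \<Longrightarrow> cluster \<Sigma> v \<noteq> 0"
  shows "1 \<in> frozen_monomials \<Sigma>"
    "x \<in> frozen_monomials \<Sigma> \<Longrightarrow> y \<in> frozen_monomials \<Sigma> \<Longrightarrow> x * y \<in> frozen_monomials \<Sigma>"
    "x \<in> frozen_monomials \<Sigma> \<Longrightarrow> inverse x \<in> frozen_monomials \<Sigma>"
    "v \<in> frozen \<Sigma> \<Longrightarrow> cluster \<Sigma> v \<in> frozen_monomials \<Sigma>"
    "x \<in> frozen_monomials \<Sigma> \<Longrightarrow> x \<noteq> 0"
proof -
  have I: "(\<Prod>v\<in>frozen \<Sigma>. cluster \<Sigma> v powi e v) \<in> frozen_monomials \<Sigma>" for e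
    by (auto simp: frozen_monomials_def)
  have E: "\<exists>e. x = (\<Prod>v\<in>frozen \<Sigma>. cluster \<Sigma> v powi e v)" if "x \<in> frozen_monomials \<Sigma>" for x
    using that by (auto simp: frozen_monomials_def)
  show "1 \<in> frozen_monomials \<Sigma>"
    using I[of "\<lambda>_. 0"] by simp
  show "x * y \<in> frozen_monomials \<Sigma>" if xy: "x \<in> frozen_monomials \<Sigma>" "y \<in> frozen_monomials \<Sigma>"
  proof -
    obtain e e' where "x = (\<Prod>v\<in>frozen \<Sigma>. cluster \<Sigma> v powi e v)" "y = (\<Prod>v\<in>frozen \<Sigma>. cluster \<Sigma> v powi e' v)"
      using E[OF xy(1)] E[OF xy(2)] by blast
    then have "x * y = (\<Prod>v\<in>frozen \<Sigma>. cluster \<Sigma> v powi (e v + e' v))"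
      using assms(2) by (simp add: power_int_add flip: prod.distrib)
    then show ?thesis
      using I by simp
  qed
  show "inverse x \<in> frozen_monomials \<Sigma>" if x: "x \<in> frozen_monomials \<Sigma>"
  proof -
    obtain e where "x = (\<Prod>v\<in>frozen \<Sigma>. cluster \<Sigma> v powi e v)"
      using E[OF x] by blast
    then have "inverse x = (\<Prod>v\<in>frozen \<Sigma>. cluster \<Sigma> v powi - e v)"
      by (simp add: power_int_minus flip: prod_inversef)
    then show ?thesis
      using I by simp
  qed
  show "cluster \<Sigma> v \<in> frozen_monomials \<Sigma>" if v: "v \<in> frozen \<Sigma>"
  proof -
    have "cluster \<Sigma> w powi (if w = v then 1 else 0) = (if w = v then cluster \<Sigma> w else 1)" for w
      by simp
    then show ?thesis
      using I[of "\<lambda>w. if w = v then 1 else 0"] v assms(1) by (simp add: prod.delta)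
  qed
  show "x \<noteq> 0" if x: "x \<in> frozen_monomials \<Sigma>"
    using E[OF x] assms by (auto simp: prod_zero_iff)
qed

text \<open>Outside its domain a substitution has an unspecified value, so the homomorphism laws are
  demanded on a subfield \<open>K\<close>. The law for inverses includes
  \<open>inverse 0 = 0\<close>; for nonzero elements it forces nonzero values and thus injectivity
  on \<open>K\<close>.\<close>

locale partial_field_hom =
  fixes f :: "ratfun \<Rightarrow> ratfun" and K :: "ratfun set"
  assumes const_K: "const c \<in> K" and f_const: "f (const c) = const c"
    and add_K: "x \<in> K \<Longrightarrow> y \<in> K \<Longrightarrow> x + y \<in> K"
    and f_add: "x \<in> K \<Longrightarrow> y \<in> K \<Longrightarrow> f (x + y) = f x + f y"
    and mult_K: "x \<in> K \<Longrightarrow> y \<in> K \<Longrightarrow> x * y \<in> K"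
    and f_mult: "x \<in> K \<Longrightarrow> y \<in> K \<Longrightarrow> f (x * y) = f x * f y"
    and inverse_K: "x \<in> K \<Longrightarrow> inverse x \<in> K"
    and f_inverse: "x \<in> K \<Longrightarrow> f (inverse x) = inverse (f x)"
begin

lemma one_K: "1 \<in> K" and f_one: "f 1 = 1"
  using const_K[of 1] f_const[of 1] by (simp_all add: const_def One_fract_def)

lemma divide_K: "x \<in> K \<Longrightarrow> y \<in> K \<Longrightarrow> x / y \<in> K"
  and f_divide: "x \<in> K \<Longrightarrow> y \<in> K \<Longrightarrow> f (x / y) = f x / f y"
  by (simp_all add: divide_inverse mult_K inverse_K f_mult f_inverse)

lemma power_K: "x \<in> K \<Longrightarrow> x ^ n \<in> K" and f_power: "x \<in> K \<Longrightarrow> f (x ^ n) = f x ^ n"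
proof -
  have "x ^ n \<in> K \<and> f (x ^ n) = f x ^ n" if "x \<in> K"
    using that by (induction n) (auto simp: one_K f_one mult_K f_mult)
  then show "x \<in> K \<Longrightarrow> x ^ n \<in> K" "x \<in> K \<Longrightarrow> f (x ^ n) = f x ^ n"
    by auto
qed

lemma power_int_K: "x \<in> K \<Longrightarrow> x powi n \<in> K" and f_power_int: "x \<in> K \<Longrightarrow> f (x powi n) = f x powi n"
  by (cases n rule: int_cases4; simp add: power_int_minus power_K f_power inverse_K f_inverse)+

lemma prod_K:
  assumes "\<And>i. i \<in> I \<Longrightarrow> g i \<in> K"
  shows "(\<Prod>i\<in>I. g i) \<in> K" and f_prod: "f (\<Prod>i\<in>I. g i) = (\<Prod>i\<in>I. f (g i))"
proof -
  have "(\<Prod>i\<in>I. g i) \<in> K \<and> f (\<Prod>i\<in>I. g i) = (\<Prod>i\<in>I. f (g i))"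
    using assms by (induction I rule: infinite_finite_induct) (auto simp: one_K f_one mult_K f_mult)
  then show "(\<Prod>i\<in>I. g i) \<in> K" "f (\<Prod>i\<in>I. g i) = (\<Prod>i\<in>I. f (g i))"
    by auto
qed

definition seed_in :: "'v seed \<Rightarrow> bool" where
  "seed_in \<Sigma> \<longleftrightarrow> (\<forall>v\<in>vertices \<Sigma>. cluster \<Sigma> v \<in> K)"

lemma product_in:
  assumes "seed_in \<Sigma>"
  shows "in_product \<Sigma> k \<in> K" "out_product \<Sigma> k \<in> K" "exchange_ratio \<Sigma> k \<in> K"
  unfolding exchange_ratio_alt in_product_def out_product_def using assms
  by (auto simp: seed_in_def intro!: divide_K prod_K power_K)

lemma seed_in_mutate:
  assumes "seed_in \<Sigma>"
  shows "seed_in (mutate k \<Sigma>)"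
  using product_in[OF assms, of k] assms
  by (auto simp: seed_in_def cluster_mutate intro!: divide_K add_K)

text \<open>
  The arrows between mutable vertices are tracked explicitly, since equality of the exchange
  ratios determines them only through the algebraic independence of the cluster variables.
\<close>

definition matching :: "ratfun set \<Rightarrow> ('v \<Rightarrow> 'w) \<Rightarrow> 'v seed \<Rightarrow> 'w seed \<Rightarrow> bool" where
  "matching M \<beta> \<Sigma> \<Sigma>' \<longleftrightarrow> bij_betw \<beta> (mutable \<Sigma>) (mutable \<Sigma>') \<and>
    (\<forall>i\<in>mutable \<Sigma>. \<exists>m\<in>M. f (cluster \<Sigma> i) = m * cluster \<Sigma>' (\<beta> i)) \<and>
    (\<forall>i\<in>mutable \<Sigma>. f (exchange_ratio \<Sigma> i) = exchange_ratio \<Sigma>' (\<beta> i)) \<and>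
    (\<forall>i\<in>mutable \<Sigma>. \<forall>j\<in>mutable \<Sigma>. arrows \<Sigma> i j = arrows \<Sigma>' (\<beta> i) (\<beta> j)) \<and>
    (\<forall>v\<in>frozen \<Sigma>. f (cluster \<Sigma> v) \<in> M) \<and> (\<forall>v\<in>frozen \<Sigma>'. cluster \<Sigma>' v \<in> M)"

lemma matching_in_product:
  assumes M: "1 \<in> M" "\<And>x y. x \<in> M \<Longrightarrow> y \<in> M \<Longrightarrow> x * y \<in> M" "\<And>x. x \<in> M \<Longrightarrow> inverse x \<in> M" "0 \<notin> M"
    and match: "matching M \<beta> \<Sigma> \<Sigma>'" and \<Sigma>: "seed_in \<Sigma>" "seed_ok \<Sigma>" "seed_ok \<Sigma>'" and k: "k \<in> mutable \<Sigma>"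
  shows "\<exists>m\<in>M. f (in_product \<Sigma> k) = m * in_product \<Sigma>' (\<beta> k)"
proof -
  have fin: "finite (vertices \<Sigma>)" "finite (vertices \<Sigma>')" "frozen \<Sigma> \<subseteq> vertices \<Sigma>" "frozen \<Sigma>' \<subseteq> vertices \<Sigma>'"
    using \<Sigma> by (auto simp: seed_ok_def)
  have pow: "x ^ n \<in> M" if "x \<in> M" for x n
    using M that by (induction n) auto
  have prod: "(\<Prod>v\<in>I. g v ^ e v) \<in> M" if "\<And>v. v \<in> I \<Longrightarrow> g v \<in> M" for I :: "'u set" and g e
    using that M by (induction I rule: infinite_finite_induct) (auto simp: pow)
  have bij: "bij_betw \<beta> (mutable \<Sigma>) (mutable \<Sigma>')"
    using match by (simp add: matching_def)
  obtain c where c: "\<And>i. i \<in> mutable \<Sigma> \<Longrightarrow> c i \<in> M"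
    "\<And>i. i \<in> mutable \<Sigma> \<Longrightarrow> f (cluster \<Sigma> i) = c i * cluster \<Sigma>' (\<beta> i)"
    using match unfolding matching_def by metis
  define a where "a i = arrows \<Sigma> i k" for i
  define m1 where "m1 = (\<Prod>i\<in>mutable \<Sigma>. c i ^ a i)"
  define m2 where "m2 = (\<Prod>i\<in>frozen \<Sigma>. f (cluster \<Sigma> i) ^ a i)"
  define m3 where "m3 = (\<Prod>i\<in>frozen \<Sigma>'. cluster \<Sigma>' i ^ arrows \<Sigma>' i (\<beta> k))"
  have m: "m1 \<in> M" "m2 \<in> M" "m3 \<in> M"
    using match by (auto simp: m1_def m2_def m3_def matching_def intro!: prod c(1))
  have "f (in_product \<Sigma> k) = (\<Prod>i\<in>vertices \<Sigma>. f (cluster \<Sigma> i) ^ a i)"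
    using \<Sigma>(1) by (simp add: in_product_def f_prod power_K f_power seed_in_def a_def)
  also have "\<dots> = (\<Prod>i\<in>mutable \<Sigma>. f (cluster \<Sigma> i) ^ a i) * m2"
    unfolding m2_def mutable_def by (rule prod.subset_diff[OF fin(3,1)])
  also have "(\<Prod>i\<in>mutable \<Sigma>. f (cluster \<Sigma> i) ^ a i) =
      m1 * (\<Prod>i\<in>mutable \<Sigma>. cluster \<Sigma>' (\<beta> i) ^ arrows \<Sigma>' (\<beta> i) (\<beta> k))"
    using match k by (simp add: m1_def c(2) power_mult_distrib prod.distrib a_def matching_def)
  also have "(\<Prod>i\<in>mutable \<Sigma>. cluster \<Sigma>' (\<beta> i) ^ arrows \<Sigma>' (\<beta> i) (\<beta> k)) =
      (\<Prod>i\<in>mutable \<Sigma>'. cluster \<Sigma>' i ^ arrows \<Sigma>' i (\<beta> k))"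
    by (rule prod.reindex_bij_betw[OF bij])
  finally have 1: "f (in_product \<Sigma> k) = m1 * m2 * (\<Prod>i\<in>mutable \<Sigma>'. cluster \<Sigma>' i ^ arrows \<Sigma>' i (\<beta> k))"
    by simp
  have 2: "in_product \<Sigma>' (\<beta> k) = (\<Prod>i\<in>mutable \<Sigma>'. cluster \<Sigma>' i ^ arrows \<Sigma>' i (\<beta> k)) * m3"
    unfolding in_product_def m3_def mutable_def by (rule prod.subset_diff[OF fin(4,2)])
  have "m3 \<noteq> 0"
    using m M(4) by auto
  then have "f (in_product \<Sigma> k) = (m1 * m2 * inverse m3) * in_product \<Sigma>' (\<beta> k)"
    unfolding 1 2 by simp
  then show ?thesis
    using M(2)[OF M(2)[OF m(1,2)] M(3)[OF m(3)]] by (rule bexI)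
qed

text \<open>The exchange relation is used in the form
  \<open>in_product * (1 + exchange_ratio) / x_k\<close>: the ratio is matched exactly, so only the
  in-product and \<open>x_k\<close> contribute elements of \<open>M\<close>.\<close>

lemma matching_mutate:
  assumes M: "1 \<in> M" "\<And>x y. x \<in> M \<Longrightarrow> y \<in> M \<Longrightarrow> x * y \<in> M" "\<And>x. x \<in> M \<Longrightarrow> inverse x \<in> M" "0 \<notin> M"
    and match: "matching M \<beta> \<Sigma> \<Sigma>'" and \<Sigma>: "seed_in \<Sigma>" "seed_ok \<Sigma>" "seed_ok \<Sigma>'"
    and pos: "positive_cone S" "seed_positive S \<Sigma>" "positive_cone S'" "seed_positive S' \<Sigma>'"
    and k: "k \<in> mutable \<Sigma>"
  shows "matching M \<beta> (mutate k \<Sigma>) (mutate (\<beta> k) \<Sigma>')"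
proof -
  have bij: "bij_betw \<beta> (mutable \<Sigma>) (mutable \<Sigma>')"
    using match by (simp add: matching_def)
  have inj: "\<beta> i = \<beta> j \<longleftrightarrow> i = j" if "i \<in> mutable \<Sigma>" "j \<in> mutable \<Sigma>" for i j
    using bij that by (auto simp: bij_betw_def inj_on_def)
  have k': "\<beta> k \<in> mutable \<Sigma>'" "k \<in> vertices \<Sigma>" "\<beta> k \<in> vertices \<Sigma>'" "k \<notin> frozen \<Sigma>" "\<beta> k \<notin> frozen \<Sigma>'"
    using k bij by (auto simp: bij_betw_def mutable_def)
  have arr: "arrows \<Sigma> i j = arrows \<Sigma>' (\<beta> i) (\<beta> j)" if "i \<in> mutable \<Sigma>" "j \<in> mutable \<Sigma>" for i j
    using match that by (simp add: matching_def)
  have ratio: "f (exchange_ratio \<Sigma> i) = exchange_ratio \<Sigma>' (\<beta> i)" if "i \<in> mutable \<Sigma>" for i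
    using match that by (simp add: matching_def)
  \<comment> \<open>The in-product is nonzero by positivity and can be factored out.\<close>
  have new: "(in_product \<Sigma> k + out_product \<Sigma> k) / cluster \<Sigma> k =
      in_product \<Sigma> k * (1 + exchange_ratio \<Sigma> k) / cluster \<Sigma> k"
    if "positive_cone S" "seed_positive S \<Sigma>" for S :: "ratfun set" and \<Sigma> :: "'u seed" and k
  proof -
    have "in_product \<Sigma> k \<noteq> 0"
      using product_positive(1)[OF that] that(1) unfolding positive_cone_def by metis
    then show ?thesis
      by (simp add: exchange_ratio_alt distrib_left)
  qed
  have "\<exists>m\<in>M. f (cluster (mutate k \<Sigma>) i) = m * cluster (mutate (\<beta> k) \<Sigma>') (\<beta> i)" if i: "i \<in> mutable \<Sigma>" for i
  proof (cases "i = k")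
    case True
    obtain m where m: "m \<in> M" "f (in_product \<Sigma> k) = m * in_product \<Sigma>' (\<beta> k)"
      using matching_in_product[OF M match \<Sigma> k] by blast
    obtain c where c: "c \<in> M" "f (cluster \<Sigma> k) = c * cluster \<Sigma>' (\<beta> k)"
      using match k unfolding matching_def by blast
    have "f (cluster (mutate k \<Sigma>) k) =
        f (in_product \<Sigma> k) * (1 + f (exchange_ratio \<Sigma> k)) / f (cluster \<Sigma> k)"
      using product_in[OF \<Sigma>(1), of k] \<Sigma>(1) k'
      by (simp add: cluster_mutate new[OF pos(1,2)] f_divide f_mult f_add f_one mult_K add_K one_K seed_in_def)
    also have "\<dots> = m * inverse c * (in_product \<Sigma>' (\<beta> k) * (1 + exchange_ratio \<Sigma>' (\<beta> k)) / cluster \<Sigma>' (\<beta> k))"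
      using ratio[OF k] m c by (simp add: divide_inverse)
    finally show ?thesis
      using M(2)[OF m(1) M(3)[OF c(1)]] True by (auto simp: cluster_mutate new[OF pos(3,4)])
  next
    case False
    then show ?thesis
      using match i inj[OF i k] by (simp add: matching_def cluster_mutate)
  qed
  moreover have "f (exchange_ratio (mutate k \<Sigma>) i) = exchange_ratio (mutate (\<beta> k) \<Sigma>') (\<beta> i)"
    if i: "i \<in> mutable \<Sigma>" for i
  proof (cases "i = k")
    case True
    then show ?thesis
      using exchange_ratio_mutate_self[OF pos(1,2) \<Sigma>(2)] exchange_ratio_mutate_self[OF pos(3,4) \<Sigma>(3)]
        ratio[OF k] product_in[OF \<Sigma>(1), of k]
      by (simp add: f_inverse)
  next
    case False
    then have "\<beta> i \<noteq> \<beta> k"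
      using inj[OF i k] by simp
    with False show ?thesis
      using exchange_ratio_mutate[OF pos(1,2) \<Sigma>(2) k'(2) False]
        exchange_ratio_mutate[OF pos(3,4) \<Sigma>(3) k'(3)] ratio[OF k] ratio[OF i] arr[OF i k] arr[OF k i]
        product_in(3)[OF \<Sigma>(1)]
      by (simp add: f_mult f_power f_power_int f_add f_one mult_K power_K power_int_K add_K one_K)
  qed
  moreover have "quiver_mutation k (arrows \<Sigma>) i j = quiver_mutation (\<beta> k) (arrows \<Sigma>') (\<beta> i) (\<beta> j)"
    if "i \<in> mutable \<Sigma>" "j \<in> mutable \<Sigma>" for i j
    using that k by (simp add: quiver_mutation_def inj arr)
  moreover have "f (cluster (mutate k \<Sigma>) v) \<in> M" if "v \<in> frozen \<Sigma>" for v
    using that match k' by (auto simp: matching_def cluster_mutate)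
  moreover have "cluster (mutate (\<beta> k) \<Sigma>') v \<in> M" if "v \<in> frozen \<Sigma>'" for v
    using that match k' by (auto simp: matching_def cluster_mutate)
  ultimately show ?thesis
    using bij by (simp add: matching_def)
qed

lemma quasi_cluster_homI:
  fixes \<Sigma>\<^sub>0 :: "'v seed" and \<Sigma>\<^sub>1 :: "'w seed"
  assumes \<Sigma>: "seed_in \<Sigma>\<^sub>0" "seed_ok \<Sigma>\<^sub>0" "seed_ok \<Sigma>\<^sub>1"
    and pos: "positive_cone S" "seed_positive S \<Sigma>\<^sub>0" "positive_cone S'" "seed_positive S' \<Sigma>\<^sub>1"
    and match: "matching (frozen_monomials \<Sigma>\<^sub>1) \<beta> \<Sigma>\<^sub>0 \<Sigma>\<^sub>1"
  shows "quasi_cluster_hom f \<Sigma>\<^sub>0 \<Sigma>\<^sub>1"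
proof -
  let ?M = "frozen_monomials \<Sigma>\<^sub>1"
  have fin: "finite (frozen \<Sigma>\<^sub>0)" "finite (frozen \<Sigma>\<^sub>1)"
    using \<Sigma> finite_subset by (auto simp: seed_ok_def)
  have "cluster \<Sigma>\<^sub>1 v \<noteq> 0" if "v \<in> frozen \<Sigma>\<^sub>1" for v
    using that \<Sigma>(3) seed_positive_nonzero[OF pos(3,4)] by (auto simp: seed_ok_def)
  note M = frozen_monomials_props[OF fin(2) this]
  have M': "1 \<in> ?M" "\<And>x y. x \<in> ?M \<Longrightarrow> y \<in> ?M \<Longrightarrow> x * y \<in> ?M" "\<And>x. x \<in> ?M \<Longrightarrow> inverse x \<in> ?M" "0 \<notin> ?M"
    using M by blast+
  \<comment> \<open>One bijection serves all seeds. Positivity and the absence of loops travel along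
    because the mutation formulas for exchange ratios rely on them.\<close>
  have main: "\<exists>\<Sigma>'\<in>mutation_class \<Sigma>\<^sub>1. matching ?M \<beta> \<Sigma> \<Sigma>' \<and> seed_in \<Sigma> \<and> seed_ok \<Sigma> \<and> seed_ok \<Sigma>' \<and>
      seed_positive S \<Sigma> \<and> seed_positive S' \<Sigma>'" if "\<Sigma> \<in> mutation_class \<Sigma>\<^sub>0" for \<Sigma>
    using that
  proof induction
    case initial
    then show ?case
      using \<Sigma> pos match mutation_class.initial by blast
  next
    case (step \<Sigma> k)
    then obtain \<Sigma>' where \<Sigma>': "\<Sigma>' \<in> mutation_class \<Sigma>\<^sub>1" "matching ?M \<beta> \<Sigma> \<Sigma>'" "seed_in \<Sigma>" "seed_ok \<Sigma>"
      "seed_ok \<Sigma>'" "seed_positive S \<Sigma>" "seed_positive S' \<Sigma>'"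
      by blast
    have "\<beta> k \<in> mutable \<Sigma>'"
      using \<Sigma>'(2) step(2) by (auto simp: matching_def bij_betw_def)
    then have "mutate (\<beta> k) \<Sigma>' \<in> mutation_class \<Sigma>\<^sub>1"
      using \<Sigma>'(1) by (rule mutation_class.step[rotated])
    moreover have "matching ?M \<beta> (mutate k \<Sigma>) (mutate (\<beta> k) \<Sigma>')"
      by (rule matching_mutate[OF M' \<Sigma>'(2-5) pos(1) \<Sigma>'(6) pos(3) \<Sigma>'(7) step(2)])
    ultimately show ?case
      using \<Sigma>'(3-7) pos(1,3)
      by (intro bexI[of _ "mutate (\<beta> k) \<Sigma>'"])
        (simp_all add: seed_in_mutate seed_ok_mutate seed_positive_mutate)
  qed
  have prod_M: "(\<Prod>v\<in>I. g v) \<in> ?M" if "\<And>v. v \<in> I \<Longrightarrow> g v \<in> ?M" for I :: "'v set" and g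
    using that M(1,2) by (induction I rule: infinite_finite_induct) auto
  have pow_M: "x ^ n \<in> ?M" if "x \<in> ?M" for x n
    using that M(1,2) by (induction n) auto
  have powi_M: "x powi n \<in> ?M" if "x \<in> ?M" for x n
    using that M(3) pow_M by (cases n rule: int_cases4) (auto simp: power_int_minus)
  \<comment> \<open>Images of cluster variables carry a frozen monomial as a factor, which has to
    lie in the target algebra; frozen variables and their inverses are generators of it.\<close>
  have M_CA: "x \<in> cluster_algebra \<Sigma>\<^sub>1" if "x \<in> ?M" for x
  proof -
    let ?A = "cluster_algebra \<Sigma>\<^sub>1"
    have gen: "cluster \<Sigma>\<^sub>1 v \<in> ?A" "inverse (cluster \<Sigma>\<^sub>1 v) \<in> ?A" if "v \<in> frozen \<Sigma>\<^sub>1" for v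
      using that unfolding cluster_algebra_def by (auto intro!: algebra_generated.gen)
    have one: "1 \<in> ?A"
      using algebra_generated.const[of 1] unfolding cluster_algebra_def by (simp add: const_def One_fract_def)
    have mult: "x * y \<in> ?A" if "x \<in> ?A" "y \<in> ?A" for x y
      using that unfolding cluster_algebra_def by (rule algebra_generated.mult)
    have pow: "x ^ n \<in> ?A" if "x \<in> ?A" for x n
      using that one mult by (induction n) auto
    have "cluster \<Sigma>\<^sub>1 v powi e \<in> ?A" if "v \<in> frozen \<Sigma>\<^sub>1" for v e
      using gen[OF that] by (cases e rule: int_cases4) (auto simp: power_int_minus pow simp flip: power_inverse)
    then have "(\<Prod>v\<in>I. cluster \<Sigma>\<^sub>1 v powi e v) \<in> ?A" if "I \<subseteq> frozen \<Sigma>\<^sub>1" for I e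
      using that one mult by (induction I rule: infinite_finite_induct) auto
    then show ?thesis
      using that unfolding frozen_monomials_def by blast
  qed
  have f_frozen: "f (cluster \<Sigma>\<^sub>0 v) \<in> ?M" "cluster \<Sigma>\<^sub>0 v \<in> K" if "v \<in> frozen \<Sigma>\<^sub>0" for v
    using that match \<Sigma>(1,2) by (auto simp: matching_def seed_in_def seed_ok_def)
  have CA: "x \<in> K \<and> f x \<in> cluster_algebra \<Sigma>\<^sub>1" if "x \<in> cluster_algebra \<Sigma>\<^sub>0" for x
    using that unfolding cluster_algebra_def[of \<Sigma>\<^sub>0]
  proof induction
    case (const c)
    then show ?case
      using const_K f_const algebra_generated.const unfolding cluster_algebra_def by metis
  next
    case (gen x)
    then consider (var) "x \<in> cluster_variables \<Sigma>\<^sub>0" | (frozen) v where "v \<in> frozen \<Sigma>\<^sub>0" "x = cluster \<Sigma>\<^sub>0 v"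
      | (inverse) v where "v \<in> frozen \<Sigma>\<^sub>0" "x = inverse (cluster \<Sigma>\<^sub>0 v)"
      by blast
    then show ?case
    proof cases
      case var
      then obtain \<Sigma> i where i: "\<Sigma> \<in> mutation_class \<Sigma>\<^sub>0" "i \<in> mutable \<Sigma>" "x = cluster \<Sigma> i"
        unfolding cluster_variables_def by blast
      obtain \<Sigma>' where \<Sigma>': "\<Sigma>' \<in> mutation_class \<Sigma>\<^sub>1" "matching ?M \<beta> \<Sigma> \<Sigma>'" "seed_in \<Sigma>"
        using main[OF i(1)] by blast
      obtain m where m: "m \<in> ?M" "f x = m * cluster \<Sigma>' (\<beta> i)"
        using \<Sigma>'(2) i by (auto simp: matching_def)
      have "\<beta> i \<in> mutable \<Sigma>'"
        using \<Sigma>'(2) i by (auto simp: matching_def bij_betw_def)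
      then have "cluster \<Sigma>' (\<beta> i) \<in> cluster_algebra \<Sigma>\<^sub>1"
        unfolding cluster_algebra_def cluster_variables_def using \<Sigma>'(1)
        by (intro algebra_generated.gen) blast
      then have "f x \<in> cluster_algebra \<Sigma>\<^sub>1"
        using M_CA[OF m(1)] unfolding m(2) cluster_algebra_def by (intro algebra_generated.mult)
      moreover have "x \<in> K"
        using \<Sigma>'(3) i by (auto simp: seed_in_def mutable_def)
      ultimately show ?thesis
        by simp
    next
      case frozen
      then show ?thesis
        using f_frozen M_CA by blast
    next
      case inverse
      then show ?thesis
        using f_frozen M_CA M(3) inverse_K f_inverse by metis
    qed
  next
    case (add x y)
    then show ?case
      using add_K f_add algebra_generated.add unfolding cluster_algebra_def by metis
  next
    case (mult x y)
    then show ?case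
      using mult_K f_mult algebra_generated.mult unfolding cluster_algebra_def by metis
  qed
  then have "algebra_hom f (cluster_algebra \<Sigma>\<^sub>0) (cluster_algebra \<Sigma>\<^sub>1)"
    unfolding algebra_hom_def using f_const f_add f_mult by blast
  moreover have "f ` frozen_monomials \<Sigma>\<^sub>0 \<subseteq> ?M"
    using f_frozen
    by (auto simp: frozen_monomials_def[of \<Sigma>\<^sub>0] f_prod f_power_int power_int_K intro!: prod_M powi_M)
  moreover have "\<exists>\<Sigma>\<in>mutation_class \<Sigma>\<^sub>0. \<exists>\<Sigma>'\<in>mutation_class \<Sigma>\<^sub>1. \<exists>\<beta>.
      bij_betw \<beta> (mutable \<Sigma>) (mutable \<Sigma>') \<and>
      (\<forall>i\<in>mutable \<Sigma>. (\<exists>m\<in>?M. f (cluster \<Sigma> i) = m * cluster \<Sigma>' (\<beta> i)) \<and>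
        f (exchange_ratio \<Sigma> i) = exchange_ratio \<Sigma>' (\<beta> i))"
    using match unfolding matching_def
    by (intro bexI[OF _ mutation_class.initial] exI[of _ \<beta>]) auto
  ultimately show ?thesis
    unfolding quasi_cluster_hom_def by simp
qed

end

section \<open>Mutation of quivers given by lists of arrows\<close>

text \<open>
  A list of arrows describes the part of the quiver that the mutations affect; the net
  numbers \<open>R\<close> of the remaining arrows do not change.
\<close>

definition net_of :: "('v \<times> 'v) list \<Rightarrow> 'v \<Rightarrow> 'v \<Rightarrow> int" where
  "net_of L u v = int (count_list L (u, v)) - int (count_list L (v, u))"

definition sources :: "'v \<Rightarrow> ('v \<times> 'v) list \<Rightarrow> 'v list" where
  "sources k L = map fst (filter (\<lambda>a. snd a = k) L)"

definition targets :: "'v \<Rightarrow> ('v \<times> 'v) list \<Rightarrow> 'v list" where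
  "targets k L = map snd (filter (\<lambda>a. fst a = k) L)"

definition mutate_arrows :: "'v \<Rightarrow> ('v \<times> 'v) list \<Rightarrow> ('v \<times> 'v) list" where
  "mutate_arrows k L =
     map (\<lambda>a. if fst a = k \<or> snd a = k then (snd a, fst a) else a) L @ List.product (sources k L) (targets k L)"

fun cancel :: "('v \<times> 'v) list \<Rightarrow> ('v \<times> 'v) list" where
  "cancel [] = []"
| "cancel ((i, j) # L) = (let L' = cancel L in if (j, i) \<in> set L' then remove1 (j, i) L' else (i, j) # L')"

text \<open>This excludes loops as well as 2-cycles, since a loop is its own reverse.\<close>

definition reduced :: "('v \<times> 'v) list \<Rightarrow> bool" where
  "reduced L \<longleftrightarrow> (\<forall>a\<in>set L. (snd a, fst a) \<notin> set L)"

lemma net_of_antisym: "net_of L u v = - net_of L v u"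
  by (simp add: net_of_def)

lemma int_count_list_remove1:
  "x \<in> set xs \<Longrightarrow> int (count_list (remove1 x xs) y) = int (count_list xs y) - of_bool (x = y)"
proof (induction xs)
  case (Cons a xs)
  then show ?case
    by (cases "x = a"; cases "a = y"; simp)
qed simp

lemma net_of_Cons:
  "net_of ((i, j) # L) u v = net_of L u v + of_bool (u = i \<and> v = j) - of_bool (u = j \<and> v = i)"
proof -
  have "int (count_list ((i, j) # L) (u, v)) = int (count_list L (u, v)) + of_bool (u = i \<and> v = j)" for u v
    by auto
  then show ?thesis
    by (simp only: net_of_def conj_commute)
qed

lemma net_of_remove1:
  assumes "(j, i) \<in> set L"
  shows "net_of (remove1 (j, i) L) u v = net_of L u v + of_bool (u = i \<and> v = j) - of_bool (u = j \<and> v = i)"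
proof -
  have "int (count_list (remove1 (j, i) L) (u, v)) = int (count_list L (u, v)) - of_bool (u = j \<and> v = i)" for u v
    unfolding int_count_list_remove1[OF assms] by auto
  then show ?thesis
    by (simp only: net_of_def conj_commute)
qed

lemma net_of_cancel: "net_of (cancel L) = net_of L"
proof (intro ext)
  show "net_of (cancel L) u v = net_of L u v" for u v
  proof (induction L rule: cancel.induct)
    case (2 i j L)
    have IH: "net_of (cancel L) u v = net_of L u v"
      using 2 by blast
    show ?case
    proof (cases "(j, i) \<in> set (cancel L)")
      case True
      then have "cancel ((i, j) # L) = remove1 (j, i) (cancel L)"
        by (simp add: Let_def)
      then show ?thesis
        by (simp only: net_of_remove1[OF True] net_of_Cons IH)
    next
      case False
      then have "cancel ((i, j) # L) = (i, j) # cancel L"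
        by (simp add: Let_def)
      then show ?thesis
        by (simp only: net_of_Cons IH)
    qed
  qed simp
qed

lemma count_list_sources: "count_list (sources k L) i = count_list L (i, k)"
  unfolding sources_def by (induction L) auto

lemma count_list_targets: "count_list (targets k L) j = count_list L (k, j)"
  unfolding targets_def by (induction L) auto

lemma count_list_product: "count_list (List.product xs ys) (i, j) = count_list xs i * count_list ys j"
proof (induction xs)
  case (Cons x xs)
  have "count_list (map (Pair x) ys) (i, j) = (if x = i then count_list ys j else 0)"
    by (induction ys) auto
  with Cons show ?case
    by simp
qed simp

lemma reduced_count:
  assumes "reduced L"
  shows "count_list L (i, j) = 0 \<or> count_list L (j, i) = 0" "count_list L (i, i) = 0"
proof -
  have "(i, j) \<notin> set L \<or> (j, i) \<notin> set L" for i j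
    using assms unfolding reduced_def by (metis fst_conv snd_conv)
  from this[of i j] this[of i i] show "count_list L (i, j) = 0 \<or> count_list L (j, i) = 0" "count_list L (i, i) = 0"
    by (simp_all add: count_list_0_iff)
qed

lemma net_of_mutate_arrows:
  assumes "reduced L"
  shows "net_of (mutate_arrows k L) i j = (if i = k \<or> j = k then - net_of L i j
    else net_of L i j + int (count_list L (i, k) * count_list L (k, j)) - int (count_list L (j, k) * count_list L (k, i)))"
proof -
  let ?f = "\<lambda>a. if fst a = k \<or> snd a = k then (snd a, fst a) else a"
  have f: "?f a = (i, j) \<longleftrightarrow> a = (if i = k \<or> j = k then (j, i) else (i, j))" for a i j
    by (cases a) auto
  have "count_list (map ?f L) (i, j) = count_list L (if i = k \<or> j = k then (j, i) else (i, j))" for i j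
    by (induction L) (simp_all only: list.map count_list.simps f)
  then have "count_list (map ?f L) (i, j) =
      (if i = k \<or> j = k then count_list L (j, i) else count_list L (i, j))" for i j
    by simp
  then have "count_list (mutate_arrows k L) (i, j) = (if i = k \<or> j = k then count_list L (j, i) else count_list L (i, j)) +
      count_list L (i, k) * count_list L (k, j)" for i j
    by (simp add: mutate_arrows_def count_list_append count_list_product count_list_sources count_list_targets)
  note count = this
  \<comment> \<open>Without a loop at \<open>k\<close>, the added paths do not interfere with the
    reversed arrows at \<open>k\<close>.\<close>
  have kk: "count_list L (k, k) = 0"
    by (rule reduced_count(2)[OF assms])
  show ?thesis
  proof (cases "i = k \<or> j = k")
    case True
    then have "count_list (mutate_arrows k L) (i, j) = count_list L (j, i)"
      "count_list (mutate_arrows k L) (j, i) = count_list L (i, j)"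
      unfolding count using kk by auto
    with True show ?thesis
      by (simp only: net_of_def) simp
  next
    case False
    then have "count_list (mutate_arrows k L) (i, j) = count_list L (i, j) + count_list L (i, k) * count_list L (k, j)"
      "count_list (mutate_arrows k L) (j, i) = count_list L (j, i) + count_list L (j, k) * count_list L (k, i)"
      unfolding count by auto
    with False show ?thesis
      by (simp only: net_of_def) simp
  qed
qed

text \<open>The quiver is the positive part of a skew-symmetric matrix. The list and
  \<open>R\<close> may contain opposite arrows; these cancel in the sum.\<close>

definition arrows_given :: "'v seed \<Rightarrow> ('v \<times> 'v) list \<Rightarrow> ('v \<Rightarrow> 'v \<Rightarrow> int) \<Rightarrow> bool" where
  "arrows_given \<Sigma> L R \<longleftrightarrow> reduced L \<and> (\<forall>u v. R u v = - R v u) \<and> (\<forall>u v. arrows \<Sigma> u v = nat (net_of L u v + R u v))"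

text \<open>At \<open>k\<close> the remainder vanishes, and a reduced list has no opposite arrows,
  so truncation at 0 loses nothing.\<close>

lemma arrows_at:
  assumes "arrows_given \<Sigma> L R" "\<And>v. R k v = 0"
  shows "arrows \<Sigma> k i = count_list L (k, i)" "arrows \<Sigma> i k = count_list L (i, k)"
proof -
  have "R i k = - R k i"
    using assms(1) unfolding arrows_given_def by blast
  then have R: "R i k = 0" "R k i = 0"
    using assms(2) by simp_all
  have red: "count_list L (i, k) = 0 \<or> count_list L (k, i) = 0"
    using assms(1) by (intro reduced_count(1)) (simp only: arrows_given_def)
  have arr: "arrows \<Sigma> u v = nat (net_of L u v + R u v)" for u v
    using assms(1) unfolding arrows_given_def by blast
  show "arrows \<Sigma> k i = count_list L (k, i)" "arrows \<Sigma> i k = count_list L (i, k)"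
    unfolding arr R net_of_def using red by auto
qed

text \<open>Since \<open>R\<close> vanishes at \<open>k\<close>, every path through \<open>k\<close>
  uses arrows of the list only. Hence the list mutates on its own and \<open>R\<close> is added
  unchanged.\<close>

lemma arrows_given_mutate:
  assumes L: "arrows_given \<Sigma> L R" "\<And>v. R k v = 0" and L': "L' = cancel (mutate_arrows k L)" "reduced L'"
  shows "arrows_given (mutate k \<Sigma>) L' R"
proof -
  have R: "R u v = - R v u" for u v
    using L(1) unfolding arrows_given_def by blast
  have red: "reduced L"
    using L(1) unfolding arrows_given_def by blast
  have int_diff: "a - b = nat (int a - int b)" for a b :: nat
    by linarith
  have arr0: "arrows \<Sigma> u v = nat (net_of L u v + R u v)" for u v
    using L(1) unfolding arrows_given_def by blast
  have arr: "int (arrows \<Sigma> u v) - int (arrows \<Sigma> v u) = net_of L u v + R u v" for u v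
    unfolding arr0 using R[of v u] net_of_antisym[of L v u] by linarith
  have "arrows (mutate k \<Sigma>) u v = nat (net_of L' u v + R u v)" for u v
  proof (cases "u = k \<or> v = k")
    case True
    then have "R u v = 0"
      using L(2)[of v] L(2)[of u] R[of u v] by auto
    moreover have "arrows (mutate k \<Sigma>) u v = nat (int (arrows \<Sigma> v u) - int (arrows \<Sigma> u v))"
      using True by (simp only: mutate_simps quiver_mutation_def Let_def int_diff disj_commute if_True)
    ultimately show ?thesis
      unfolding arr using True R[of v u] net_of_antisym[of L u v]
      by (simp add: L' net_of_cancel net_of_mutate_arrows[OF red])
  next
    case False
    have "arrows (mutate k \<Sigma>) u v =
        nat (int (arrows \<Sigma> u v + arrows \<Sigma> u k * arrows \<Sigma> k v) - int (arrows \<Sigma> v u + arrows \<Sigma> v k * arrows \<Sigma> k u))"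
      unfolding mutate_simps quiver_mutation_def Let_def int_diff using False by auto
    also have "\<dots> = nat (net_of L u v + R u v + int (arrows \<Sigma> u k * arrows \<Sigma> k v) - int (arrows \<Sigma> v k * arrows \<Sigma> k u))"
      using arr[of u v] by simp
    also have "\<dots> = nat (net_of L' u v + R u v)"
      using False by (simp add: arrows_at[OF L] L' net_of_cancel net_of_mutate_arrows[OF red] algebra_simps)
    finally show ?thesis .
  qed
  then show ?thesis
    using L'(2) R unfolding arrows_given_def by blast
qed

lemma prod_count_list:
  assumes "finite A" "set xs \<subseteq> A"
  shows "(\<Prod>i\<in>A. x i ^ count_list xs i) = prod_list (map x xs)"
  using assms(2)
proof (induction xs)
  case (Cons a xs)
  have "(\<Prod>i\<in>A. x i ^ count_list (a # xs) i) = (\<Prod>i\<in>A. (if i = a then x i else 1) * x i ^ count_list xs i)"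
    by (intro prod.cong) auto
  also have "\<dots> = x a * (\<Prod>i\<in>A. x i ^ count_list xs i)"
    using Cons.prems assms(1) by (simp add: prod.distrib prod.delta)
  finally show ?case
    using Cons by simp
qed simp

lemma cluster_mutate_arrows:
  assumes L: "arrows_given \<Sigma> L R" "\<And>v. R k v = 0" and V: "finite (vertices \<Sigma>)"
    "set (sources k L) \<subseteq> vertices \<Sigma>" "set (targets k L) \<subseteq> vertices \<Sigma>"
  shows "cluster (mutate k \<Sigma>) = (cluster \<Sigma>)(k :=
    (prod_list (map (cluster \<Sigma>) (sources k L)) + prod_list (map (cluster \<Sigma>) (targets k L))) / cluster \<Sigma> k)"
  using prod_count_list[OF V(1,2), of "cluster \<Sigma>"] prod_count_list[OF V(1,3), of "cluster \<Sigma>"]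
  by (simp add: cluster_mutate in_product_def out_product_def arrows_at[OF L] count_list_sources count_list_targets)

section \<open>The spurion seed\<close>

text \<open>The bound 9 is chosen because the mutated vertices lie in columns 5 to 8. The list
  reaches into column 9, but arrows with both ends in columns from 9 on are left to the
  remainder.\<close>

definition initial_arrows :: "(vertex \<times> vertex) list" where
  "initial_arrows = (V\<^sub>0, V 1 5) #
     concat (map (\<lambda>r. concat (map (\<lambda>c. [(V r c, V r (c + 1)), (V r c, V (r + 1) c), (V (r + 1) (c + 1), V r c)])
       [5..<9])) [1..<4])"

definition spurion_mutations :: "vertex list" where
  "spurion_mutations =
     [V 3 8, V 3 7, V 2 7, V 2 6, V 2 5, V 3 6, V 3 5, V 3 8, V 2 8, V 1 8, V 1 5]"

definition spurion_quiver :: "nat \<Rightarrow> (vertex \<times> vertex) list" where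
  "spurion_quiver t = fold (\<lambda>k L. cancel (mutate_arrows k L)) (take t spurion_mutations) initial_arrows"

definition spurion_step :: "nat \<Rightarrow> nat \<Rightarrow> vertex seed" where
  "spurion_step n t = fold mutate (take t spurion_mutations) (rectangles_seed {1..n})"

text \<open>Gathers in one evaluation what the exchange relations require at each step: the
  neighbours of the vertex about to be mutated, and the reducedness of the current list.\<close>

fun quiver_trace :: "'v list \<Rightarrow> ('v \<times> 'v) list \<Rightarrow> (bool \<times> 'v list \<times> 'v list) list" where
  "quiver_trace [] L = []"
| "quiver_trace (k # ks) L =
     (reduced L, sources k L, targets k L) # quiver_trace ks (cancel (mutate_arrows k L))"

lemma quiver_trace_nth:
  "t < length ks \<Longrightarrow> quiver_trace ks L ! t =
    (let L' = fold (\<lambda>k L. cancel (mutate_arrows k L)) (take t ks) L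
     in (reduced L', sources (ks ! t) L', targets (ks ! t) L'))"
proof (induction ks arbitrary: t L)
  case (Cons k ks)
  then show ?case
    by (cases t) (simp_all add: Let_def)
qed simp

text \<open>Each entry lists the factors of the two monomials in one exchange relation, for example
  \<open><1278> <1567> <6789>\<close> and \<open><1267> <1789> <5678>\<close> at the start.\<close>

definition spurion_trace :: "(bool \<times> vertex list \<times> vertex list) list" where
  "spurion_trace =
    [(True, [V 2 8, V 3 7, V 4 9], [V 2 7, V 3 9, V 4 8]),
     (True, [V 3 6, V 3 8], [V 2 6, V 4 7, V 3 9]),
     (True, [V 1 7, V 2 6, V 4 9], [V 1 6, V 3 8]),
     (True, [V 2 5, V 2 7], [V 1 5, V 3 7]),
     (True, [V 2 6, V 3 6], [V 3 5, V 3 7]),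
     (True, [V 2 5], [V 4 6, V 3 9]),
     (True, [V 4 6, V 2 6], [V 2 5, V 4 5]),
     (True, [V 3 7, V 4 8, V 1 7], [V 2 7, V 2 8, V 4 7]),
     (True, [V 1 8, V 3 7], [V 2 9, V 3 8]),
     (True, [V 1 7, V 2 8], [V 1 9, V 3 8]),
     (True, [V\<^sub>0, V 2 7], [V 1 6, V 2 6])]"

lemma spurion_quiver_trace: "quiver_trace spurion_mutations initial_arrows = spurion_trace"
  by code_simp

lemma spurion_quiver_0: "spurion_quiver 0 = initial_arrows"
  by (simp add: spurion_quiver_def)

text \<open>The list contains \<open>(V 4 9, V 3 9)\<close>, opposite to an arrow of the rectangles
  quiver that belongs to the remainder when \<open>n\<close> exceeds 9; the two cancel only after
  the parts are added.\<close>

lemma spurion_quiver_11: "spurion_quiver 11 = 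
    [(V 1 5, V\<^sub>0), (V 1 6, V 1 5), (V 2 6, V 1 5), (V 1 8, V 1 7), (V 1 9, V 1 8), (V 1 8,
    V 2 8), (V 2 5, V 3 5), (V 3 6, V 2 5), (V 2 7, V 3 8), (V 2 9, V 2 8), (V 4 5, V 3 5), (V 3
    5, V 4 6), (V 4 6, V 3 6), (V 3 8, V 4 8), (V 3 9, V 3 7), (V 2 7, V 4 9), (V 4 9, V 3 9),
    (V 4 9, V 4 8), (V 3 9, V 3 6), (V 4 7, V 3 8), (V 4 9, V 1 6), (V 3 7, V 2 5), (V 1 5, V 2
    7), (V 3 5, V 2 6), (V 2 5, V 3 9), (V 4 6, V 4 5), (V 2 6, V 4 5), (V 2 8, V 3 7), (V 4 8,
    V 2 7), (V 4 8, V 4 7), (V 1 7, V 4 7), (V 3 8, V 1 8), (V 3 7, V 2 9), (V 1 7, V 1 9), (V 2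
    8, V 1 9), (V\<^sub>0, V 1 6), (V\<^sub>0, V 2 6)]"
  by code_simp

lemma reduced_spurion_quiver_11: "reduced (spurion_quiver 11)"
  unfolding spurion_quiver_11 by code_simp

lemma spurion_quiver_nth:
  assumes "t < 11"
  shows "(reduced (spurion_quiver t), sources (spurion_mutations ! t) (spurion_quiver t),
    targets (spurion_mutations ! t) (spurion_quiver t)) = spurion_trace ! t"
proof -
  have "t < length spurion_mutations"
    using assms by (simp add: spurion_mutations_def)
  from quiver_trace_nth[OF this, of initial_arrows] show ?thesis
    by (simp only: spurion_quiver_trace spurion_quiver_def Let_def)
qed

lemma spurion_step_0: "spurion_step n 0 = rectangles_seed {1..n}"
  by (simp add: spurion_step_def)

lemma spurion_step_Suc:
  assumes "t < 11"
  shows "spurion_step n (Suc t) = mutate (spurion_mutations ! t) (spurion_step n t)"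
    "spurion_quiver (Suc t) = cancel (mutate_arrows (spurion_mutations ! t) (spurion_quiver t))"
proof -
  have "t < length spurion_mutations"
    using assms by (simp add: spurion_mutations_def)
  then show "spurion_step n (Suc t) = mutate (spurion_mutations ! t) (spurion_step n t)"
    "spurion_quiver (Suc t) = cancel (mutate_arrows (spurion_mutations ! t) (spurion_quiver t))"
    by (simp_all add: spurion_step_def spurion_quiver_def take_Suc_conv_app_nth)
qed

section \<open>The rectangles quiver, near the mutations and far from them\<close>

definition far :: "vertex \<Rightarrow> bool" where
  "far w = (case w of V\<^sub>0 \<Rightarrow> False | V r c \<Rightarrow> 9 \<le> c)"

definition far_net :: "nat \<Rightarrow> vertex \<Rightarrow> vertex \<Rightarrow> int" where
  "far_net n u v = (if far u \<and> far v then of_bool (rect_arrow n u v) - of_bool (rect_arrow n v u) else 0)"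

lemma set_initial_arrows:
  "(u, v) \<in> set initial_arrows \<longleftrightarrow> u = V\<^sub>0 \<and> v = V 1 5 \<or>
     (\<exists>r c. 1 \<le> r \<and> r \<le> 3 \<and> 5 \<le> c \<and> c < 9 \<and> (u = V r c \<and> v = V r (c + 1) \<or>
         u = V r c \<and> v = V (r + 1) c \<or> u = V (r + 1) (c + 1) \<and> v = V r c))"
  (is "_ \<longleftrightarrow> _ \<or> (\<exists>r c. 1 \<le> r \<and> r \<le> 3 \<and> 5 \<le> c \<and> c < 9 \<and> ?P r c)")
proof -
  have "{1..<4} = {1..3::nat}"
    by auto
  then have "(\<exists>r\<in>{1..<4}. \<exists>c\<in>{5..<9}. P r c) \<longleftrightarrow> (\<exists>r c. 1 \<le> r \<and> r \<le> 3 \<and> 5 \<le> c \<and> c < 9 \<and> P r c)"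
    for P :: "nat \<Rightarrow> nat \<Rightarrow> bool"
    unfolding Bex_def atLeastLessThan_iff atLeastAtMost_iff by auto
  moreover have "(u, v) \<in> set initial_arrows \<longleftrightarrow> u = V\<^sub>0 \<and> v = V 1 5 \<or> (\<exists>r\<in>{1..<4}. \<exists>c\<in>{5..<9}. ?P r c)"
    unfolding initial_arrows_def by (simp del: upt_rec_numeral)
  ultimately show ?thesis
    by simp
qed

lemma distinct_initial_arrows: "distinct initial_arrows"
  by code_simp

lemma count_list_distinct: "distinct xs \<Longrightarrow> count_list xs x = of_bool (x \<in> set xs)"
  by (induction xs) auto

lemma rect_arrow_acyclic: "rect_arrow n u v \<Longrightarrow> \<not> rect_arrow n v u"
  unfolding rect_arrow_def by auto

lemma rectangles_seed_simps:
  "vertices (rectangles_seed N) = insert V\<^sub>0 {V r c | r c. 1 \<le> r \<and> r \<le> 4 \<and> 5 \<le> c \<and> c \<le> card N}"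
  "frozen (rectangles_seed N) = insert V\<^sub>0 {V r c | r c. 1 \<le> r \<and> r \<le> 4 \<and> 5 \<le> c \<and> c \<le> card N \<and> (r = 4 \<or> c = card N)}"
  "cluster (rectangles_seed N) V\<^sub>0 = plucker (map (\<lambda>i. sorted_list_of_set N ! (i - 1)) [1, 2, 3, 4])"
  "cluster (rectangles_seed N) (V r c) = plucker (map (\<lambda>i. sorted_list_of_set N ! (i - 1)) (rect_indices r c))"
  "arrows (rectangles_seed N) = (\<lambda>u v. of_bool (rect_arrow (card N) u v))"
  by (simp_all add: rectangles_seed_def Let_def of_bool_def)

lemma finite_rectangles: "finite (vertices (rectangles_seed N))"
proof -
  have "vertices (rectangles_seed N) \<subseteq> insert V\<^sub>0 ((\<lambda>(r, c). V r c) ` ({1..4} \<times> {5..card N}))"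
    by (auto simp: rectangles_seed_simps)
  then show ?thesis
    by (rule finite_subset) simp
qed

lemma seed_ok_rectangles: "seed_ok (rectangles_seed N)"
  using finite_rectangles rect_arrow_acyclic
  by (auto simp: seed_ok_def rectangles_seed_simps)

lemma rect_indices_simps:
  "5 \<le> c \<Longrightarrow> rect_indices 1 c = [1, 2, 3, c]"
  "5 \<le> c \<Longrightarrow> rect_indices 2 c = [1, 2, c - 1, c]"
  "5 \<le> c \<Longrightarrow> rect_indices 3 c = [1, c - 2, c - 1, c]"
  "5 \<le> c \<Longrightarrow> rect_indices 4 c = [c - 3, c - 2, c - 1, c]"
proof -
  \<comment> \<open>Counting backwards from the last index yields a list of explicit length although
    \<open>m\<close> is symbolic.\<close>
  have upt: "[5 + m - a..<5 + m + 1] = map (\<lambda>i. 5 + m - i) (rev [0..<Suc a])" if "a \<le> 3" for m a :: nat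
    using that by (intro nth_equalityI) (auto simp: rev_nth nth_append simp del: upt_Suc)
  assume "5 \<le> c"
  then obtain m where c: "c = 5 + m"
    using le_Suc_ex by blast
  show "rect_indices 1 c = [1, 2, 3, c]" "rect_indices 2 c = [1, 2, c - 1, c]"
    "rect_indices 3 c = [1, c - 2, c - 1, c]" "rect_indices 4 c = [c - 3, c - 2, c - 1, c]"
    using upt[of 0 m] upt[of 1 m] upt[of 2 m] upt[of 3 m]
    by (simp_all add: rect_indices_def c upt_rec numeral_eq_Suc)
qed

text \<open>An arrow of the rectangles quiver with parameters \<open>r\<close>, \<open>c\<close> has
  an end in column \<open>c\<close> and none further left, so \<open>c < 9\<close> holds exactly if
  not both ends are far.\<close>

lemma initial_arrows_given:
  assumes "9 \<le> n"
  shows "arrows_given (rectangles_seed {1..n}) initial_arrows (far_net n)"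
proof -
  have far: "\<not> (far u \<and> far v)" if "(u, v) \<in> set initial_arrows" for u v
    using that unfolding set_initial_arrows far_def by auto
  have rect: "rect_arrow n u v" if uv: "(u, v) \<in> set initial_arrows" for u v
  proof (cases "u = V\<^sub>0 \<and> v = V 1 5")
    case False
    then obtain r c where rc: "1 \<le> r" "r \<le> 3" "5 \<le> c" "c < 9" "u = V r c \<and> v = V r (c + 1) \<or>
        u = V r c \<and> v = V (r + 1) c \<or> u = V (r + 1) (c + 1) \<and> v = V r c"
      using uv unfolding set_initial_arrows by blast
    moreover have "c < n"
      using rc(4) assms by simp
    ultimately show ?thesis
      unfolding rect_arrow_def by blast
  qed (simp add: rect_arrow_def)
  have init: "(u, v) \<in> set initial_arrows" if uv: "rect_arrow n u v" "\<not> (far u \<and> far v)" for u v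
  proof (cases "u = V\<^sub>0 \<and> v = V 1 5")
    case False
    then obtain r c where rc: "1 \<le> r" "r \<le> 3" "5 \<le> c" "u = V r c \<and> v = V r (c + 1) \<or>
        u = V r c \<and> v = V (r + 1) c \<or> u = V (r + 1) (c + 1) \<and> v = V r c"
      using uv(1) unfolding rect_arrow_def by blast
    then have "c < 9"
      using uv(2) by (auto simp: far_def)
    with rc show ?thesis
      unfolding set_initial_arrows by blast
  qed (simp add: set_initial_arrows)
  have count: "count_list initial_arrows (u, v) = of_bool ((u, v) \<in> set initial_arrows)" for u v
    by (rule count_list_distinct[OF distinct_initial_arrows])
  have "arrows (rectangles_seed {1..n}) u v = nat (net_of initial_arrows u v + far_net n u v)" for u v
  proof (cases "far u \<and> far v")
    case True
    then have "(u, v) \<notin> set initial_arrows" "(v, u) \<notin> set initial_arrows"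
      using far by blast+
    then show ?thesis
      using True rect_arrow_acyclic[of n u v] by (auto simp: net_of_def count far_net_def rectangles_seed_simps)
  next
    case False
    then have "(u, v) \<in> set initial_arrows \<longleftrightarrow> rect_arrow n u v" "(v, u) \<in> set initial_arrows \<longleftrightarrow> rect_arrow n v u"
      using init rect by blast+
    then show ?thesis
      using False rect_arrow_acyclic[of n u v] by (auto simp: net_of_def count far_net_def rectangles_seed_simps)
  qed
  moreover have "reduced initial_arrows"
    by code_simp
  moreover have "far_net n u v = - far_net n v u" for u v
    by (simp add: far_net_def)
  ultimately show ?thesis
    unfolding arrows_given_def by blast
qed

lemma less_11_cases:
  "t < (11::nat) \<Longrightarrow> t = 0 \<or> t = 1 \<or> t = 2 \<or> t = 3 \<or> t = 4 \<or> t = 5 \<or> t = 6 \<or> t = 7 \<or> t = 8 \<or> t = 9 \<or> t = 10"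
  by (auto simp: eval_nat_numeral less_Suc_eq)

lemma reduced_spurion_quiver:
  assumes "t \<le> 11"
  shows "reduced (spurion_quiver t)"
proof (cases "t = 11")
  case False
  with assms have "t < 11"
    by simp
  from less_11_cases[OF this] show ?thesis
    using spurion_quiver_nth[OF \<open>t < 11\<close>] by (elim disjE) (simp_all add: spurion_trace_def)
qed (simp add: reduced_spurion_quiver_11)

lemma far_net_mutations:
  assumes "t < 11"
  shows "far_net n (spurion_mutations ! t) v = 0"
proof -
  have "spurion_mutations ! t \<in> set spurion_mutations"
    using assms by (intro nth_mem) (simp add: spurion_mutations_def)
  then have "\<not> far (spurion_mutations ! t)"
    by (auto simp: spurion_mutations_def far_def)
  then show ?thesis
    by (simp add: far_net_def)
qed

lemma spurion_step_arrows:
  assumes "9 \<le> n" "t \<le> 11"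
  shows "arrows_given (spurion_step n t) (spurion_quiver t) (far_net n)"
  using assms(2)
proof (induction t)
  case 0
  then show ?case
    using initial_arrows_given[OF assms(1)] by (simp add: spurion_step_0 spurion_quiver_0)
next
  case (Suc t)
  then have t: "t < 11" "arrows_given (spurion_step n t) (spurion_quiver t) (far_net n)"
    by simp_all
  show ?case
    unfolding spurion_step_Suc(1)[OF t(1)]
    by (rule arrows_given_mutate[OF t(2) far_net_mutations[OF t(1)] spurion_step_Suc(2)[OF t(1)]
        reduced_spurion_quiver[OF Suc.prems]])
qed

lemma spurion_step_vertices: "vertices (spurion_step n t) = vertices (rectangles_seed {1..n})"
  "frozen (spurion_step n t) = frozen (rectangles_seed {1..n})"
proof -
  have "vertices (fold mutate ks \<Sigma>) = vertices \<Sigma> \<and> frozen (fold mutate ks \<Sigma>) = frozen \<Sigma>"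
    for ks :: "vertex list" and \<Sigma>
    by (induction ks arbitrary: \<Sigma>) auto
  then show "vertices (spurion_step n t) = vertices (rectangles_seed {1..n})"
    "frozen (spurion_step n t) = frozen (rectangles_seed {1..n})"
    by (simp_all add: spurion_step_def)
qed

lemma spurion_step_cluster:
  assumes "9 \<le> n" "t < 11" "spurion_mutations ! t = k"
    and "spurion_trace ! t = (b, ins, outs)"
  shows "cluster (spurion_step n (Suc t)) = (cluster (spurion_step n t))(k :=
    (prod_list (map (cluster (spurion_step n t)) ins) + prod_list (map (cluster (spurion_step n t)) outs)) /
    cluster (spurion_step n t) k)"
proof -
  have L: "arrows_given (spurion_step n t) (spurion_quiver t) (far_net n)"
    using assms by (intro spurion_step_arrows) auto
  have k: "sources k (spurion_quiver t) = ins" "targets k (spurion_quiver t) = outs"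
    using spurion_quiver_nth[OF assms(2)] unfolding assms(3,4) by simp_all
  have "set ins \<union> set outs \<subseteq> vertices (spurion_step n t)"
    using less_11_cases[OF assms(2)] assms(1,4) unfolding spurion_trace_def spurion_step_vertices rectangles_seed_simps
    by (elim disjE) auto
  then show ?thesis
    using cluster_mutate_arrows[OF L, of k] far_net_mutations[OF assms(2)] finite_rectangles
    by (simp add: spurion_step_Suc(1)[OF assms(2)] assms(3) k spurion_step_vertices)
qed

text \<open>The label serves as the node, so increasing indices give positive minors: a totally
  positive point.\<close>

definition vandermonde_column :: "nat \<Rightarrow> ratfun vec" where
  "vandermonde_column j = vec 4 (\<lambda>i. const (of_nat j ^ i))"

text \<open>Membership includes being defined at the point. A positive value then keeps the inverse
  defined there too, which makes the set closed under division.\<close>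

definition vandermonde_positive :: "ratfun set" where
  "vandermonde_positive = {x \<in> subst_dom vandermonde_column.
     \<exists>r>0. column_subst vandermonde_column x = const (of_real r)}"

lemma positive_cone_vandermonde: "positive_cone vandermonde_positive"
proof -
  have neq0: "const (of_real r) \<noteq> 0" if "r > 0" for r :: real
    using that const_eq_iff[of "of_real r" 0] by (simp del: const_eq_iff)
  have "x + y \<in> vandermonde_positive" "x * y \<in> vandermonde_positive"
    if xy: "x \<in> vandermonde_positive" "y \<in> vandermonde_positive" for x y
  proof -
    obtain r s where "r > 0" "s > 0" "column_subst vandermonde_column x = const (of_real r)"
      "column_subst vandermonde_column y = const (of_real s)"
      "x \<in> subst_dom vandermonde_column" "y \<in> subst_dom vandermonde_column"
      using xy unfolding vandermonde_positive_def by blast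
    then show "x + y \<in> vandermonde_positive" "x * y \<in> vandermonde_positive"
      unfolding vandermonde_positive_def
      by (auto simp: subst_add subst_mult simp flip: const_add const_mult of_real_add of_real_mult
          intro!: exI[of _ "r + s"] exI[of _ "r * s"])
  qed
  moreover have "inverse x \<in> vandermonde_positive" if x: "x \<in> vandermonde_positive" for x
  proof -
    obtain r where r: "r > 0" "column_subst vandermonde_column x = const (of_real r)" "x \<in> subst_dom vandermonde_column"
      using x by (auto simp: vandermonde_positive_def)
    then show ?thesis
      using neq0[OF r(1)] unfolding vandermonde_positive_def
      by (auto simp: subst_inverse simp flip: const_inverse of_real_inverse intro!: exI[of _ "inverse r"])
  qed
  moreover have "0 \<notin> vandermonde_positive"
    using neq0 by (auto simp: vandermonde_positive_def)
  moreover have "1 \<in> vandermonde_positive"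
    by (auto simp: vandermonde_positive_def intro!: exI[of _ "1 :: real"])
  ultimately show ?thesis
    unfolding positive_cone_def by blast
qed

lemma subst_plucker:
  "plucker [a, b, c, d] \<in> subst_dom t"
  "column_subst t (plucker [a, b, c, d]) = bracket (t a) (t b) (t c) (t d)"
proof -
  let ?A = "mat_of_cols 4 (map zcol [a, b, c, d])"
  have A: "?A \<in> carrier_mat 4 4"
    by (simp add: mat_of_cols_def numeral_eq_Suc)
  have entry: "?A $$ (i, j) = var i ([a, b, c, d] ! j)" if "i < 4" "j < 4" for i j
    using that nth_map[of j "[a, b, c, d]" zcol] by (simp add: mat_of_cols_def del: list.map) (simp add: zcol_def)
  have dom: "?A $$ (i, j) \<in> subst_dom t" if "i < 4" "j < 4" for i j
    unfolding entry[OF that] by (rule subst_var)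
  have "map_mat (column_subst t) ?A = mat_of_cols 4 [t a, t b, t c, t d]"
  proof (rule eq_matI)
    fix i j assume "i < dim_row (mat_of_cols 4 [t a, t b, t c, t d])" "j < dim_col (mat_of_cols 4 [t a, t b, t c, t d])"
    then have ij: "i < 4" "j < 4"
      by simp_all
    have "[t a, t b, t c, t d] ! j = t ([a, b, c, d] ! j)"
      using nth_map[of j "[a, b, c, d]" t] ij by simp
    then show "map_mat (column_subst t) ?A $$ (i, j) = mat_of_cols 4 [t a, t b, t c, t d] $$ (i, j)"
      using ij A entry[OF ij] by (simp add: subst_var mat_of_cols_def)
  qed (simp_all add: mat_of_cols_def)
  then show "plucker [a, b, c, d] \<in> subst_dom t"
    "column_subst t (plucker [a, b, c, d]) = bracket (t a) (t b) (t c) (t d)"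
    using subst_det[OF A dom] by (simp_all add: plucker_def bracket_def)
qed

lemma plucker_positive:
  assumes "a < b" "b < c" "c < d"
  shows "plucker [a, b, c, d] \<in> vandermonde_positive"
proof -
  let ?v = "vandermonde_column"
  let ?r = "(real d - real c) * (real d - real b) * (real d - real a) * (real c - real b) * (real c - real a) * (real b - real a)"
  have entries: "?v j $ 0 = const 1" "?v j $ 1 = const (of_nat j)" "?v j $ 2 = const (of_nat j ^ 2)"
    "?v j $ 3 = const (of_nat j ^ 3)" for j
    by (simp_all add: vandermonde_column_def del: const_1)
  have "bracket (?v a) (?v b) (?v c) (?v d) = const (of_real ?r)"
    unfolding bracket_expand minor3_def entries const_mult[symmetric] const_diff[symmetric] const_add[symmetric] const_eq_iff
    by (simp add: power2_eq_square power3_eq_cube algebra_simps)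
  moreover have "?r > 0"
    using assms by simp
  ultimately show ?thesis
    unfolding vandermonde_positive_def by (auto simp: subst_plucker)
qed

lemma seed_positive_rectangles:
  assumes "finite N" "5 \<le> card N"
  shows "seed_positive vandermonde_positive (rectangles_seed N)"
proof -
  let ?a = "\<lambda>i. sorted_list_of_set N ! (i - 1)"
  have a: "?a i < ?a j" if "i < j" "1 \<le> i" "j \<le> card N" for i j
    using that assms by (intro sorted_wrt_nth_less[of "(<)"]) auto
  have pos: "plucker (map ?a [i, j, k, l]) \<in> vandermonde_positive"
    if "1 \<le> i" "i < j" "j < k" "k < l" "l \<le> card N" for i j k l
    using that a[of i j] a[of j k] a[of k l] by (auto intro!: plucker_positive)
  have "cluster (rectangles_seed N) v \<in> vandermonde_positive" if v: "v \<in> vertices (rectangles_seed N)" for v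
  proof (cases v)
    case V\<^sub>0
    then show ?thesis
      unfolding V\<^sub>0 rectangles_seed_simps using assms(2) by (intro pos) auto
  next
    case (V r c)
    with v have "r = 1 \<or> r = 2 \<or> r = 3 \<or> r = 4" and c: "5 \<le> c" "c \<le> card N"
      by (auto simp: rectangles_seed_simps)
    then show ?thesis
      unfolding V rectangles_seed_simps
      by (elim disjE) (auto simp only: rect_indices_simps[OF c(1)] intro!: pos)
  qed
  then show ?thesis
    by (simp add: seed_positive_def)
qed

lemma seed_positive_spurion_step:
  assumes "9 \<le> n"
  shows "seed_positive vandermonde_positive (spurion_step n t)"
proof -
  have "seed_positive vandermonde_positive (fold mutate ks (rectangles_seed {1..n}))" for ks
    by (induction ks rule: rev_induct)
      (use assms in \<open>auto intro!: seed_positive_mutate seed_positive_rectangles positive_cone_vandermonde\<close>)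
  then show ?thesis
    by (simp add: spurion_step_def)
qed

section \<open>Cluster variables before and after the eleven mutations\<close>

lemma sorted_list_of_interval_nth:
  assumes "1 \<le> i" "i \<le> n"
  shows "sorted_list_of_set {1..n} ! (i - 1) = i"
proof -
  have "sorted_list_of_set {1..n} = [1..<Suc n]"
    by (metis atLeastLessThanSuc_atLeastAtMost sorted_list_of_set_range)
  then show ?thesis
    using assms by (simp del: upt_Suc)
qed

lemma cluster_rectangles_interval_V0:
  assumes "4 \<le> n"
  shows "cluster (rectangles_seed {1..n}) V\<^sub>0 = plucker [1, 2, 3, 4]"
proof -
  have "sorted_list_of_set {1..n} ! (1 - 1) = 1" "sorted_list_of_set {1..n} ! (2 - 1) = 2"
    "sorted_list_of_set {1..n} ! (3 - 1) = 3" "sorted_list_of_set {1..n} ! (4 - 1) = 4"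
    by (rule sorted_list_of_interval_nth; use assms in simp)+
  then show ?thesis
    unfolding rectangles_seed_simps list.map by (simp only:)
qed

lemma cluster_rectangles_interval:
  assumes "5 \<le> c" "c \<le> n"
  shows "cluster (rectangles_seed {1..n}) (V 1 c) = plucker [1, 2, 3, c]"
    "cluster (rectangles_seed {1..n}) (V 2 c) = plucker [1, 2, c - 1, c]"
    "cluster (rectangles_seed {1..n}) (V 3 c) = plucker [1, c - 2, c - 1, c]"
    "cluster (rectangles_seed {1..n}) (V 4 c) = plucker [c - 3, c - 2, c - 1, c]"
proof -
  have nth_c: "sorted_list_of_set {1..n} ! (1 - 1) = 1" "sorted_list_of_set {1..n} ! (2 - 1) = 2"
    "sorted_list_of_set {1..n} ! (3 - 1) = 3"
    "sorted_list_of_set {1..n} ! (c - 1) = c" "sorted_list_of_set {1..n} ! (c - 1 - 1) = c - 1"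
    "sorted_list_of_set {1..n} ! (c - 2 - 1) = c - 2" "sorted_list_of_set {1..n} ! (c - 3 - 1) = c - 3"
    by (rule sorted_list_of_interval_nth; use assms in simp)+
  show "cluster (rectangles_seed {1..n}) (V 1 c) = plucker [1, 2, 3, c]"
    "cluster (rectangles_seed {1..n}) (V 2 c) = plucker [1, 2, c - 1, c]"
    "cluster (rectangles_seed {1..n}) (V 3 c) = plucker [1, c - 2, c - 1, c]"
    "cluster (rectangles_seed {1..n}) (V 4 c) = plucker [c - 3, c - 2, c - 1, c]"
    unfolding rectangles_seed_simps rect_indices_simps[OF assms(1)] list.map
    using assms by (simp_all only: nth_c)
qed

text \<open>The vertex \<open>(3, 8)\<close> is mutated twice and appears with its second value
  only. The vertices \<open>(1, 6)\<close> and \<open>(1, 7)\<close> are never mutated and keep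
  \<open><1236>\<close> and \<open><1237>\<close>.\<close>

lemma cluster_spurion_step:
  assumes n: "9 \<le> n"
  shows "cluster (spurion_step n 11) = (cluster (rectangles_seed {1..n}))(V 3 8 := spurion_F 9, V 3 7 := spurion_F 3,
    V 2 7 := spurion_F 4, V 2 6 := spurion_F 6, V 2 5 := spurion_F 2, V 3 6 := plucker [3, 7, 8, 9],
    V 3 5 := spurion_F 1, V 2 8 := spurion_F 7, V 1 8 := spurion_F 8, V 1 5 := spurion_F 5)"
proof -
  let ?x = "cluster (rectangles_seed {1..n})"
  note x = cluster_rectangles_interval[OF _ order_trans[OF _ n], simplified]
    cluster_rectangles_interval_V0[OF order_trans[OF _ n], simplified]
  \<comment> \<open>The variable at \<open>(3, 8)\<close> between its two mutations.\<close>
  let ?X = "plucker [1, 5, 6, 7] * plucker [2, 7, 8, 9] - plucker [2, 5, 6, 7] * plucker [1, 7, 8, 9]"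
  let ?y = "\<lambda>t. cluster (spurion_step n t)"
  note steps = spurion_mutations_def spurion_trace_def
  \<comment> \<open>The old variable is nonzero by positivity, so a new variable may be verified by
    the exchange relation in product form instead of by division.\<close>
  have step: "?y (Suc t) = (?y t)(spurion_mutations ! t := z)"
    if t: "t < 11" and z: "z * ?y t (spurion_mutations ! t) =
      prod_list (map (?y t) (fst (snd (spurion_trace ! t)))) + prod_list (map (?y t) (snd (snd (spurion_trace ! t))))"
    for t z
  proof -
    have "spurion_mutations ! t \<in> vertices (spurion_step n t)"
      using less_11_cases[OF t] n by (elim disjE) (auto simp: steps spurion_step_vertices rectangles_seed_simps)
    then have "?y t (spurion_mutations ! t) \<noteq> 0"
      using seed_positive_nonzero[OF positive_cone_vandermonde seed_positive_spurion_step[OF n]] by blast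
    then show ?thesis
      using spurion_step_cluster[OF n t refl] z by (cases "spurion_trace ! t")
        (metis fst_conv snd_conv nonzero_mult_div_cancel_right)
  qed
  have c1: "?y 1 = (?y 0)(V 3 8 := ?X)"
    using step[of 0 "?X"] exchange_X by (simp add: steps spurion_step_0 x algebra_simps)
  note y = spurion_step_0 c1 c1[simplified]
  have c2: "?y 2 = (?y 1)(V 3 7 := spurion_F 3)"
    using step[of 1 "spurion_F 3"] exchange_F3 by (simp add: steps y x algebra_simps flip: numeral_2_eq_2)
  note y = y c2
  have c3: "?y 3 = (?y 2)(V 2 7 := spurion_F 4)"
    using step[of 2 "spurion_F 4"] exchange_F4 by (simp add: steps y x algebra_simps)
  note y = y c3
  have c4: "?y 4 = (?y 3)(V 2 6 := spurion_F 6)"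
    using step[of 3 "spurion_F 6"] exchange_F6 by (simp add: steps y x algebra_simps)
  note y = y c4
  have c5: "?y 5 = (?y 4)(V 2 5 := spurion_F 2)"
    using step[of 4 "spurion_F 2"] exchange_F2 by (simp add: steps y x algebra_simps)
  note y = y c5
  have c6: "?y 6 = (?y 5)(V 3 6 := plucker [3, 7, 8, 9])"
    using step[of 5 "plucker [3, 7, 8, 9]"] exchange_P3789 by (simp add: steps y x algebra_simps)
  note y = y c6
  have c7: "?y 7 = (?y 6)(V 3 5 := spurion_F 1)"
    using step[of 6 "spurion_F 1"] exchange_F1 by (simp add: steps y x algebra_simps)
  note y = y c7
  have c8: "?y 8 = (?y 7)(V 3 8 := spurion_F 9)"
    using step[of 7 "spurion_F 9"] exchange_F9 by (simp add: steps y x algebra_simps)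
  note y = y c8
  have c9: "?y 9 = (?y 8)(V 2 8 := spurion_F 7)"
    using step[of 8 "spurion_F 7"] exchange_F7 by (simp add: steps y x algebra_simps)
  note y = y c9
  have c10: "?y 10 = (?y 9)(V 1 8 := spurion_F 8)"
    using step[of 9 "spurion_F 8"] exchange_F8 by (simp add: steps y x algebra_simps)
  note y = y c10
  have c11: "?y 11 = (?y 10)(V 1 5 := spurion_F 5)"
    using step[of 10 "spurion_F 5"] exchange_F5 by (simp add: steps y x algebra_simps)
  show ?thesis
    unfolding y c11 by (simp add: fun_upd_twist)
qed

section \<open>Substitutions that are injective on a function field\<close>

definition mpoly_vars :: "mpoly \<Rightarrow> nat set" where
  "mpoly_vars p = (\<Union>m\<in>Poly_Mapping.keys p. Poly_Mapping.keys m)"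

lemma mpoly_vars_add: "mpoly_vars (p + q) \<subseteq> mpoly_vars p \<union> mpoly_vars q"
  using keys_add[of p q] by (auto simp: mpoly_vars_def)

lemma mpoly_vars_mult: "mpoly_vars (p * q) \<subseteq> mpoly_vars p \<union> mpoly_vars q"
proof
  fix v assume "v \<in> mpoly_vars (p * q)"
  then obtain m where "m \<in> Poly_Mapping.keys (p * q)" "v \<in> Poly_Mapping.keys m"
    by (auto simp: mpoly_vars_def)
  then obtain a b where "a \<in> Poly_Mapping.keys p" "b \<in> Poly_Mapping.keys q" "v \<in> Poly_Mapping.keys (a + b)"
    using keys_mult[of p q] by blast
  then show "v \<in> mpoly_vars p \<union> mpoly_vars q"
    using keys_add[of a b] by (auto simp: mpoly_vars_def)
qed

definition entry_vars :: "nat set \<Rightarrow> nat set" where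
  "entry_vars N = {prod_encode (i, j) | i j. i < 4 \<and> j \<in> N}"

text \<open>This field contains the Grassmannian field. Its advantage is that every element has a
  representation whose denominator involves only entries of columns in \<open>N\<close>, to which
  injectivity on polynomials applies directly.\<close>

definition entry_field :: "nat set \<Rightarrow> ratfun set" where
  "entry_field N = {Fract p q | p q. q \<noteq> 0 \<and> mpoly_vars p \<union> mpoly_vars q \<subseteq> entry_vars N}"

lemma entry_fieldI:
  assumes "q \<noteq> 0" "mpoly_vars p \<subseteq> entry_vars N" "mpoly_vars q \<subseteq> entry_vars N"
  shows "Fract p q \<in> entry_field N"
  using assms unfolding entry_field_def by blast

lemma entry_fieldE:
  assumes "x \<in> entry_field N"
  obtains p q where "x = Fract p q" "q \<noteq> 0" "mpoly_vars p \<subseteq> entry_vars N" "mpoly_vars q \<subseteq> entry_vars N"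
  using assms unfolding entry_field_def by blast

lemma entry_field_const: "const c \<in> entry_field N"
  unfolding const_def by (rule entry_fieldI) (auto simp: mpoly_vars_def)

lemma entry_field_var: "i < 4 \<Longrightarrow> j \<in> N \<Longrightarrow> var i j \<in> entry_field N"
  unfolding var_def by (rule entry_fieldI) (auto simp: mpoly_vars_def entry_vars_def)

lemma entry_field_add:
  assumes "x \<in> entry_field N" "y \<in> entry_field N"
  shows "x + y \<in> entry_field N"
proof -
  obtain p q where x: "x = Fract p q" "q \<noteq> 0" "mpoly_vars p \<subseteq> entry_vars N" "mpoly_vars q \<subseteq> entry_vars N"
    using assms(1) by (rule entry_fieldE)
  obtain p' q' where y: "y = Fract p' q'" "q' \<noteq> 0" "mpoly_vars p' \<subseteq> entry_vars N" "mpoly_vars q' \<subseteq> entry_vars N"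
    using assms(2) by (rule entry_fieldE)
  have "x + y = Fract (p * q' + p' * q) (q * q')"
    using x y by simp
  moreover have "Fract (p * q' + p' * q) (q * q') \<in> entry_field N"
    using x y mpoly_vars_add[of "p * q'" "p' * q"] mpoly_vars_mult[of p q'] mpoly_vars_mult[of p' q]
      mpoly_vars_mult[of q q']
    by (intro entry_fieldI) (simp, blast+)
  ultimately show ?thesis
    by simp
qed

lemma entry_field_mult:
  assumes "x \<in> entry_field N" "y \<in> entry_field N"
  shows "x * y \<in> entry_field N"
proof -
  obtain p q where x: "x = Fract p q" "q \<noteq> 0" "mpoly_vars p \<subseteq> entry_vars N" "mpoly_vars q \<subseteq> entry_vars N"
    using assms(1) by (rule entry_fieldE)
  obtain p' q' where y: "y = Fract p' q'" "q' \<noteq> 0" "mpoly_vars p' \<subseteq> entry_vars N" "mpoly_vars q' \<subseteq> entry_vars N"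
    using assms(2) by (rule entry_fieldE)
  have "x * y = Fract (p * p') (q * q')"
    using x y by simp
  moreover have "Fract (p * p') (q * q') \<in> entry_field N"
    using x y mpoly_vars_mult[of p p'] mpoly_vars_mult[of q q']
    by (intro entry_fieldI) (simp, blast+)
  ultimately show ?thesis
    by simp
qed

lemma entry_field_inverse:
  assumes "x \<in> entry_field N"
  shows "inverse x \<in> entry_field N"
proof (cases "x = 0")
  case True
  then show ?thesis
    using assms by simp
next
  case False
  obtain p q where x: "x = Fract p q" "q \<noteq> 0" "mpoly_vars p \<subseteq> entry_vars N" "mpoly_vars q \<subseteq> entry_vars N"
    using assms by (rule entry_fieldE)
  have "p \<noteq> 0"
    using False x by (auto simp: fract_collapse)
  then show ?thesis
    using x by (auto intro: entry_fieldI)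
qed

lemma entry_field_uminus: "x \<in> entry_field N \<Longrightarrow> - x \<in> entry_field N"
  using entry_field_mult[OF entry_field_const[of "-1"]] by (simp add: const_uminus)

lemma entry_field_diff: "x \<in> entry_field N \<Longrightarrow> y \<in> entry_field N \<Longrightarrow> x - y \<in> entry_field N"
  using entry_field_add[OF _ entry_field_uminus] by fastforce

lemma length_4_cases: "length js = 4 \<Longrightarrow> \<exists>a b c d. js = [a, b, c, d]"
  by (auto simp: numeral_eq_Suc length_Suc_conv)

lemma gr_field_subset_entry_field: "gr_field N \<subseteq> entry_field N"
proof
  fix x assume "x \<in> gr_field N"
  then show "x \<in> entry_field N"
    unfolding gr_field_def
  proof induction
    case (gen x)
    then obtain js where js: "x = plucker js" "length js = 4" "set js \<subseteq> N"
      by blast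
    then obtain a b c d where abcd: "js = [a, b, c, d]"
      using length_4_cases by blast
    have entry: "zcol j $ i \<in> entry_field N" if "i < 4" "j \<in> N" for i j
      using entry_field_var[OF that] that by (simp add: zcol_def)
    show ?case
      unfolding js(1) abcd plucker_bracket bracket_expand minor3_def using js(3) abcd
      by (intro entry_field_add entry_field_diff entry_field_mult entry) auto
  qed (auto intro: entry_field_const entry_field_add entry_field_mult entry_field_inverse)
qed

text \<open>
  Instead of a transcendence degree argument: a substitution \<open>t\<close> is injective as soon as some
  further specialisation \<open>u\<close> of the variables turns the substituted columns back into generic ones.
\<close>

lemma partial_field_hom_column_subst:
  assumes u: "\<And>i j. i < 4 \<Longrightarrow> j \<in> N \<Longrightarrow> t j $ i \<in> subst_dom u"
    "\<And>i j. i < 4 \<Longrightarrow> j \<in> N \<Longrightarrow> column_subst u (t j $ i) = var i j"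
  shows "partial_field_hom (column_subst t) (entry_field N)"
proof -
  have inj: "mpoly_eval (entries_subst t) p \<noteq> 0"
    if p: "p \<noteq> 0" "mpoly_vars p \<subseteq> entry_vars N" for p
  proof
    assume "mpoly_eval (entries_subst t) p = 0"
    have dom: "entries_subst t v \<in> subst_dom u" "column_subst u (entries_subst t v) = (case prod_decode v of (i, j) \<Rightarrow> var i j)"
      if v: "v \<in> (\<Union>m\<in>Poly_Mapping.keys p. Poly_Mapping.keys m)" for v
    proof -
      have "v \<in> entry_vars N"
        using v p(2) unfolding mpoly_vars_def by blast
      then obtain i j where "v = prod_encode (i, j)" "i < 4" "j \<in> N"
        unfolding entry_vars_def by blast
      then show "entries_subst t v \<in> subst_dom u"
        "column_subst u (entries_subst t v) = (case prod_decode v of (i, j) \<Rightarrow> var i j)"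
        using u by (auto simp: entries_subst_def)
    qed
    have "column_subst u (mpoly_eval (entries_subst t) p) = mpoly_eval (\<lambda>v. column_subst u (entries_subst t v)) p"
      by (rule subst_mpoly_eval(2)[OF dom(1)])
    also have "\<dots> = mpoly_eval (\<lambda>v. case prod_decode v of (i, j) \<Rightarrow> var i j) p"
      by (rule mpoly_eval_cong) (use dom(2) in blast)
    also have "\<dots> = Fract p 1"
      by (rule mpoly_eval_entries_id)
    finally have "Fract p 1 = 0"
      using \<open>mpoly_eval (entries_subst t) p = 0\<close> by simp
    with p(1) show False
      by (simp add: Zero_fract_def eq_fract)
  qed
  have dom: "x \<in> subst_dom t" if "x \<in> entry_field N" for x
    using that inj unfolding entry_field_def subst_dom_def by blast
  have nonzero: "column_subst t x \<noteq> 0" if x: "x \<in> entry_field N" "x \<noteq> 0" for x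
  proof -
    obtain p q where pq: "x = Fract p q" "q \<noteq> 0" "mpoly_vars p \<subseteq> entry_vars N"
      "mpoly_vars q \<subseteq> entry_vars N"
      using x(1) by (rule entry_fieldE)
    have "p \<noteq> 0"
      using x(2) pq by (auto simp: fract_collapse)
    then show ?thesis
      using inj pq by (simp add: column_subst_Fract)
  qed
  show ?thesis
  proof
    show "column_subst t (inverse x) = inverse (column_subst t x)" if "x \<in> entry_field N" for x
      using that nonzero dom by (cases "x = 0") (auto simp: subst_inverse)
  qed (auto simp: entry_field_const entry_field_add entry_field_mult entry_field_inverse dom
      subst_const subst_add subst_mult)
qed

section \<open>The spurion columns\<close>

lemma dim_zcol [simp]: "dim_vec (zcol j) = 4"
  by (simp add: zcol_def)

lemma bracket_linear:
  "dim_vec p = 4 \<Longrightarrow> dim_vec q = 4 \<Longrightarrow> bracket (p + q) b c d = bracket p b c d + bracket q b c d"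
  "dim_vec p = 4 \<Longrightarrow> dim_vec q = 4 \<Longrightarrow> bracket a (p + q) c d = bracket a p c d + bracket a q c d"
  "dim_vec p = 4 \<Longrightarrow> dim_vec q = 4 \<Longrightarrow> bracket a b (p + q) d = bracket a b p d + bracket a b q d"
  "dim_vec p = 4 \<Longrightarrow> dim_vec q = 4 \<Longrightarrow> bracket a b c (p + q) = bracket a b c p + bracket a b c q"
  "dim_vec p = 4 \<Longrightarrow> bracket (x \<cdot>\<^sub>v p) b c d = x * bracket p b c d"
  "dim_vec p = 4 \<Longrightarrow> bracket a (x \<cdot>\<^sub>v p) c d = x * bracket a p c d"
  "dim_vec p = 4 \<Longrightarrow> bracket a b (x \<cdot>\<^sub>v p) d = x * bracket a b p d"
  "dim_vec p = 4 \<Longrightarrow> bracket a b c (x \<cdot>\<^sub>v p) = x * bracket a b c p"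
  by (simp_all add: bracket_expand minor3_def algebra_simps)

text \<open>Each of them is a cluster variable after the eleven mutations and hence positive. They
  do not depend on \<open>n\<close>, so the smallest case is enough.\<close>

lemma spurion_F_nonzero:
  assumes "i \<in> {1..9}"
  shows "spurion_F i \<noteq> 0"
proof -
  have vertices: "V r c \<in> vertices (spurion_step 9 11)" if "1 \<le> r" "r \<le> 4" "5 \<le> c" "c \<le> 9" for r c
    using that by (auto simp: spurion_step_vertices rectangles_seed_simps)
  note nz = seed_positive_nonzero[OF positive_cone_vandermonde seed_positive_spurion_step[OF order_refl] vertices]
  have "i \<in> {1, 2, 3, 4, 5, 6, 7, 8, 9}"
    using assms by auto
  then show ?thesis
    using nz[of 3 5] nz[of 2 5] nz[of 3 7] nz[of 2 7] nz[of 1 5] nz[of 2 6] nz[of 2 8] nz[of 1 8] nz[of 3 8]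
    unfolding cluster_spurion_step[OF order_refl] by (elim insertE) simp_all
qed

text \<open>The new column is a point of the line through columns 1 and 2; dividing by
  \<open>spurion_F 2\<close> normalises the coefficient of \<open>zcol 2\<close> to 1.\<close>

lemma spurion_columns_2:
  "spurion_columns 2 = zcol 2 + (- (spurion_F 1 / spurion_F 2)) \<cdot>\<^sub>v zcol 1"
proof (rule eq_vecI)
  fix i assume "i < dim_vec (zcol 2 + (- (spurion_F 1 / spurion_F 2)) \<cdot>\<^sub>v zcol 1)"
  then have i: "i < 4"
    by simp
  have "(zw [1, 2] \<star> (zw [3] \<curlywedge> (zw [4, 5, 6] \<star> zw [7, 8, 9]))) {i} =
      spurion_F 2 * zcol 2 $ i - spurion_F 1 * zcol 1 $ i"
    unfolding spurion_F_brackets plucker_bracket zw_def list.map by (rule projection_2_3[OF i])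
  then show "spurion_columns 2 $ i = (zcol 2 + (- (spurion_F 1 / spurion_F 2)) \<cdot>\<^sub>v zcol 1) $ i"
    using i spurion_F_nonzero[of 2]
    by (simp add: spurion_columns_def vec_of_ext_def del: One_nat_def) (simp add: field_simps)
qed (simp_all add: spurion_columns_def vec_of_ext_def)

lemma spurion_columns_8:
  "spurion_columns 8 = zcol 8 + (- (spurion_F 9 / spurion_F 8)) \<cdot>\<^sub>v zcol 9"
proof (rule eq_vecI)
  fix i assume "i < dim_vec (zcol 8 + (- (spurion_F 9 / spurion_F 8)) \<cdot>\<^sub>v zcol 9)"
  then have i: "i < 4"
    by simp
  have "(((zw [1, 2, 3] \<star> zw [4, 5, 6]) \<curlywedge> zw [7]) \<star> zw [8, 9]) {i} =
      spurion_F 8 * zcol 8 $ i - spurion_F 9 * zcol 9 $ i"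
    using projection_3_2[OF i, of "zcol 1" "zcol 2" "zcol 3" "zcol 4" "zcol 5" "zcol 6" "zcol 7" "zcol 8" "zcol 9"]
    by (simp add: spurion_F_def chain_brackets zw_def flip: plucker_bracket)
  then show "spurion_columns 8 $ i = (zcol 8 + (- (spurion_F 9 / spurion_F 8)) \<cdot>\<^sub>v zcol 9) $ i"
    using i spurion_F_nonzero[of 8]
    by (simp add: spurion_columns_def vec_of_ext_def) (simp add: field_simps)
qed (simp_all add: spurion_columns_def vec_of_ext_def)

text \<open>The point lies on both planes 123 and 789 and has an expression in either spanning set.
  Brackets with columns 1 and 2 call for the first, brackets with columns 8 and 9 for the
  second.\<close>

lemma intersection_spurion_columns:
  assumes i: "i < 4"
  shows "(zw [1, 2, 3] \<star> zw [4, 5, 6] \<star> zw [7, 8, 9]) {i} =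
      spurion_F 3 * zcol 3 $ i - spurion_F 2 * zcol 2 $ i + spurion_F 1 * zcol 1 $ i"
    "(zw [1, 2, 3] \<star> zw [4, 5, 6] \<star> zw [7, 8, 9]) {i} =
      spurion_F 7 * zcol 7 $ i - spurion_F 8 * zcol 8 $ i + spurion_F 9 * zcol 9 $ i"
proof -
  show 1: "(zw [1, 2, 3] \<star> zw [4, 5, 6] \<star> zw [7, 8, 9]) {i} =
      spurion_F 3 * zcol 3 $ i - spurion_F 2 * zcol 2 $ i + spurion_F 1 * zcol 1 $ i"
    unfolding spurion_F_brackets plucker_bracket zw_def list.map by (rule intersection_3_3_3[OF i])
  \<comment> \<open>Cramer's rule for \<open>b\<close>, \<open>c\<close>, 7, 8, 9, separating a
    vector of the plane 789 from one of the line \<open>bc\<close>.\<close>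
  have E: "plucker [b, c, 7, 8] * zcol 9 $ i - plucker [b, c, 7, 9] * zcol 8 $ i + plucker [b, c, 8, 9] * zcol 7 $ i =
      plucker [b, 7, 8, 9] * zcol c $ i - plucker [c, 7, 8, 9] * zcol b $ i" for b c
    using cramer_coord[OF i, of "zcol b" "zcol c" "zcol 7" "zcol 8" "zcol 9"]
    by (simp add: plucker_bracket algebra_simps)
  \<comment> \<open>The three-term forms rather than the binomials: grouped by their first factors,
    they leave exactly the combinations of the preceding fact.\<close>
  have F: "spurion_F 7 = plucker [1, 4, 5, 6] * plucker [2, 3, 8, 9] - plucker [2, 4, 5, 6] * plucker [1, 3, 8, 9] +
      plucker [3, 4, 5, 6] * plucker [1, 2, 8, 9]"
    "spurion_F 8 = plucker [1, 4, 5, 6] * plucker [2, 3, 7, 9] - plucker [2, 4, 5, 6] * plucker [1, 3, 7, 9] +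
      plucker [3, 4, 5, 6] * plucker [1, 2, 7, 9]"
    "spurion_F 9 = plucker [1, 4, 5, 6] * plucker [2, 3, 7, 8] - plucker [2, 4, 5, 6] * plucker [1, 3, 7, 8] +
      plucker [3, 4, 5, 6] * plucker [1, 2, 7, 8]"
    by (simp_all add: spurion_F_def chain_brackets)
  have "spurion_F 7 * zcol 7 $ i - spurion_F 8 * zcol 8 $ i + spurion_F 9 * zcol 9 $ i =
      plucker [1, 4, 5, 6] * (plucker [2, 3, 7, 8] * zcol 9 $ i - plucker [2, 3, 7, 9] * zcol 8 $ i + plucker [2, 3, 8, 9] * zcol 7 $ i) -
      plucker [2, 4, 5, 6] * (plucker [1, 3, 7, 8] * zcol 9 $ i - plucker [1, 3, 7, 9] * zcol 8 $ i + plucker [1, 3, 8, 9] * zcol 7 $ i) +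
      plucker [3, 4, 5, 6] * (plucker [1, 2, 7, 8] * zcol 9 $ i - plucker [1, 2, 7, 9] * zcol 8 $ i + plucker [1, 2, 8, 9] * zcol 7 $ i)"
    unfolding F by (simp add: algebra_simps)
  also have "\<dots> = spurion_F 3 * zcol 3 $ i - spurion_F 2 * zcol 2 $ i + spurion_F 1 * zcol 1 $ i"
    unfolding E spurion_F_brackets by (simp add: algebra_simps)
  finally show "(zw [1, 2, 3] \<star> zw [4, 5, 6] \<star> zw [7, 8, 9]) {i} =
      spurion_F 7 * zcol 7 $ i - spurion_F 8 * zcol 8 $ i + spurion_F 9 * zcol 9 $ i"
    unfolding 1 by simp
qed

lemma spurion_columns_7:
  "spurion_columns 7 = zcol 7 + (- (spurion_F 8 / spurion_F 7)) \<cdot>\<^sub>v zcol 8 + (spurion_F 9 / spurion_F 7) \<cdot>\<^sub>v zcol 9"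
    (is "_ = ?v")
  "spurion_columns 7 = (spurion_F 3 / spurion_F 7) \<cdot>\<^sub>v zcol 3 + (- (spurion_F 2 / spurion_F 7)) \<cdot>\<^sub>v zcol 2 +
     (spurion_F 1 / spurion_F 7) \<cdot>\<^sub>v zcol 1"
    (is "_ = ?w")
proof -
  have entry: "spurion_columns 7 $ i = inverse (spurion_F 7) * (zw [1, 2, 3] \<star> zw [4, 5, 6] \<star> zw [7, 8, 9]) {i}"
    if "i < 4" for i
    using that by (simp add: spurion_columns_def vec_of_ext_def)
  show "spurion_columns 7 = ?v"
  proof (rule eq_vecI)
    fix i assume "i < dim_vec ?v"
    then have i: "i < 4"
      by simp
    show "spurion_columns 7 $ i = ?v $ i"
      unfolding entry[OF i] intersection_spurion_columns(2)[OF i]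
      using i spurion_F_nonzero[of 7] by simp (simp add: field_simps)
  qed (simp add: spurion_columns_def vec_of_ext_def)
  show "spurion_columns 7 = ?w"
  proof (rule eq_vecI)
    fix i assume "i < dim_vec ?w"
    then have i: "i < 4"
      by simp
    show "spurion_columns 7 $ i = ?w $ i"
      unfolding entry[OF i] intersection_spurion_columns(1)[OF i]
      using i spurion_F_nonzero[of 7] by simp (simp add: field_simps)
  qed (simp add: spurion_columns_def vec_of_ext_def)
qed

lemma spurion_columns_other: "j \<notin> {2, 7, 8} \<Longrightarrow> spurion_columns j = zcol j"
  by (simp add: spurion_columns_def)

lemma plucker_nonzero: "a < b \<Longrightarrow> b < c \<Longrightarrow> c < d \<Longrightarrow> plucker [a, b, c, d] \<noteq> 0"
  using plucker_positive[of a b c d] positive_cone_vandermonde unfolding positive_cone_def by metis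

text \<open>
  With these values the first three columns and the columns 4, 5, 6 span planes through the
  seventh spurion column, so that \<open>F\<^sub>1\<close> and \<open>F\<^sub>9\<close> vanish and \<open>F\<^sub>7 = F\<^sub>8\<close>.
\<close>

definition specialised_columns :: "nat \<Rightarrow> ratfun vec" where
  "specialised_columns j = (if j = 3 then zcol 7 + zcol 2 else if j = 4 then zcol 7 else if j = 5 then zcol 9
     else if j = 6 then zcol 1 else if j = 7 then zcol 7 + zcol 8 else zcol j)"

lemma spurion_F_subst_dom: "spurion_F i \<in> subst_dom t" if "i \<in> {1..9}"
proof -
  have "i \<in> {1, 2, 3, 4, 5, 6, 7, 8, 9}"
    using that by auto
  then show ?thesis
    by (elim insertE) (simp_all only: spurion_F_brackets subst_diff(1) subst_mult(1) subst_plucker(1) empty_iff)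
qed

lemma specialised_spurion_F:
  "column_subst specialised_columns (spurion_F 1) = 0"
  "column_subst specialised_columns (spurion_F 2) = plucker [1, 2, 7, 9] * plucker [1, 7, 8, 9]"
  "column_subst specialised_columns (spurion_F 7) = plucker [1, 2, 7, 9] * plucker [1, 7, 8, 9]"
  "column_subst specialised_columns (spurion_F 8) = plucker [1, 2, 7, 9] * plucker [1, 7, 8, 9]"
  "column_subst specialised_columns (spurion_F 9) = 0"
  unfolding spurion_F_brackets
  by (simp_all add: subst_diff subst_mult subst_plucker specialised_columns_def bracket_linear plucker_sort
      flip: plucker_bracket)

lemma partial_field_hom_spurion:
  "partial_field_hom spurion_promotion (entry_field (spurion_index_set n))"
  unfolding spurion_promotion_def
proof (rule partial_field_hom_column_subst)
  fix i j :: nat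
  assume ij: "i < 4" "j \<in> spurion_index_set n"
  let ?u = "specialised_columns"
  have nz: "plucker [1, 2, 7, 9] * plucker [1, 7, 8, 9] \<noteq> 0"
    by (simp add: plucker_nonzero)
  have entry: "zcol k $ i \<in> subst_dom ?u" "column_subst ?u (zcol k $ i) = ?u k $ i" for k
    using ij(1) by (simp_all add: zcol_def subst_var)
  define a b c d where abcd: "a = spurion_F 1 / spurion_F 2" "b = spurion_F 8 / spurion_F 7"
    "c = spurion_F 9 / spurion_F 7" "d = spurion_F 9 / spurion_F 8"
  have dom: "a \<in> subst_dom ?u" "b \<in> subst_dom ?u" "c \<in> subst_dom ?u" "d \<in> subst_dom ?u"
    using nz unfolding abcd by (auto intro!: subst_divide spurion_F_subst_dom simp: specialised_spurion_F)
  \<comment> \<open>With these values column 7 becomes its specialised value minus column 8, that is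
    \<open>zcol 7\<close>, while columns 2 and 8 lose their correction terms.\<close>
  have subst: "column_subst ?u a = 0" "column_subst ?u b = 1" "column_subst ?u c = 0" "column_subst ?u d = 0"
    using nz unfolding abcd by (simp_all add: subst_divide spurion_F_subst_dom specialised_spurion_F del: One_nat_def)
  have col: "spurion_columns 2 $ i = zcol 2 $ i - a * zcol 1 $ i"
    "spurion_columns 7 $ i = zcol 7 $ i - b * zcol 8 $ i + c * zcol 9 $ i"
    "spurion_columns 8 $ i = zcol 8 $ i - d * zcol 9 $ i"
    using ij(1) by (simp_all add: spurion_columns_2 spurion_columns_7(1) spurion_columns_8 abcd del: One_nat_def)
  have "j \<notin> {3, 4, 5, 6}"
    using ij(2) by (auto simp: spurion_index_set_def)
  then consider "j = 2" | "j = 7" | "j = 8" | "j \<notin> {2, 3, 4, 5, 6, 7, 8}"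
    by blast
  note cases = this
  have var: "var i k = zcol k $ i" for k
    using ij(1) by (simp add: zcol_def)
  show "spurion_columns j $ i \<in> subst_dom ?u"
    using cases
    by cases (simp_all add: col spurion_columns_other entry dom subst_add subst_diff subst_mult del: One_nat_def)
  show "column_subst ?u (spurion_columns j $ i) = var i j"
    using cases ij(1) unfolding var
    by cases (simp_all add: col spurion_columns_other entry dom subst subst_add subst_diff subst_mult
        specialised_columns_def del: One_nat_def)
qed

section \<open>Images of Pluecker coordinates\<close>

lemma spurion_promotion_bracket:
  "spurion_promotion (plucker [a, b, c, d]) =
     bracket (spurion_columns a) (spurion_columns b) (spurion_columns c) (spurion_columns d)"
  unfolding spurion_promotion_def by (rule subst_plucker)

text \<open>Every correction term is cancelled by a neighbouring column: column 2 changes by a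
  multiple of column 1, column 8 by one of column 9, and column 7 by a combination of columns 8 and
  9. Next to columns 1 and 2, the other expression of column 7 leaves a multiple of
  \<open>zcol 3\<close>. These cancellations are complete except in the first two formulas, which
  are finished by a three-term relation.\<close>

lemma spurion_promotion_plucker:
  "spurion_promotion (plucker [1, 2, 7, 8]) = spurion_F 3 * plucker [1, 2, 3, 7] / spurion_F 8"
  "spurion_promotion (plucker [2, 7, 8, 9]) = spurion_F 3 / spurion_F 2 * plucker [3, 7, 8, 9]"
  "9 \<le> c \<Longrightarrow> spurion_promotion (plucker [1, 2, 7, c]) = spurion_F 3 / spurion_F 7 * plucker [1, 2, 3, c]"
  "9 \<le> c \<Longrightarrow> spurion_promotion (plucker [1, 2, c - 1, c]) = plucker [1, 2, c - 1, c]"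
  "9 \<le> c \<Longrightarrow> spurion_promotion (plucker [1, c - 2, c - 1, c]) = plucker [1, c - 2, c - 1, c]"
  "10 \<le> c \<Longrightarrow> spurion_promotion (plucker [c - 3, c - 2, c - 1, c]) = plucker [c - 3, c - 2, c - 1, c]"
proof -
  have nz: "spurion_F 2 \<noteq> 0" "spurion_F 7 \<noteq> 0" "spurion_F 8 \<noteq> 0"
    by (simp_all add: spurion_F_nonzero)
  have 1: "spurion_columns 1 = zcol 1"
    by (simp add: spurion_columns_other)
  have c: "spurion_columns c = zcol c" if "9 \<le> c" for c
    using that by (simp add: spurion_columns_other)
  have "spurion_promotion (plucker [1, 2, 7, 8]) =
      spurion_F 3 / spurion_F 7 * (plucker [1, 2, 3, 8] - spurion_F 9 / spurion_F 8 * plucker [1, 2, 3, 9])"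
    unfolding spurion_promotion_bracket spurion_columns_2 spurion_columns_7(2) spurion_columns_8 1
    by (simp add: bracket_linear algebra_simps flip: plucker_bracket)
  also have "\<dots> = spurion_F 3 * plucker [1, 2, 3, 7] / spurion_F 8"
    using exchange_F8 nz by (simp add: field_simps)
  finally show "spurion_promotion (plucker [1, 2, 7, 8]) = spurion_F 3 * plucker [1, 2, 3, 7] / spurion_F 8" .
  have "spurion_promotion (plucker [2, 7, 8, 9]) =
      plucker [2, 7, 8, 9] - spurion_F 1 / spurion_F 2 * plucker [1, 7, 8, 9]"
    unfolding spurion_promotion_bracket spurion_columns_2 spurion_columns_7(1) spurion_columns_8 c[OF order_refl]
    by (simp add: bracket_linear algebra_simps flip: plucker_bracket)
  also have "\<dots> = spurion_F 3 / spurion_F 2 * plucker [3, 7, 8, 9]"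
    using exchange_spurion nz by (simp add: field_simps)
  finally show "spurion_promotion (plucker [2, 7, 8, 9]) = spurion_F 3 / spurion_F 2 * plucker [3, 7, 8, 9]" .
  show "spurion_promotion (plucker [1, 2, 7, c]) = spurion_F 3 / spurion_F 7 * plucker [1, 2, 3, c]" if "9 \<le> c"
    unfolding spurion_promotion_bracket spurion_columns_2 spurion_columns_7(2) 1 c[OF that]
    by (simp add: bracket_linear flip: plucker_bracket)
  show "spurion_promotion (plucker [1, 2, c - 1, c]) = plucker [1, 2, c - 1, c]" if "9 \<le> c"
  proof (cases "c = 9")
    case True
    show ?thesis
      unfolding spurion_promotion_bracket spurion_columns_2 True 1 c[OF order_refl]
      by (simp add: spurion_columns_8 bracket_linear flip: plucker_bracket)
  next
    case False
    then show ?thesis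
      using that unfolding spurion_promotion_bracket spurion_columns_2 1
      by (simp add: c bracket_linear flip: plucker_bracket)
  qed
  show "spurion_promotion (plucker [1, c - 2, c - 1, c]) = plucker [1, c - 2, c - 1, c]" if c_ge: "9 \<le> c"
  proof -
    consider "c = 9" | "c = 10" | "11 \<le> c"
      using c_ge by linarith
    then show ?thesis
    proof cases
      case 1
      show ?thesis
        unfolding spurion_promotion_bracket 1
        by (simp add: spurion_columns_7(1) spurion_columns_8 c spurion_columns_other bracket_linear flip: plucker_bracket)
    next
      case 2
      show ?thesis
        unfolding spurion_promotion_bracket 2
        by (simp add: spurion_columns_8 c spurion_columns_other bracket_linear flip: plucker_bracket)
    next
      case 3
      then show ?thesis
        unfolding spurion_promotion_bracket
        by (simp add: c spurion_columns_other flip: plucker_bracket)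
    qed
  qed
  show "spurion_promotion (plucker [c - 3, c - 2, c - 1, c]) = plucker [c - 3, c - 2, c - 1, c]" if c_ge: "10 \<le> c"
  proof -
    consider "c = 10" | "c = 11" | "12 \<le> c"
      using c_ge by linarith
    then show ?thesis
    proof cases
      case 1
      show ?thesis
        unfolding spurion_promotion_bracket 1
        by (simp add: spurion_columns_7(1) spurion_columns_8 c bracket_linear flip: plucker_bracket)
    next
      case 2
      show ?thesis
        unfolding spurion_promotion_bracket 2
        by (simp add: spurion_columns_8 c bracket_linear flip: plucker_bracket)
    next
      case 3
      then show ?thesis
        unfolding spurion_promotion_bracket by (simp add: c flip: plucker_bracket)
    qed
  qed
qed

section \<open>The image of the Grassmannian function field\<close>

lemma gr_field_closed:
  "const c \<in> gr_field N"
  "x \<in> gr_field N \<Longrightarrow> y \<in> gr_field N \<Longrightarrow> x + y \<in> gr_field N"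
  "x \<in> gr_field N \<Longrightarrow> y \<in> gr_field N \<Longrightarrow> x * y \<in> gr_field N"
  "x \<in> gr_field N \<Longrightarrow> inverse x \<in> gr_field N"
  unfolding gr_field_def by (auto intro: field_generated.intros)

lemma gr_field_closed':
  "0 \<in> gr_field N" "1 \<in> gr_field N"
  "x \<in> gr_field N \<Longrightarrow> - x \<in> gr_field N"
  "x \<in> gr_field N \<Longrightarrow> y \<in> gr_field N \<Longrightarrow> x - y \<in> gr_field N"
  "x \<in> gr_field N \<Longrightarrow> y \<in> gr_field N \<Longrightarrow> x / y \<in> gr_field N"
proof -
  show "0 \<in> gr_field N" "1 \<in> gr_field N"
    using gr_field_closed(1)[of 0 N] gr_field_closed(1)[of 1 N] by simp_all
  show minus: "- x \<in> gr_field N" if "x \<in> gr_field N" for x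
    using gr_field_closed(3)[OF gr_field_closed(1)[of "-1"] that] by (simp add: const_uminus)
  show "x - y \<in> gr_field N" if "x \<in> gr_field N" "y \<in> gr_field N"
    using gr_field_closed(2)[OF that(1) minus[OF that(2)]] by simp
  show "x / y \<in> gr_field N" if "x \<in> gr_field N" "y \<in> gr_field N"
    unfolding divide_inverse using that by (intro gr_field_closed)
qed

lemma plucker_gr_field: "{a, b, c, d} \<subseteq> N \<Longrightarrow> plucker [a, b, c, d] \<in> gr_field N"
  unfolding gr_field_def
  by (intro field_generated.gen CollectI exI[of _ "[a, b, c, d]"]) auto

text \<open>The entries of a column are in general not in the Grassmannian field, but brackets of
  such combinations are. Three terms suffice for the image of \<open>z_7\<close>.\<close>

definition rational_span :: "nat set \<Rightarrow> ratfun vec set" where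
  "rational_span N = {x \<cdot>\<^sub>v zcol i + y \<cdot>\<^sub>v zcol j + z \<cdot>\<^sub>v zcol k | x y z i j k.
     {x, y, z} \<subseteq> gr_field N \<and> {i, j, k} \<subseteq> N}"

lemma bracket_rational_span:
  assumes "v\<^sub>1 \<in> rational_span N" "v\<^sub>2 \<in> rational_span N" "v\<^sub>3 \<in> rational_span N" "v\<^sub>4 \<in> rational_span N"
  shows "bracket v\<^sub>1 v\<^sub>2 v\<^sub>3 v\<^sub>4 \<in> gr_field N"
proof -
  \<comment> \<open>Linearity in one slot; it is applied to the four slots in turn, from the last to
    the first.\<close>
  have lin: "f v \<in> gr_field N"
    if v: "v \<in> rational_span N" and f: "\<And>i. i \<in> N \<Longrightarrow> f (zcol i) \<in> gr_field N"
      "\<And>p q. dim_vec p = 4 \<Longrightarrow> dim_vec q = 4 \<Longrightarrow> f (p + q) = f p + f q"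
      "\<And>x p. dim_vec p = 4 \<Longrightarrow> f (x \<cdot>\<^sub>v p) = x * f p" for f v
  proof -
    obtain x y z i j k where ijk: "v = x \<cdot>\<^sub>v zcol i + y \<cdot>\<^sub>v zcol j + z \<cdot>\<^sub>v zcol k"
      "{x, y, z} \<subseteq> gr_field N" "{i, j, k} \<subseteq> N"
      using v unfolding rational_span_def mem_Collect_eq by (elim exE conjE) (rule that)
    have "f v = x * f (zcol i) + y * f (zcol j) + z * f (zcol k)"
      unfolding ijk(1) by (simp add: f(2,3))
    also have "\<dots> \<in> gr_field N"
      using ijk(2,3) by (intro gr_field_closed(2,3) f(1)) simp_all
    finally show ?thesis .
  qed
  have 4: "bracket (zcol i) (zcol j) (zcol k) v\<^sub>4 \<in> gr_field N" if "{i, j, k} \<subseteq> N" for i j k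
  proof (rule lin[OF assms(4)])
    show "bracket (zcol i) (zcol j) (zcol k) (zcol l) \<in> gr_field N" if "l \<in> N" for l
      unfolding plucker_bracket[symmetric] using that \<open>{i, j, k} \<subseteq> N\<close> by (intro plucker_gr_field) simp
  qed (simp_all add: bracket_linear)
  have 3: "bracket (zcol i) (zcol j) v\<^sub>3 v\<^sub>4 \<in> gr_field N" if "{i, j} \<subseteq> N" for i j
    by (rule lin[OF assms(3), of "\<lambda>v. bracket (zcol i) (zcol j) v v\<^sub>4"], rule 4)
      (use that in \<open>simp_all add: bracket_linear\<close>)
  have 2: "bracket (zcol i) v\<^sub>2 v\<^sub>3 v\<^sub>4 \<in> gr_field N" if "i \<in> N" for i
    by (rule lin[OF assms(2), of "\<lambda>v. bracket (zcol i) v v\<^sub>3 v\<^sub>4"], rule 3)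
      (use that in \<open>simp_all add: bracket_linear\<close>)
  show ?thesis
    by (rule lin[OF assms(1), of "\<lambda>v. bracket v v\<^sub>2 v\<^sub>3 v\<^sub>4"], rule 2) (simp_all add: bracket_linear)
qed

lemma spurion_F_gr_field:
  assumes "9 \<le> n" "i \<in> {1..9}"
  shows "spurion_F i \<in> gr_field {1..n}"
proof -
  have "i \<in> {1, 2, 3, 4, 5, 6, 7, 8, 9}"
    using assms(2) by auto
  then show ?thesis
    using assms(1)
    by (elim insertE; simp only: spurion_F_brackets empty_iff)
      (intro gr_field_closed gr_field_closed' plucker_gr_field; simp)+
qed

lemma spurion_columns_span:
  assumes "9 \<le> n" "j \<in> {1..n}"
  shows "spurion_columns j \<in> rational_span {1..n}"
proof -
  note F = spurion_F_gr_field[OF assms(1)]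
  have I: "x \<cdot>\<^sub>v zcol i + y \<cdot>\<^sub>v zcol j + z \<cdot>\<^sub>v zcol k \<in> rational_span {1..n}"
    if "x \<in> gr_field {1..n}" "y \<in> gr_field {1..n}" "z \<in> gr_field {1..n}" "i \<in> {1..n}" "j \<in> {1..n}" "k \<in> {1..n}"
    for x y z i j k
    unfolding rational_span_def mem_Collect_eq
    by (rule exI[of _ x], rule exI[of _ y], rule exI[of _ z], rule exI[of _ i], rule exI[of _ j], rule exI[of _ k])
      (use that in simp)
  have eq: "spurion_columns 2 = 1 \<cdot>\<^sub>v zcol 2 + (- (spurion_F 1 / spurion_F 2)) \<cdot>\<^sub>v zcol 1 + 0 \<cdot>\<^sub>v zcol 1"
    "spurion_columns 7 = 1 \<cdot>\<^sub>v zcol 7 + (- (spurion_F 8 / spurion_F 7)) \<cdot>\<^sub>v zcol 8 + (spurion_F 9 / spurion_F 7) \<cdot>\<^sub>v zcol 9"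
    "spurion_columns 8 = 1 \<cdot>\<^sub>v zcol 8 + (- (spurion_F 9 / spurion_F 8)) \<cdot>\<^sub>v zcol 9 + 0 \<cdot>\<^sub>v zcol 1"
    "zcol j = 1 \<cdot>\<^sub>v zcol j + 0 \<cdot>\<^sub>v zcol j + 0 \<cdot>\<^sub>v zcol j"
    unfolding spurion_columns_2 spurion_columns_7(1) spurion_columns_8 by (rule eq_vecI; simp)+
  consider "j = 2" | "j = 7" | "j = 8" | "j \<notin> {2, 7, 8}"
    by blast
  then show ?thesis
  proof cases
    case 1
    show ?thesis
      unfolding 1 eq(1) using assms by (intro I gr_field_closed' F) auto
  next
    case 2
    show ?thesis
      unfolding 2 eq(2) using assms by (intro I gr_field_closed' F) auto
  next
    case 3
    show ?thesis
      unfolding 3 eq(3) using assms by (intro I gr_field_closed' F) auto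
  next
    case 4
    show ?thesis
      unfolding spurion_columns_other[OF 4] by (subst eq(4)) (use assms in \<open>intro I gr_field_closed'\<close>)
  qed
qed

lemma algebra_hom_spurion_promotion:
  assumes "9 \<le> n"
  shows "algebra_hom spurion_promotion (gr_field (spurion_index_set n)) (gr_field {1..n})"
proof -
  interpret partial_field_hom spurion_promotion "entry_field (spurion_index_set n)"
    by (rule partial_field_hom_spurion)
  have N: "spurion_index_set n \<subseteq> {1..n}"
    using assms by (auto simp: spurion_index_set_def)
  note K = subsetD[OF gr_field_subset_entry_field[of "spurion_index_set n"]]
  have "spurion_promotion x \<in> gr_field {1..n}" if "x \<in> gr_field (spurion_index_set n)" for x
    using that unfolding gr_field_def[of "spurion_index_set n"]
  proof induction
    case (gen x)
    then obtain js where js: "x = plucker js" "length js = 4" "set js \<subseteq> spurion_index_set n"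
      by blast
    then obtain a b c d where "js = [a, b, c, d]"
      using length_4_cases by blast
    then show ?case
      using js N spurion_columns_span[OF assms]
      by (auto simp: spurion_promotion_bracket intro!: bracket_rational_span)
  next
    case (inverse x)
    then show ?case
      using K[of x, unfolded gr_field_def] by (simp add: f_inverse gr_field_closed)
  next
    case (add x y)
    then show ?case
      using K[of x, unfolded gr_field_def] K[of y, unfolded gr_field_def] by (simp add: f_add gr_field_closed)
  next
    case (mult x y)
    then show ?case
      using K[of x, unfolded gr_field_def] K[of y, unfolded gr_field_def] by (simp add: f_mult gr_field_closed)
  qed (simp add: f_const gr_field_closed)
  then show ?thesis
    unfolding algebra_hom_def by (intro conjI allI ballI image_subsetI f_const f_add f_mult K)
qed

section \<open>The spurion promotion as a quasi-cluster homomorphism\<close>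

lemma spurion_seed_simps:
  "vertices (spurion_seed n) = vertices (rectangles_seed {1..n})"
  "frozen (spurion_seed n) = frozen (rectangles_seed {1..n}) \<union> spurion_frozen_vertices"
  "cluster (spurion_seed n) = cluster (spurion_step n 11)"
  "arrows (spurion_seed n) = arrows (spurion_step n 11)"
proof -
  have "spurion_seed n = freeze spurion_frozen_vertices (spurion_step n 11)"
    by (simp add: spurion_seed_def spurion_step_def spurion_mutations_def)
  then show "vertices (spurion_seed n) = vertices (rectangles_seed {1..n})"
    "frozen (spurion_seed n) = frozen (rectangles_seed {1..n}) \<union> spurion_frozen_vertices"
    "cluster (spurion_seed n) = cluster (spurion_step n 11)"
    "arrows (spurion_seed n) = arrows (spurion_step n 11)"
    using spurion_step_vertices[of n 11] by (simp_all add: freeze_def)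
qed

lemma cluster_spurion_seed:
  assumes n: "9 \<le> n"
  defines "y \<equiv> cluster (spurion_seed n)"
  shows "y (V 1 5) = spurion_F 5" "y (V 1 6) = plucker [1, 2, 3, 6]" "y (V 1 7) = plucker [1, 2, 3, 7]"
    "y (V 1 8) = spurion_F 8" "y (V 2 5) = spurion_F 2" "y (V 2 6) = spurion_F 6"
    "y (V 2 7) = spurion_F 4" "y (V 2 8) = spurion_F 7" "y (V 3 5) = spurion_F 1"
    "y (V 3 6) = plucker [3, 7, 8, 9]" "y (V 3 7) = spurion_F 3" "y (V 3 8) = spurion_F 9"
    "9 \<le> c \<Longrightarrow> y (V r c) = cluster (rectangles_seed {1..n}) (V r c)"
  unfolding y_def spurion_seed_simps cluster_spurion_step[OF n]
  using cluster_rectangles_interval(1)[of 6 n] cluster_rectangles_interval(1)[of 7 n] n by simp_all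

lemma spurion_frozen_vertices_eq:
  "spurion_frozen_vertices = {V 1 5, V 1 6, V 1 7, V 1 8, V 2 5, V 2 6, V 2 7, V 2 8, V 3 5, V 3 6, V 3 7, V 3 8}"
proof -
  have "{1..3} = {1, 2, 3::nat}" "{5..8} = {5, 6, 7, 8::nat}"
    by auto
  moreover have "spurion_frozen_vertices = (\<lambda>(r, c). V r c) ` ({1..3} \<times> {5..8})"
    by (auto simp: spurion_frozen_vertices_def)
  ultimately show ?thesis
    by (simp add: insert_commute)
qed

lemma cluster_spurion_frozen_vertices:
  assumes "9 \<le> n"
  shows "cluster (spurion_seed n) ` spurion_frozen_vertices =
    {plucker [1, 2, 3, 6], plucker [1, 2, 3, 7], plucker [3, 7, 8, 9]} \<union> spurion_F ` {1..9}"
proof -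
  have "{1..9} = {1, 2, 3, 4, 5, 6, 7, 8, 9::nat}"
    by auto
  then have F: "spurion_F ` {1..9} = {spurion_F 1, spurion_F 2, spurion_F 3, spurion_F 4, spurion_F 5,
      spurion_F 6, spurion_F 7, spurion_F 8, spurion_F 9}"
    by (simp only: image_insert image_empty)
  show ?thesis
    unfolding spurion_frozen_vertices_eq F image_insert image_empty cluster_spurion_seed(1-12)[OF assms]
    by blast
qed

lemma sorted_list_spurion_index_set:
  assumes "9 \<le> n"
  shows "sorted_list_of_set (spurion_index_set n) = [1, 2] @ [7..<Suc n]"
proof -
  have "spurion_index_set n = set ([1, 2] @ [7..<Suc n])"
    by (auto simp: spurion_index_set_def)
  moreover have "sorted ([1, 2] @ [7..<Suc n])" "distinct ([1, 2] @ [7..<Suc n])"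
    by (auto simp: sorted_append simp del: upt_Suc)
  ultimately show ?thesis
    by (simp only: sorted_list_of_set.idem_if_sorted_distinct)
qed

lemma card_spurion_index_set:
  assumes "9 \<le> n"
  shows "card (spurion_index_set n) = n - 4"
  using arg_cong[OF sorted_list_spurion_index_set[OF assms], of length] assms
  by (simp del: upt_Suc)

text \<open>From position 3 on, position \<open>i\<close> carries the label \<open>i + 4\<close>,
  which shifts the column indices by 4. Only at \<open>(4, 5)\<close> does one of the last
  \<open>r\<close> indices fall below the gap between the labels 2 and 7.\<close>

lemma cluster_rectangles_spurion_index_set:
  assumes n: "9 \<le> n"
  defines "x \<equiv> cluster (rectangles_seed (spurion_index_set n))"
  shows "x V\<^sub>0 = plucker [1, 2, 7, 8]" "x (V 4 5) = plucker [2, 7, 8, 9]"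
    "5 \<le> c \<Longrightarrow> c + 4 \<le> n \<Longrightarrow> x (V 1 c) = plucker [1, 2, 7, c + 4]"
    "5 \<le> c \<Longrightarrow> c + 4 \<le> n \<Longrightarrow> x (V 2 c) = plucker [1, 2, c + 4 - 1, c + 4]"
    "5 \<le> c \<Longrightarrow> c + 4 \<le> n \<Longrightarrow> x (V 3 c) = plucker [1, c + 4 - 2, c + 4 - 1, c + 4]"
    "6 \<le> c \<Longrightarrow> c + 4 \<le> n \<Longrightarrow> x (V 4 c) = plucker [c + 4 - 3, c + 4 - 2, c + 4 - 1, c + 4]"
proof -
  let ?a = "(!) (sorted_list_of_set (spurion_index_set n))"
  have nth: "?a (i - 1) = (if i = 1 then 1 else if i = 2 then 2 else i + 4)"
    if "1 \<le> i" "i + 4 \<le> n" for i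
    unfolding sorted_list_spurion_index_set[OF n] using that
    by (auto simp: nth_append nth_Cons' simp del: upt_Suc)
  have a: "?a (1 - 1) = 1" "?a (2 - 1) = 2"
    "?a (3 - 1) = 7" "?a (4 - 1) = 8"
    "?a (5 - 1) = 9"
    by (subst nth; use n in simp)+
  have b: "?a (c - 1) = c + 4"
    "?a (c - 1 - 1) = c + 4 - 1"
    "?a (c - 2 - 1) = c + 4 - 2"
    if "5 \<le> c" "c + 4 \<le> n"
    by (subst nth; use that in auto)+
  have b': "?a (c - 3 - 1) = c + 4 - 3" if "6 \<le> c" "c + 4 \<le> n"
    by (subst nth; use that in auto)
  show "x V\<^sub>0 = plucker [1, 2, 7, 8]"
    unfolding x_def rectangles_seed_simps list.map a ..
  \<comment> \<open>Position 2 has the label 2, not 6.\<close>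
  have "rect_indices 4 5 = [2, 3, 4, 5]"
    using rect_indices_simps(4)[of 5] by simp
  then show "x (V 4 5) = plucker [2, 7, 8, 9]"
    unfolding x_def rectangles_seed_simps by (simp only: list.map a)
  show "x (V 1 c) = plucker [1, 2, 7, c + 4]" "x (V 2 c) = plucker [1, 2, c + 4 - 1, c + 4]"
    "x (V 3 c) = plucker [1, c + 4 - 2, c + 4 - 1, c + 4]" if c: "5 \<le> c" "c + 4 \<le> n"
    unfolding x_def rectangles_seed_simps rect_indices_simps[OF c(1)] list.map a b[OF c] by (rule refl)+
  show "x (V 4 c) = plucker [c + 4 - 3, c + 4 - 2, c + 4 - 1, c + 4]" if c: "6 \<le> c" "c + 4 \<le> n"
  proof -
    have c5: "5 \<le> c"
      using c(1) by simp
    show ?thesis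
      unfolding x_def rectangles_seed_simps rect_indices_simps[OF c5] list.map b[OF c5 c(2)] b'[OF c] ..
  qed
qed

lemma spurion_promotion_cluster:
  assumes n: "9 \<le> n"
  defines "x \<equiv> cluster (rectangles_seed (spurion_index_set n))" and "y \<equiv> cluster (spurion_seed n)"
  shows "spurion_promotion (x V\<^sub>0) = y (V 3 7) * y (V 1 7) / y (V 1 8)"
    "spurion_promotion (x (V 4 5)) = y (V 3 7) / y (V 2 5) * y (V 3 6)"
    "5 \<le> c \<Longrightarrow> c + 4 \<le> n \<Longrightarrow> spurion_promotion (x (V 1 c)) = y (V 3 7) / y (V 2 8) * y (V 1 (c + 4))"
    "5 \<le> c \<Longrightarrow> c + 4 \<le> n \<Longrightarrow> spurion_promotion (x (V 2 c)) = y (V 2 (c + 4))"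
    "5 \<le> c \<Longrightarrow> c + 4 \<le> n \<Longrightarrow> spurion_promotion (x (V 3 c)) = y (V 3 (c + 4))"
    "6 \<le> c \<Longrightarrow> c + 4 \<le> n \<Longrightarrow> spurion_promotion (x (V 4 c)) = y (V 4 (c + 4))"
proof -
  note X = cluster_rectangles_spurion_index_set[OF n, folded x_def]
  note Y = cluster_spurion_seed[OF n, folded y_def]
  show "spurion_promotion (x V\<^sub>0) = y (V 3 7) * y (V 1 7) / y (V 1 8)"
    "spurion_promotion (x (V 4 5)) = y (V 3 7) / y (V 2 5) * y (V 3 6)"
    unfolding X Y spurion_promotion_plucker by (rule refl)+
  show "spurion_promotion (x (V 1 c)) = y (V 3 7) / y (V 2 8) * y (V 1 (c + 4))"
    "spurion_promotion (x (V 2 c)) = y (V 2 (c + 4))" "spurion_promotion (x (V 3 c)) = y (V 3 (c + 4))"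
    if c: "5 \<le> c" "c + 4 \<le> n"
  proof -
    have c': "9 \<le> c + 4" "5 \<le> c + 4"
      using c by simp_all
    show "spurion_promotion (x (V 1 c)) = y (V 3 7) / y (V 2 8) * y (V 1 (c + 4))"
      "spurion_promotion (x (V 2 c)) = y (V 2 (c + 4))" "spurion_promotion (x (V 3 c)) = y (V 3 (c + 4))"
      unfolding X(3-5)[OF c] Y(8,11) Y(13)[OF c'(1)] cluster_rectangles_interval[OF c'(2) c(2)]
        spurion_promotion_plucker(3-5)[OF c'(1)] by (rule refl)+
  qed
  show "spurion_promotion (x (V 4 c)) = y (V 4 (c + 4))" if c: "6 \<le> c" "c + 4 \<le> n"
  proof -
    have c': "10 \<le> c + 4" "9 \<le> c + 4" "5 \<le> c + 4"
      using c by simp_all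
    show ?thesis
      unfolding X(6)[OF c] Y(13)[OF c'(2)] cluster_rectangles_interval[OF c'(3) c(2)]
        spurion_promotion_plucker(6)[OF c'(1)] ..
  qed
qed

section \<open>Exchange ratios of the two seeds\<close>

definition rect_targets :: "nat \<Rightarrow> nat \<Rightarrow> vertex list" where
  "rect_targets r c = [V r (c + 1), V (r + 1) c] @ (if 1 < r \<and> 5 < c then [V (r - 1) (c - 1)] else [])"

definition rect_sources :: "nat \<Rightarrow> nat \<Rightarrow> vertex list" where
  "rect_sources r c = (if 5 < c then [V r (c - 1)] else if r = 1 then [V\<^sub>0] else []) @
     (if 1 < r then [V (r - 1) c] else []) @ [V (r + 1) (c + 1)]"

lemma rect_arrow_neighbours:
  assumes "1 \<le> r" "r \<le> 3" "5 \<le> c" "c < m"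
  shows "rect_arrow m (V r c) v \<longleftrightarrow> v \<in> set (rect_targets r c)"
    "rect_arrow m v (V r c) \<longleftrightarrow> v \<in> set (rect_sources r c)"
proof -
  have I: "rect_arrow m u v"
    if "1 \<le> r" "r \<le> 3" "5 \<le> c" "c < m" "u = V r c \<and> v = V r (c + 1) \<or>
      u = V r c \<and> v = V (r + 1) c \<or> u = V (r + 1) (c + 1) \<and> v = V r c" for r c u v
    using that unfolding rect_arrow_def by blast
  have "rect_arrow m (V r c) v \<longleftrightarrow> v = V r (c + 1) \<or> v = V (r + 1) c \<or> 1 < r \<and> 5 < c \<and> v = V (r - 1) (c - 1)"
    using assms I[of r c "V r c" v] I[of "r - 1" "c - 1" "V r c" v] by (auto simp: rect_arrow_def)
  then show "rect_arrow m (V r c) v \<longleftrightarrow> v \<in> set (rect_targets r c)"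
    by (auto simp: rect_targets_def)
  have "rect_arrow m v (V r c) \<longleftrightarrow> r = 1 \<and> c = 5 \<and> v = V\<^sub>0 \<or> 5 < c \<and> v = V r (c - 1) \<or>
      1 < r \<and> v = V (r - 1) c \<or> v = V (r + 1) (c + 1)"
    using assms I[of r "c - 1" v "V r c"] I[of "r - 1" c v "V r c"] I[of r c v "V r c"]
    by (auto simp: rect_arrow_def)
  then show "rect_arrow m v (V r c) \<longleftrightarrow> v \<in> set (rect_sources r c)"
    using assms by (auto simp: rect_sources_def)
qed

lemma distinct_rect_neighbours: "distinct (rect_targets r c)" "distinct (rect_sources r c)"
  by (auto simp: rect_targets_def rect_sources_def)

text \<open>Only the differences of multiplicities matter, so the two lists may overlap. This
  happens at \<open>(3, 9)\<close>, where \<open>(4, 9)\<close> occurs in both.\<close>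

lemma exchange_ratio_lists:
  assumes "finite (vertices \<Sigma>)" "\<And>v. v \<in> vertices \<Sigma> \<Longrightarrow> cluster \<Sigma> v \<noteq> 0"
    and "set A \<subseteq> vertices \<Sigma>" "set B \<subseteq> vertices \<Sigma>"
    and "\<And>j. net_arrows \<Sigma> v j = int (count_list A j) - int (count_list B j)"
  shows "exchange_ratio \<Sigma> v = prod_list (map (cluster \<Sigma>) A) / prod_list (map (cluster \<Sigma>) B)"
proof -
  have "exchange_ratio \<Sigma> v = (\<Prod>j\<in>vertices \<Sigma>. cluster \<Sigma> j powi (int (count_list A j) - int (count_list B j)))"
    using assms by (simp add: exchange_ratio_net_arrows)
  also have "\<dots> = (\<Prod>j\<in>vertices \<Sigma>. cluster \<Sigma> j ^ count_list A j / cluster \<Sigma> j ^ count_list B j)"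
    using assms(2) by (intro prod.cong) (simp_all add: power_int_diff)
  finally show ?thesis
    using prod_count_list[OF assms(1,3), of "cluster \<Sigma>"] prod_count_list[OF assms(1,4), of "cluster \<Sigma>"]
    by (simp add: prod_dividef)
qed

lemma spurion_quiver_near:
  "targets (V 1 9) (spurion_quiver 11) = [V 1 8]" "sources (V 1 9) (spurion_quiver 11) = [V 1 7, V 2 8]"
  "targets (V 2 9) (spurion_quiver 11) = [V 2 8]" "sources (V 2 9) (spurion_quiver 11) = [V 3 7]"
  "targets (V 3 9) (spurion_quiver 11) = [V 3 7, V 3 6]" "sources (V 3 9) (spurion_quiver 11) = [V 4 9, V 2 5]"
  unfolding spurion_quiver_11 by code_simp+

lemma spurion_quiver_far:
  "(u, v) \<in> set (spurion_quiver 11) \<Longrightarrow> far u \<Longrightarrow> far v \<Longrightarrow> u = V 4 9"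
  "(V r c, v) \<in> set (spurion_quiver 11) \<Longrightarrow> c \<le> 9" "(v, V r c) \<in> set (spurion_quiver 11) \<Longrightarrow> c \<le> 9"
proof -
  have "list_all (\<lambda>(u, v). (far u \<and> far v \<longrightarrow> u = V 4 9) \<and>
      (case u of V\<^sub>0 \<Rightarrow> True | V r c \<Rightarrow> c \<le> 9) \<and> (case v of V\<^sub>0 \<Rightarrow> True | V r c \<Rightarrow> c \<le> 9)) (spurion_quiver 11)"
    unfolding spurion_quiver_11 far_def by code_simp
  note * = this[unfolded list_all_iff, rule_format]
  show "(u, v) \<in> set (spurion_quiver 11) \<Longrightarrow> far u \<Longrightarrow> far v \<Longrightarrow> u = V 4 9"
    using *[of "(u, v)"] by simp
  show "(V r c, v) \<in> set (spurion_quiver 11) \<Longrightarrow> c \<le> 9"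
    using *[of "(V r c, v)"] by simp
  show "(v, V r c) \<in> set (spurion_quiver 11) \<Longrightarrow> c \<le> 9"
    using *[of "(v, V r c)"] by simp
qed

lemma spurion_quiver_beyond:
  assumes "10 \<le> c"
  shows "targets (V r c) (spurion_quiver 11) = []" "sources (V r c) (spurion_quiver 11) = []"
proof -
  have "fst a \<noteq> V r c" "snd a \<noteq> V r c" if "a \<in> set (spurion_quiver 11)" for a
  proof -
    have "fst a = V r c \<Longrightarrow> c \<le> 9" "snd a = V r c \<Longrightarrow> c \<le> 9"
      using spurion_quiver_far(2)[of r c "snd a"] spurion_quiver_far(3)[of "fst a" r c] that
      by (cases a; simp)+
    then show "fst a \<noteq> V r c" "snd a \<noteq> V r c"
      using assms by auto
  qed
  then show "targets (V r c) (spurion_quiver 11) = []" "sources (V r c) (spurion_quiver 11) = []"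
    by (simp_all add: targets_def sources_def filter_empty_conv)
qed

lemma arrows_spurion_seed:
  assumes "9 \<le> n"
  shows "arrows (spurion_seed n) u v = nat (net_of (spurion_quiver 11) u v + far_net n u v)"
  using spurion_step_arrows[OF assms order_refl] unfolding arrows_given_def spurion_seed_simps by blast

lemma seed_ok_spurion_seed:
  assumes "9 \<le> n"
  shows "seed_ok (spurion_seed n)"
proof -
  have "seed_ok (fold mutate ks (rectangles_seed {1..n}))" for ks
    by (induction ks rule: rev_induct) (auto intro: seed_ok_mutate seed_ok_rectangles)
  then have "seed_ok (spurion_step n 11)"
    by (simp add: spurion_step_def)
  moreover have "spurion_frozen_vertices \<subseteq> vertices (rectangles_seed {1..n})"
    using assms by (auto simp: spurion_frozen_vertices_def rectangles_seed_simps)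
  ultimately show ?thesis
    by (auto simp: seed_ok_def spurion_seed_simps spurion_step_vertices)
qed

lemma seed_positive_spurion_seed:
  "9 \<le> n \<Longrightarrow> seed_positive vandermonde_positive (spurion_seed n)"
  using seed_positive_spurion_step[of n 11]
  by (simp add: seed_positive_def spurion_seed_simps spurion_step_vertices)

lemma mutable_rectangles:
  "mutable (rectangles_seed N) = {V r c | r c. 1 \<le> r \<and> r \<le> 3 \<and> 5 \<le> c \<and> c < card N}"
  by (auto simp: mutable_def rectangles_seed_simps)

lemma mutable_spurion_seed:
  "mutable (spurion_seed n) = {V r c | r c. 1 \<le> r \<and> r \<le> 3 \<and> 9 \<le> c \<and> c < n}"
  by (auto simp: mutable_def rectangles_seed_simps spurion_seed_simps spurion_frozen_vertices_def)

lemma exchange_ratio_rectangles: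
  assumes "finite N" "5 \<le> card N" "1 \<le> r" "r \<le> 3" "5 \<le> c" "c < card N"
  defines "x \<equiv> cluster (rectangles_seed N)"
  shows "exchange_ratio (rectangles_seed N) (V r c) =
    prod_list (map x (rect_targets r c)) / prod_list (map x (rect_sources r c))"
  unfolding x_def
proof (rule exchange_ratio_lists)
  show "cluster (rectangles_seed N) v \<noteq> 0" if "v \<in> vertices (rectangles_seed N)" for v
    using seed_positive_nonzero[OF positive_cone_vandermonde seed_positive_rectangles[OF assms(1,2)] that] .
  show "set (rect_targets r c) \<subseteq> vertices (rectangles_seed N)" "set (rect_sources r c) \<subseteq> vertices (rectangles_seed N)"
    using assms(3-6) by (auto simp: rect_targets_def rect_sources_def rectangles_seed_simps)
  show "net_arrows (rectangles_seed N) (V r c) j =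
      int (count_list (rect_targets r c) j) - int (count_list (rect_sources r c) j)" for j
    by (simp add: net_arrows_def rectangles_seed_simps rect_arrow_neighbours[OF assms(3-6)]
        count_list_distinct distinct_rect_neighbours)
qed (rule finite_rectangles)

lemma exchange_ratio_spurion_seed:
  assumes n: "9 \<le> n" and rc: "1 \<le> r" "r \<le> 3" "9 \<le> c" "c < n"
  defines "y \<equiv> cluster (spurion_seed n)"
  shows "exchange_ratio (spurion_seed n) (V r c) =
    prod_list (map y (targets (V r c) (spurion_quiver 11) @ filter far (rect_targets r c))) /
    prod_list (map y (sources (V r c) (spurion_quiver 11) @ filter far (rect_sources r c)))"
  unfolding y_def
proof (rule exchange_ratio_lists)
  show "finite (vertices (spurion_seed n))"
    using finite_rectangles by (simp add: spurion_seed_simps)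
  show "cluster (spurion_seed n) v \<noteq> 0" if "v \<in> vertices (spurion_seed n)" for v
    using seed_positive_nonzero[OF positive_cone_vandermonde seed_positive_spurion_seed[OF n] that] .
  have "set (targets (V r c) (spurion_quiver 11)) \<union> set (sources (V r c) (spurion_quiver 11)) \<subseteq> vertices (spurion_seed n)"
  proof (cases "10 \<le> c")
    case True
    then show ?thesis
      by (simp add: spurion_quiver_beyond)
  next
    case False
    then have "c = 9" "r = 1 \<or> r = 2 \<or> r = 3"
      using rc by auto
    then show ?thesis
      using n by (elim disjE) (auto simp only: spurion_quiver_near, auto simp: spurion_seed_simps rectangles_seed_simps)
  qed
  moreover have "set (rect_targets r c) \<subseteq> vertices (spurion_seed n)" "set (rect_sources r c) \<subseteq> vertices (spurion_seed n)"
    using rc by (auto simp: rect_targets_def rect_sources_def rectangles_seed_simps spurion_seed_simps)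
  ultimately show "set (targets (V r c) (spurion_quiver 11) @ filter far (rect_targets r c)) \<subseteq> vertices (spurion_seed n)"
    "set (sources (V r c) (spurion_quiver 11) @ filter far (rect_sources r c)) \<subseteq> vertices (spurion_seed n)"
    by auto
  \<comment> \<open>The positive parts of \<open>p\<close> and \<open>- p\<close> differ by
    \<open>p\<close>, so the skew-symmetric matrix is recovered from the truncated numbers of
    arrows.\<close>
  have net: "int (nat p) - int (nat q) = p" if "q = - p" for p q
    using that by simp
  fix j
  have "net_arrows (spurion_seed n) (V r c) j = net_of (spurion_quiver 11) (V r c) j + far_net n (V r c) j"
    unfolding net_arrows_def arrows_spurion_seed[OF n]
    using net_of_antisym[of "spurion_quiver 11" j "V r c"] by (intro net) (simp add: far_net_def)
  also have "far_net n (V r c) j =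
      int (count_list (filter far (rect_targets r c)) j) - int (count_list (filter far (rect_sources r c)) j)"
  proof -
    have c5: "5 \<le> c"
      using rc(3) by simp
    show ?thesis
      using rc(3) unfolding far_net_def rect_arrow_neighbours[OF rc(1,2) c5 rc(4)]
      by (simp add: count_list_distinct distinct_rect_neighbours) (simp add: far_def)
  qed
  finally show "net_arrows (spurion_seed n) (V r c) j =
      int (count_list (targets (V r c) (spurion_quiver 11) @ filter far (rect_targets r c)) j) -
      int (count_list (sources (V r c) (spurion_quiver 11) @ filter far (rect_sources r c)) j)"
    by (simp add: net_of_def count_list_sources count_list_targets)
qed

definition shift :: "vertex \<Rightarrow> vertex" where
  "shift v = (case v of V\<^sub>0 \<Rightarrow> V\<^sub>0 | V r c \<Rightarrow> V r (c + 4))"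

text \<open>Mutable vertices lie in rows 1 to 3, which rules out the list arrow starting at
  \<open>(4, 9)\<close>. The remaining arrows are those of the rectangles quiver, whose pattern is
  invariant under translation of columns; a neighbour in column 8 is not the shift of a mutable
  vertex.\<close>

lemma arrows_shift:
  assumes n: "9 \<le> n" and u: "u \<in> mutable (rectangles_seed (spurion_index_set n))"
    and v: "v \<in> mutable (rectangles_seed (spurion_index_set n))"
  shows "arrows (rectangles_seed (spurion_index_set n)) u v = arrows (spurion_seed n) (shift u) (shift v)"
proof -
  obtain r c where rc: "u = V r c" "1 \<le> r" "r \<le> 3" "5 \<le> c" "c < n - 4"
    using u unfolding mutable_rectangles card_spurion_index_set[OF n] by blast
  obtain r' c' where rc': "v = V r' c'" "1 \<le> r'" "r' \<le> 3" "5 \<le> c'" "c' < n - 4"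
    using v unfolding mutable_rectangles card_spurion_index_set[OF n] by blast
  have "rect_arrow (n - 4) u v \<longleftrightarrow> rect_arrow n (shift u) (shift v)"
  proof -
    have c: "5 \<le> c + 4" "c + 4 < n"
      using rc by auto
    show ?thesis
      unfolding rc(1) rc'(1) shift_def vertex.case rect_arrow_neighbours(1)[OF rc(2-5)] rect_arrow_neighbours(1)[OF rc(2,3) c]
      using rc rc' by (auto simp: rect_targets_def)
  qed
  moreover have "(shift u, shift v) \<notin> set (spurion_quiver 11)" "(shift v, shift u) \<notin> set (spurion_quiver 11)"
    using spurion_quiver_far(1)[of "shift u" "shift v"] spurion_quiver_far(1)[of "shift v" "shift u"] rc rc'
    by (auto simp: shift_def far_def)
  then have "arrows (spurion_seed n) (shift u) (shift v) = nat (far_net n (shift u) (shift v))"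
    unfolding arrows_spurion_seed[OF n] by (simp add: net_of_def)
  moreover have "far (shift u)" "far (shift v)"
    using rc rc' by (simp_all add: shift_def far_def)
  ultimately show ?thesis
    using rect_arrow_acyclic[of n "shift u" "shift v"]
    by (auto simp: rectangles_seed_simps card_spurion_index_set[OF n] far_net_def)
qed

lemma shift_bij:
  assumes n: "9 \<le> n"
  shows "bij_betw shift (mutable (rectangles_seed (spurion_index_set n))) (mutable (spurion_seed n))"
proof (rule bij_betw_imageI)
  show "inj_on shift (mutable (rectangles_seed (spurion_index_set n)))"
    unfolding mutable_rectangles by (auto simp: inj_on_def shift_def)
  have "V r c \<in> shift ` mutable (rectangles_seed (spurion_index_set n))" if "1 \<le> r" "r \<le> 3" "9 \<le> c" "c < n" for r c
    unfolding mutable_rectangles card_spurion_index_set[OF n] using that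
    by (intro image_eqI[of _ _ "V r (c - 4)"]) (auto simp: shift_def)
  then show "shift ` mutable (rectangles_seed (spurion_index_set n)) = mutable (spurion_seed n)"
    unfolding mutable_rectangles mutable_spurion_seed card_spurion_index_set[OF n] by (auto simp: shift_def)
qed

lemma cluster_rectangles_gr_field:
  assumes "finite N" "5 \<le> card N" "v \<in> vertices (rectangles_seed N)"
  shows "cluster (rectangles_seed N) v \<in> gr_field N"
proof -
  let ?a = "\<lambda>i. sorted_list_of_set N ! (i - 1)"
  have a: "?a i \<in> N" if "1 \<le> i" "i \<le> card N" for i
    using that assms(1) nth_mem[of "i - 1" "sorted_list_of_set N"] by simp
  have G: "plucker (map ?a [i, j, k, l]) \<in> gr_field N" if "{i, j, k, l} \<subseteq> {1..card N}" for i j k l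
    using that a by (auto intro!: plucker_gr_field)
  show ?thesis
  proof (cases v)
    case V\<^sub>0
    then show ?thesis
      unfolding V\<^sub>0 rectangles_seed_simps using assms(2) by (intro G) auto
  next
    case (V r c)
    with assms(3) have "r = 1 \<or> r = 2 \<or> r = 3 \<or> r = 4" and c: "5 \<le> c" "c \<le> card N"
      by (auto simp: rectangles_seed_simps)
    then show ?thesis
      unfolding V rectangles_seed_simps
      by (elim disjE) (simp_all only: rect_indices_simps[OF c(1)], (rule G; auto)+)
  qed
qed

lemma (in partial_field_hom) prod_list_K:
  assumes "\<And>v. v \<in> set A \<Longrightarrow> g v \<in> K"
  shows "prod_list (map g A) \<in> K" "f (prod_list (map g A)) = prod_list (map (\<lambda>v. f (g v)) A)"
proof -
  have "prod_list (map g A) \<in> K \<and> f (prod_list (map g A)) = prod_list (map (\<lambda>v. f (g v)) A)"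
    using assms by (induction A) (auto simp: one_K f_one mult_K f_mult)
  then show "prod_list (map g A) \<in> K" "f (prod_list (map g A)) = prod_list (map (\<lambda>v. f (g v)) A)"
    by auto
qed

lemma spurion_promotion_exchange_ratio:
  assumes n: "9 \<le> n" and v: "v \<in> mutable (rectangles_seed (spurion_index_set n))"
  shows "spurion_promotion (exchange_ratio (rectangles_seed (spurion_index_set n)) v) =
    exchange_ratio (spurion_seed n) (shift v)"
proof -
  interpret partial_field_hom spurion_promotion "entry_field (spurion_index_set n)"
    by (rule partial_field_hom_spurion)
  let ?\<Sigma> = "rectangles_seed (spurion_index_set n)"
  define x where "x = cluster ?\<Sigma>"
  define y where "y = cluster (spurion_seed n)"
  have N: "finite (spurion_index_set n)" "5 \<le> card (spurion_index_set n)"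
    using n by (simp_all add: card_spurion_index_set) (simp add: spurion_index_set_def)
  obtain r c where rc: "v = V r c" "1 \<le> r" "r \<le> 3" "5 \<le> c" "c < card (spurion_index_set n)"
    using v unfolding mutable_rectangles by blast
  have c: "9 \<le> c + 4" "c + 4 < n"
    using rc by (simp_all add: card_spurion_index_set[OF n])
  have K: "x w \<in> entry_field (spurion_index_set n)" if "w \<in> vertices ?\<Sigma>" for w
    using cluster_rectangles_gr_field[OF N that] gr_field_subset_entry_field unfolding x_def by blast
  have sub: "set (rect_targets r c) \<subseteq> vertices ?\<Sigma>" "set (rect_sources r c) \<subseteq> vertices ?\<Sigma>"
    using rc by (auto simp: rect_targets_def rect_sources_def rectangles_seed_simps)
  have K': "\<And>w. w \<in> set (rect_targets r c) \<Longrightarrow> x w \<in> entry_field (spurion_index_set n)"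
    "\<And>w. w \<in> set (rect_sources r c) \<Longrightarrow> x w \<in> entry_field (spurion_index_set n)"
    using sub K by blast+
  have lhs: "spurion_promotion (exchange_ratio ?\<Sigma> v) =
      prod_list (map (\<lambda>v. spurion_promotion (x v)) (rect_targets r c)) /
      prod_list (map (\<lambda>v. spurion_promotion (x v)) (rect_sources r c))"
    unfolding rc(1) exchange_ratio_rectangles[OF N rc(2-5), folded x_def]
    by (simp only: f_divide prod_list_K[OF K'(1)] prod_list_K[OF K'(2)])
  have rhs: "exchange_ratio (spurion_seed n) (shift v) =
      prod_list (map y (targets (V r (c + 4)) (spurion_quiver 11) @ filter far (rect_targets r (c + 4)))) /
      prod_list (map y (sources (V r (c + 4)) (spurion_quiver 11) @ filter far (rect_sources r (c + 4))))"
    unfolding rc(1) shift_def vertex.case y_def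
    by (rule exchange_ratio_spurion_seed[OF n rc(2,3) c])
  have nz: "y (V r c) \<noteq> 0" if "1 \<le> r" "r \<le> 4" "5 \<le> c" "c \<le> n" for r c
    unfolding y_def
    by (rule seed_positive_nonzero[OF positive_cone_vandermonde seed_positive_spurion_seed[OF n]])
      (use that in \<open>auto simp: spurion_seed_simps rectangles_seed_simps\<close>)
  \<comment> \<open>The variable at \<open>(4, 9)\<close> stands in numerator and denominator of the
    ratio at \<open>(3, 9)\<close> and has to be cancelled.\<close>
  have nz': "y (V 1 8) \<noteq> 0" "y (V 2 5) \<noteq> 0" "y (V 2 8) \<noteq> 0" "y (V 3 7) \<noteq> 0" "y (V 4 9) \<noteq> 0"
    by (rule nz; use n in simp)+
  note X = spurion_promotion_cluster[OF n, folded x_def y_def]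
  show ?thesis
  proof (cases "c = 5")
    case True
    then have n10: "10 \<le> n"
      using c by simp
    from rc(2,3) consider "r = 1" | "r = 2" | "r = 3"
      by linarith
    then show ?thesis
      unfolding lhs rhs using nz' n10 True
      by cases (simp_all add: rect_targets_def rect_sources_def far_def X[simplified] spurion_quiver_near[simplified] field_simps
          flip: numeral_2_eq_2 numeral_3_eq_3)
  next
    case False
    then obtain d where d: "c = Suc d" "5 \<le> d"
      using rc(4) by (metis Suc_leI le_neq_implies_less not_less_eq_eq not0_implies_Suc not_numeral_le_zero)
    have beyond: "10 \<le> c + 4"
      using d by simp
    have "Suc (Suc d) + 4 \<le> n"
      using c d by simp
    from rc(2,3) consider "r = 1" | "r = 2" | "r = 3"
      by linarith
    then show ?thesis
      unfolding lhs rhs spurion_quiver_beyond[OF beyond] using nz' d \<open>Suc (Suc d) + 4 \<le> n\<close>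
      by cases (simp_all add: rect_targets_def rect_sources_def far_def X[simplified] add.commute[of _ 4]
          flip: numeral_2_eq_2 numeral_3_eq_3)
  qed
qed

theorem theorem8p7:
  fixes n :: nat
  assumes "n \<ge> 9"
  shows "algebra_hom spurion_promotion (gr_field (spurion_index_set n)) (gr_field {1..n}) \<and>
         quasi_cluster_hom spurion_promotion
           (rectangles_seed (spurion_index_set n)) (spurion_seed n) \<and>
         cluster (spurion_seed n) ` spurion_frozen_vertices =
           {plucker [1, 2, 3, 6], plucker [1, 2, 3, 7], plucker [3, 7, 8, 9]} \<union>
           spurion_F ` {1..9}"
proof -
  interpret partial_field_hom spurion_promotion "entry_field (spurion_index_set n)"
    by (rule partial_field_hom_spurion)
  let ?\<Sigma> = "rectangles_seed (spurion_index_set n)" and ?M = "frozen_monomials (spurion_seed n)"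
  define x where "x = cluster ?\<Sigma>"
  define y where "y = cluster (spurion_seed n)"
  have N: "finite (spurion_index_set n)" "5 \<le> card (spurion_index_set n)"
    using assms by (simp_all add: card_spurion_index_set) (simp add: spurion_index_set_def)
  note ok = seed_ok_spurion_seed[OF assms] and pos = seed_positive_spurion_seed[OF assms]
  have fin: "finite (frozen (spurion_seed n))"
    using ok finite_subset by (auto simp: seed_ok_def)
  have "cluster (spurion_seed n) v \<noteq> 0" if "v \<in> frozen (spurion_seed n)" for v
    using that ok seed_positive_nonzero[OF positive_cone_vandermonde pos] by (auto simp: seed_ok_def)
  note M = frozen_monomials_props[OF fin this, folded y_def]
  have divide_M: "a / b \<in> ?M" if "a \<in> ?M" "b \<in> ?M" for a b
    unfolding divide_inverse using that by (intro M)
  \<comment> \<open>The variables frozen after the mutations supply all the correction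
    factors.\<close>
  have special: "y (V r c) \<in> ?M" if "1 \<le> r" "r \<le> 3" "5 \<le> c" "c \<le> 8" for r c
    using that by (intro M(4)) (auto simp: spurion_seed_simps spurion_frozen_vertices_def)
  note X = spurion_promotion_cluster[OF assms, folded x_def y_def]
  have mutable: "\<exists>m\<in>?M. spurion_promotion (x v) = m * y (shift v)" if v: "v \<in> mutable ?\<Sigma>" for v
  proof -
    obtain r c where rc: "v = V r c" "1 \<le> r" "r \<le> 3" "5 \<le> c" "c + 4 \<le> n"
      using v unfolding mutable_rectangles card_spurion_index_set[OF assms] by auto
    then consider "r = 1" | "r = 2" | "r = 3"
      by linarith
    then show ?thesis
    proof cases
      case 1
      have "y (V 3 7) / y (V 2 8) \<in> ?M"
        by (intro divide_M special) simp_all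
      then show ?thesis
        unfolding rc(1) 1 X(3)[OF rc(4,5)] shift_def vertex.case by (rule bexI[rotated]) simp
    next
      case 2
      show ?thesis
        unfolding rc(1) 2 X(4)[OF rc(4,5)] shift_def vertex.case by (rule bexI[OF _ M(1)]) simp
    next
      case 3
      show ?thesis
        unfolding rc(1) 3 X(5)[OF rc(4,5)] shift_def vertex.case by (rule bexI[OF _ M(1)]) simp
    qed
  qed
  have frozen: "spurion_promotion (x v) \<in> ?M" if v: "v \<in> frozen ?\<Sigma>" for v
  proof -
    \<comment> \<open>The vertices \<open>V_0\<close> and \<open>(4, 5)\<close> involve the gap in
      the labels; the rest of row 4 and the last column are simply translated, up to the factor in
      row 1.\<close>
    consider "v = V\<^sub>0" | "v = V 4 5" | c where "v = V 4 c" "6 \<le> c" "c + 4 \<le> n"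
      | r where "v = V r (n - 4)" "1 \<le> r" "r \<le> 3"
    proof -
      consider "v = V\<^sub>0" | r c where "v = V r c" "1 \<le> r" "r \<le> 4" "5 \<le> c" "c \<le> n - 4" "r = 4 \<or> c = n - 4"
        using v unfolding rectangles_seed_simps card_spurion_index_set[OF assms] by auto
      then show thesis
      proof cases
        case 2
        show thesis
        proof (cases "r = 4")
          case True
          show thesis
            using 2 True that(2) that(3)[of c] by (cases "c = 5") auto
        next
          case False
          show thesis
            using 2 False by (intro that(4)[of r]) auto
        qed
      qed (rule that(1))
    qed
    then show ?thesis
    proof cases
      case 1
      show ?thesis
        unfolding 1 X(1) by (intro divide_M M(2) special) simp_all
    next
      case 2
      show ?thesis
        unfolding 2 X(2) by (intro divide_M M(2) special) simp_all
    next
      case 3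
      have "y (V 4 (c + 4)) \<in> ?M"
        using 3 by (intro M(4)) (auto simp: spurion_seed_simps rectangles_seed_simps)
      then show ?thesis
        unfolding 3(1) X(6)[OF 3(2,3)] .
    next
      case 4
      \<comment> \<open>The last column of the first seed, number \<open>n - 4\<close>, is
        translated to the last column of the second, which is frozen as well.\<close>
      have last: "y (V r (n - 4 + 4)) \<in> ?M" if "1 \<le> r" "r \<le> 3" for r
        using assms that by (intro M(4)) (auto simp: spurion_seed_simps rectangles_seed_simps)
      have n4: "5 \<le> n - 4" "n - 4 + 4 \<le> n"
        using assms by simp_all
      from 4(2,3) consider "r = 1" | "r = 2" | "r = 3"
        by linarith
      then show ?thesis
        unfolding 4(1)
        by cases (simp_all only: X(3-5)[OF n4], (intro M(2) divide_M special last; simp)+)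
    qed
  qed
  have "matching ?M shift ?\<Sigma> (spurion_seed n)"
    unfolding matching_def
    using shift_bij[OF assms] mutable frozen spurion_promotion_exchange_ratio[OF assms] arrows_shift[OF assms] M(4)
    unfolding x_def y_def by blast
  moreover have "seed_in ?\<Sigma>"
    using cluster_rectangles_gr_field[OF N] gr_field_subset_entry_field unfolding seed_in_def by blast
  ultimately have "quasi_cluster_hom spurion_promotion ?\<Sigma> (spurion_seed n)"
    by (intro quasi_cluster_homI[OF _ seed_ok_rectangles ok positive_cone_vandermonde
          seed_positive_rectangles[OF N] positive_cone_vandermonde pos])
  then show ?thesis
    using algebra_hom_spurion_promotion[OF assms] cluster_spurion_frozen_vertices[OF assms] by blast
qed

end
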